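(* Let $I\neq\{0\}$ be a principal ideal. Then the am-$\infty$ stability of any one of the following ideals is equivalent to the am-$\infty$ stability of any other: $I$, ${}_{a_\infty}I$, $I^{o\infty}$, $I_{-\infty}$, $I^{oo\infty}$, $I_{a_\infty}$, and $I^{-\infty}$.
   Context: $H$ is a separable infinite-dimensional complex Hilbert space. "Ideal" means a two-sided ideal of $B(H)$ contained in the compact operators. $c_o^*$ is the set of nonnegative monotone nonincreasing sequences converging to $0$, and $(\ell^1)^*$ the set of summable sequences in $c_o^*$. $\Sigma(I):=\{s(X)\mid X\in I\}\subset c_o^*$, where $s(X)$ is the sequence of s-numbers (singular values) of $X$; $I\mapsto\Sigma(I)$ is an inclusion-preserving bijection between ideals and the hereditary (solid) subcones of $c_o^*$ invariant under the ampliations $D_m$, $(D_m\xi)_n:=\xi_{\lceil n/m\rceil}$, $m\in\mathbb N$. A principal ideal is one generated by a single operator. $\mathscr L_1$ is the trace class. $\omega=\langle 1/n\rangle$ is the harmonic sequence and $se(\omega)$ is the ideal with $\Sigma(se(\omega))=\{\xi\in c_o^*\mid\xi=o(\omega)\}$. For $\xi\in(\ell^1)^*$ put $(\xi_{a_\infty})_n:=\frac1n\sum_{j=n+1}^\infty\xi_j$. For an ideal $I$: ${}_{a_\infty}I$ is the ideal with $\Sigma({}_{a_\infty}I)=\{\xi\in(\ell^1)^*\mid\xi_{a_\infty}\in\Sigma(I)\}$; $I_{a_\infty}$ is the ideal with $\Sigma(I_{a_\infty})=\{\xi\in c_o^*\mid\xi=O(\eta_{a_\infty})\text{ for some }\eta\in\Sigma(I\cap\mathscr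 L_1)\}$; $I^{-\infty}:={}_{a_\infty}(I_{a_\infty})$; $I^{o\infty}:=({}_{a_\infty}I)_{a_\infty}$. $I$ is am-$\infty$ closed if $I=I^{-\infty}$ and am-$\infty$ open if $I=I^{o\infty}$. $I_{-\infty}$ is the largest am-$\infty$ closed ideal contained in $I$, and $I^{oo\infty}$ is the smallest am-$\infty$ open ideal containing $I\cap se(\omega)$. $I$ is am-$\infty$ stable if $I={}_{a_\infty}I$ (equivalently, $I\subset\mathscr L_1$ and $I=I_{a_\infty}$). *)

theory Defs
  imports "HOL-Analysis.Analysis" "HOL-Algebra.Ideal"
begin

section \<open>Complex Hilbert spaces\<close>

text \<open>The complex inner product is linear in its first argument. The real structure of the
  library (norm, topology, real inner product) is the underlying one: the real inner product is
  the real part of the complex one, so the norm of x is the square root of cinner x x.\<close>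

class complex_hilbert = real_inner + complete_space +
  fixes scaleC :: "complex \<Rightarrow> 'a \<Rightarrow> 'a" (infixr \<open>*\<^sub>C\<close> 75)
    and cinner :: "'a \<Rightarrow> 'a \<Rightarrow> complex"
  assumes scaleC_add_right: "a *\<^sub>C (x + y) = a *\<^sub>C x + a *\<^sub>C y"
    and scaleC_add_left: "(a + b) *\<^sub>C x = a *\<^sub>C x + b *\<^sub>C x"
    and scaleC_scaleC: "a *\<^sub>C b *\<^sub>C x = (a * b) *\<^sub>C x"
    and scaleC_of_real: "complex_of_real r *\<^sub>C x = r *\<^sub>R x"
    and cinner_commute: "cinner x y = cnj (cinner y x)"
    and cinner_add_left: "cinner (x + y) z = cinner x z + cinner y z"
    and cinner_scaleC_left: "cinner (a *\<^sub>C x) y = a * cinner x y"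
    and Re_cinner: "Re (cinner x y) = inner x y"

global_interpretation complex_vector: vector_space "scaleC :: complex \<Rightarrow> 'a \<Rightarrow> 'a::complex_hilbert"
  defines cspan = complex_vector.span
    and cdim = complex_vector.dim
proof
  show "1 *\<^sub>C x = x" for x :: 'a
    using scaleC_of_real[of 1 x] by simp
qed (rule scaleC_add_right scaleC_add_left scaleC_scaleC)+


section \<open>The ring B(H), compact operators, s-numbers\<close>

definition BH :: "('h::complex_hilbert \<Rightarrow>\<^sub>L 'h) ring" where
  "BH = \<lparr>carrier = {T. \<forall>c x. blinfun_apply T (c *\<^sub>C x) = c *\<^sub>C blinfun_apply T x},
         monoid.mult = (o\<^sub>L), one = id_blinfun, zero = 0, add = (+)\<rparr>"

lemma ring_BH: "ring (BH :: ('h::complex_hilbert \<Rightarrow>\<^sub>L 'h) ring)"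
proof (intro ringI abelian_groupI monoidI)
  fix T :: "'h \<Rightarrow>\<^sub>L 'h" assume T: "T \<in> carrier BH"
  have neg: "c *\<^sub>C (- x) = - (c *\<^sub>C x)" for c and x :: 'h
    by (rule complex_vector.scale_minus_right)
  have "- T \<in> carrier BH" using T by (simp add: BH_def blinfun.minus_left neg)
  moreover have "(- T) \<oplus>\<^bsub>BH\<^esub> T = \<zero>\<^bsub>BH\<^esub>" by (simp add: BH_def)
  ultimately show "\<exists>S\<in>carrier BH. S \<oplus>\<^bsub>BH\<^esub> T = \<zero>\<^bsub>BH\<^esub>" by blast
qed (auto simp: BH_def blinfun.add_left blinfun.add_right scaleC_add_right
      intro!: blinfun_eqI)

definition compact_ops :: "('h::complex_hilbert \<Rightarrow>\<^sub>L 'h) set" where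
  "compact_ops = {T \<in> carrier BH. compact (closure (blinfun_apply T ` cball 0 1))}"

definition cadjoint :: "('h::complex_hilbert \<Rightarrow>\<^sub>L 'h) \<Rightarrow> ('h \<Rightarrow>\<^sub>L 'h)" where
  "cadjoint T = (THE S. \<forall>x y. cinner (blinfun_apply T x) y = cinner x (blinfun_apply S y))"

text \<open>The s-numbers of a compact operator T are the square roots of the nonzero eigenvalues of
  T*T, in nonincreasing order and repeated according to multiplicity, followed by zeros if there
  are only finitely many. All sequences are indexed from 0, so that the n-th term in the usual
  numbering from 1 is the value at n - 1.\<close>

definition s_numbers :: "('h::complex_hilbert \<Rightarrow>\<^sub>L 'h) \<Rightarrow> nat \<Rightarrow> real" where
  "s_numbers T = (THE s. decseq s \<and> s \<longlonglongrightarrow> 0 \<and>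
     (\<forall>t>0. card {n. s n = t} =
        cdim {x. blinfun_apply (cadjoint T o\<^sub>L T) x = complex_of_real (t\<^sup>2) *\<^sub>C x}))"

definition trace_class :: "('h::complex_hilbert \<Rightarrow>\<^sub>L 'h) set" where
  "trace_class = {T \<in> compact_ops. summable (s_numbers T)}"


section \<open>Operator ideals and their characteristic sets\<close>

definition c0_star :: "(nat \<Rightarrow> real) set" where
  "c0_star = {\<xi>. (\<forall>n. 0 \<le> \<xi> n) \<and> decseq \<xi> \<and> \<xi> \<longlonglongrightarrow> 0}"

definition l1_star :: "(nat \<Rightarrow> real) set" where
  "l1_star = {\<xi> \<in> c0_star. summable \<xi>}"

definition op_ideal :: "('h::complex_hilbert \<Rightarrow>\<^sub>L 'h) set \<Rightarrow> bool" where
  "op_ideal I \<longleftrightarrow> ideal I BH \<and> I \<subseteq> compact_ops"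

definition principal_op_ideal :: "('h::complex_hilbert \<Rightarrow>\<^sub>L 'h) set \<Rightarrow> bool" where
  "principal_op_ideal I \<longleftrightarrow> principalideal I BH \<and> I \<subseteq> compact_ops"

definition char_set :: "('h::complex_hilbert \<Rightarrow>\<^sub>L 'h) set \<Rightarrow> (nat \<Rightarrow> real) set" where
  "char_set I = s_numbers ` I"

definition ideal_with :: "(nat \<Rightarrow> real) set \<Rightarrow> ('h::complex_hilbert \<Rightarrow>\<^sub>L 'h) set" where
  "ideal_with S = (THE J. op_ideal J \<and> char_set J = S)"

definition harmonic :: "nat \<Rightarrow> real" where
  "harmonic n = 1 / real (Suc n)"

definition se_harmonic :: "('h::complex_hilbert \<Rightarrow>\<^sub>L 'h) set" where
  "se_harmonic = ideal_with {\<xi> \<in> c0_star. \<xi> \<in> o(harmonic)}"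


section \<open>Arithmetic means at infinity\<close>

text \<open>With indices from 1 this is the mean (1/n) times the sum of the terms with index j > n;
  here k = n - 1.\<close>

definition am_inf :: "(nat \<Rightarrow> real) \<Rightarrow> nat \<Rightarrow> real" where
  "am_inf \<xi> k = (\<Sum>j. \<xi> (j + Suc k)) / real (Suc k)"

definition pre_am_inf :: "('h::complex_hilbert \<Rightarrow>\<^sub>L 'h) set \<Rightarrow> ('h \<Rightarrow>\<^sub>L 'h) set" where
  "pre_am_inf I = ideal_with {\<xi> \<in> l1_star. am_inf \<xi> \<in> char_set I}"

text \<open>The Landau relation only concerns large n. Domination for all n gives the same set for
  every nonzero I: all finitely supported sequences then lie in char_set I.\<close>

definition am_inf_ideal :: "('h::complex_hilbert \<Rightarrow>\<^sub>L 'h) set \<Rightarrow> ('h \<Rightarrow>\<^sub>L 'h) set" where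
  "am_inf_ideal I =
     ideal_with {\<xi> \<in> c0_star. \<exists>\<eta> \<in> char_set (I \<inter> trace_class). \<xi> \<in> O(am_inf \<eta>)}"

definition am_inf_closure :: "('h::complex_hilbert \<Rightarrow>\<^sub>L 'h) set \<Rightarrow> ('h \<Rightarrow>\<^sub>L 'h) set" where
  "am_inf_closure I = pre_am_inf (am_inf_ideal I)"

definition am_inf_interior :: "('h::complex_hilbert \<Rightarrow>\<^sub>L 'h) set \<Rightarrow> ('h \<Rightarrow>\<^sub>L 'h) set" where
  "am_inf_interior I = am_inf_ideal (pre_am_inf I)"

definition am_inf_closed :: "('h::complex_hilbert \<Rightarrow>\<^sub>L 'h) set \<Rightarrow> bool" where
  "am_inf_closed I \<longleftrightarrow> op_ideal I \<and> I = am_inf_closure I"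

definition am_inf_open :: "('h::complex_hilbert \<Rightarrow>\<^sub>L 'h) set \<Rightarrow> bool" where
  "am_inf_open I \<longleftrightarrow> op_ideal I \<and> I = am_inf_interior I"

definition am_inf_stable :: "('h::complex_hilbert \<Rightarrow>\<^sub>L 'h) set \<Rightarrow> bool" where
  "am_inf_stable I \<longleftrightarrow> op_ideal I \<and> I = pre_am_inf I"

text \<open>GREATEST and LEAST refer to inclusion of ideals.\<close>

definition largest_closed_below :: "('h::complex_hilbert \<Rightarrow>\<^sub>L 'h) set \<Rightarrow> ('h \<Rightarrow>\<^sub>L 'h) set" where
  "largest_closed_below I = (GREATEST J. am_inf_closed J \<and> J \<subseteq> I)"

definition smallest_open_above :: "('h::complex_hilbert \<Rightarrow>\<^sub>L 'h) set \<Rightarrow> ('h \<Rightarrow>\<^sub>L 'h) set" where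
  "smallest_open_above I = (LEAST J. am_inf_open J \<and> I \<inter> se_harmonic \<subseteq> J)"

end

theory Submission
  imports Defs
begin

text \<open>By Calkin's correspondence an ideal is determined by the s-number sequences of its members, so
  the statement becomes one about hereditary cones of sequences. The correspondence rests on the
  decomposition of a compact operator as a sum of \<open>s n\<close> times matrix units, obtained greedily from norm
  maximisers, and on a minimax bound for s-numbers.

  On sequences, the passage to means at infinity and its inverse image form a Galois connection.
  This alone makes the stability of the pre-am-infinity ideal equivalent to that of the interior, and
  the stability of the am-infinity ideal to that of the closure. For an ideal generated by \<open>\<xi>\<close>
  the largest closed ideal below is the pre-am-infinity ideal; for any ideal, the smallest open ideal
  above consists of the sequences dominated by sup over k \<open>\<ge>\<close> n of \<open>(k + 1) \<eta> k\<close>, divided by n + 1.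

  It remains to see that stability of a derived ideal forces stability of the principal one. The
  derived ideal contains a sequence \<open>\<mu>\<close> tied to \<open>\<xi>\<close> for which \<open>(n + 1) \<mu>\<close> is nonincreasing, and
  stability makes \<open>(n + 1) \<mu>\<close> drop by a factor 2 between n and K n. This decay shows that \<open>\<xi>\<close> and
  \<open>\<mu>\<close> dominate each other, so the two ideals coincide. In the degenerate cases (\<open>\<xi>\<close> not summable, or
  above the harmonic sequence) a sequence with tails 1 / ln n contradicts stability.\<close>

text \<open>Why decay follows: if g n = (n + 1) \<mu> n is nonincreasing, then \<mu> j = g j / (j +
  1), and stability bounds the sum of g j / (j + 1) over j > n by a multiple of g at an ampliated
  index. The harmonic weights of each dyadic block have a sum bounded below, so g has to drop. The
  obstacle is that (n + 1) \<xi> n need not be monotone, so this cannot be applied to \<xi>. Each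
  derived ideal sees \<xi> through a regularisation of its own: the pre-am-infinity ideal through
  the largest nonincreasing minorant of (n + 1) \<xi> n, the am-infinity ideal through the tails of
  \<xi>, the smallest open ideal through the least nonincreasing majorant. That the minorant and the
  majorant lead to members of the derived ideals at all rests on \<open>convexification\<close>: if
  g is nonincreasing and tends to 0, then \<mu> is, up to an ampliation, a mean at infinity. The
  degenerate cases are those where the tails do not exist or the regularised g does not tend to
  0.\<close>

instance complex_hilbert \<subseteq> banach ..

section \<open>Complex inner product spaces\<close>

lemma cinner_add_right: "cinner x (y + z) = cinner x y + cinner x (z :: 'h::complex_hilbert)"
  by (metis cinner_add_left cinner_commute complex_cnj_add)

lemma cinner_scaleC_right: "cinner x (a *\<^sub>C y) = cnj a * cinner x (y :: 'h::complex_hilbert)"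
  by (metis cinner_commute cinner_scaleC_left complex_cnj_mult)

lemma cinner_self: "cinner x x = complex_of_real ((norm x)\<^sup>2)" for x :: "'h::complex_hilbert"
proof -
  have "cnj (cinner x x) = cinner x x" by (metis cinner_commute)
  then have "Im (cinner x x) = 0" by (simp add: complex_eq_iff)
  then show ?thesis by (simp add: complex_eq_iff Re_cinner power2_norm_eq_inner)
qed

lemma norm_scaleC: "norm (a *\<^sub>C x) = cmod a * norm (x :: 'h::complex_hilbert)"
proof -
  have "complex_of_real ((norm (a *\<^sub>C x))\<^sup>2) = complex_of_real ((cmod a * norm x)\<^sup>2)"
    unfolding cinner_self[symmetric] cinner_scaleC_left cinner_scaleC_right
    using complex_norm_square[of a] by (simp add: cinner_self power_mult_distrib mult.commute)
  then have "(norm (a *\<^sub>C x))\<^sup>2 = (cmod a * norm x)\<^sup>2"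
    using of_real_eq_iff by blast
  then show ?thesis by simp
qed

lemma norm_cinner_le: "cmod (cinner x y) \<le> norm x * norm (y :: 'h::complex_hilbert)"
proof (cases "cinner x y = 0")
  case False
  \<comment> \<open>A unimodular factor that turns the inner product into its modulus, so that the
    real Cauchy-Schwarz inequality applies.\<close>
  define a where "a = cnj (cinner x y) / cmod (cinner x y)"
  have a: "cmod a = 1" using False by (simp add: a_def norm_divide)
  have "cinner (a *\<^sub>C x) y = cnj (cinner x y) * cinner x y / cmod (cinner x y)"
    by (simp add: cinner_scaleC_left a_def)
  also have "\<dots> = complex_of_real (cmod (cinner x y))"
    using False complex_norm_square[of "cinner x y"]
    by (simp add: power2_eq_square field_simps)
  finally have "cmod (cinner x y) = Re (cinner (a *\<^sub>C x) y)" by simp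
  also have "\<dots> = inner (a *\<^sub>C x) y" by (rule Re_cinner)
  also have "\<dots> \<le> norm (a *\<^sub>C x) * norm y" by (rule norm_cauchy_schwarz)
  finally show ?thesis by (simp add: norm_scaleC a)
qed auto

lemma scaleR_eq_scaleC: "r *\<^sub>R x = complex_of_real r *\<^sub>C (x :: 'h::complex_hilbert)"
  by (simp add: scaleC_of_real)

lemma bounded_bilinear_cinner: "bounded_bilinear (cinner :: 'h::complex_hilbert \<Rightarrow> 'h \<Rightarrow> complex)"
proof
  show "\<exists>K. \<forall>a b. norm (cinner a b) \<le> norm a * norm (b::'h) * K"
    using norm_cinner_le by (metis mult.right_neutral)
qed (simp_all add: cinner_add_left cinner_add_right scaleR_eq_scaleC cinner_scaleC_left
  cinner_scaleC_right scaleR_conv_of_real)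

lemma bounded_bilinear_scaleC: "bounded_bilinear (scaleC :: complex \<Rightarrow> 'h::complex_hilbert \<Rightarrow> 'h)"
proof
  show "\<exists>K. \<forall>a b. norm (a *\<^sub>C (b::'h)) \<le> norm a * norm b * K"
    by (intro exI[of _ 1]) (simp add: norm_scaleC)
qed (simp_all add: scaleC_add_left scaleC_add_right scaleR_eq_scaleC scaleC_scaleC
    scaleR_conv_of_real mult.commute)

interpretation cinner: bounded_bilinear "cinner :: 'h::complex_hilbert \<Rightarrow> 'h \<Rightarrow> complex"
  by (rule bounded_bilinear_cinner)

interpretation scaleC: bounded_bilinear "scaleC :: complex \<Rightarrow> 'h::complex_hilbert \<Rightarrow> 'h"
  by (rule bounded_bilinear_scaleC)

lemma cinner_eq_0_sym: "cinner x y = 0 \<longleftrightarrow> cinner y (x :: 'h::complex_hilbert) = 0"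
  by (metis cinner_commute complex_cnj_zero_iff)

lemma norm_add_orthogonal_sq:
  fixes x y :: "'h::complex_hilbert"
  assumes "cinner x y = 0" shows "(norm (x + y))\<^sup>2 = (norm x)\<^sup>2 + (norm y)\<^sup>2"
proof -
  have "inner x y = 0" using assms by (simp flip: Re_cinner)
  then show ?thesis by (simp add: power2_norm_eq_inner inner_add_left inner_add_right inner_commute)
qed

section \<open>Orthonormal sequences\<close>

definition ortho_seq :: "(nat \<Rightarrow> 'h::complex_hilbert) \<Rightarrow> bool" where
  "ortho_seq e \<longleftrightarrow> (\<forall>m n. cinner (e m) (e n) = (if m = n then 1 else 0))"

lemma ortho_seqD:
  assumes "ortho_seq e"
  shows "cinner (e m) (e n) = (if m = n then 1 else 0)" "norm (e n) = 1"
proof -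
  show *: "cinner (e m) (e n) = (if m = n then 1 else 0)" for m n
    using assms by (simp add: ortho_seq_def)
  have "complex_of_real ((norm (e n))\<^sup>2) = 1" using *[of n n] by (simp add: cinner_self)
  then have "(norm (e n))\<^sup>2 = 1" using of_real_eq_1_iff by blast
  then show "norm (e n) = 1" using power2_eq_imp_eq[of "norm (e n)" 1] by simp
qed

lemma cinner_sum_ortho:
  assumes "ortho_seq e" "finite A"
  shows "cinner (\<Sum>n\<in>A. a n *\<^sub>C e n) (e k) = (if k \<in> A then a k else 0)"
  using assms by (simp add: cinner.sum_left cinner_scaleC_left ortho_seqD(1) if_distrib sum.delta cong: if_cong)

lemma norm_sum_ortho:
  assumes "ortho_seq e" "finite A"
  shows "(norm (\<Sum>n\<in>A. a n *\<^sub>C e n))\<^sup>2 = (\<Sum>n\<in>A. (cmod (a n))\<^sup>2)"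
  using assms(2)
proof induction
  case (insert n A)
  have "cinner (\<Sum>n\<in>A. a n *\<^sub>C e n) (e n) = 0"
    using insert by (simp add: cinner_sum_ortho assms)
  then have "cinner (a n *\<^sub>C e n) (\<Sum>n\<in>A. a n *\<^sub>C e n) = 0"
    by (simp add: cinner_scaleC_left cinner_eq_0_sym)
  then show ?case
    using insert by (simp add: norm_add_orthogonal_sq norm_scaleC ortho_seqD(2)[OF assms(1)])
qed simp

lemma bessel_finite:
  assumes e: "ortho_seq e" and A: "finite A"
  shows "(\<Sum>n\<in>A. (cmod (cinner x (e n)))\<^sup>2) \<le> (norm x)\<^sup>2"
proof -
  define p where "p = (\<Sum>n\<in>A. cinner x (e n) *\<^sub>C e n)"
  have "cinner (x - p) (e n) = 0" if "n \<in> A" for n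
    using that by (simp add: p_def cinner.diff_left cinner_sum_ortho[OF e A])
  then have "cinner (x - p) p = 0"
    by (simp add: p_def cinner.sum_right cinner_scaleC_right)
  then have "(norm (x - p + p))\<^sup>2 = (norm (x - p))\<^sup>2 + (norm p)\<^sup>2"
    by (rule norm_add_orthogonal_sq)
  then have "(norm p)\<^sup>2 \<le> (norm x)\<^sup>2" by simp
  then show ?thesis by (simp add: p_def norm_sum_ortho[OF e A])
qed

lemma bessel:
  assumes e: "ortho_seq e"
  shows "summable (\<lambda>n. (cmod (cinner x (e n)))\<^sup>2)" "(\<Sum>n. (cmod (cinner x (e n)))\<^sup>2) \<le> (norm x)\<^sup>2"
proof -
  show s: "summable (\<lambda>n. (cmod (cinner x (e n)))\<^sup>2)"
    by (rule summableI_nonneg_bounded[where x = "(norm x)\<^sup>2"]) (auto intro: bessel_finite e)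
  show "(\<Sum>n. (cmod (cinner x (e n)))\<^sup>2) \<le> (norm x)\<^sup>2"
    by (rule suminf_le_const[OF s]) (auto intro: bessel_finite e)
qed

text \<open>Riesz-Fischer: by Pythagoras a block of the vector series has as squared norm the same
  block of the scalar series, so the Cauchy criterion passes from one to the other.\<close>

lemma summable_ortho:
  assumes e: "ortho_seq e" and a: "summable (\<lambda>n. (cmod (a n))\<^sup>2)"
  shows "summable (\<lambda>n. a n *\<^sub>C e n)"
    and "(norm (\<Sum>n. a n *\<^sub>C e n))\<^sup>2 = (\<Sum>n. (cmod (a n))\<^sup>2)"
    and "cinner (\<Sum>n. a n *\<^sub>C e n) (e k) = a k"
proof -
  show s: "summable (\<lambda>n. a n *\<^sub>C e n)"
    unfolding summable_Cauchy
  proof (intro allI impI)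
    fix r :: real assume r: "0 < r"
    then have "0 < r\<^sup>2" by simp
    then obtain N where N: "\<And>m n. m \<ge> N \<Longrightarrow> norm (\<Sum>k=m..<n. (cmod (a k))\<^sup>2) < r\<^sup>2"
      using a unfolding summable_Cauchy by meson
    have "norm (\<Sum>k=m..<n. a k *\<^sub>C e k) < r" if "m \<ge> N" for m n
    proof -
      have "(norm (\<Sum>k=m..<n. a k *\<^sub>C e k))\<^sup>2 < r\<^sup>2"
        using N[OF that, of n] by (simp add: norm_sum_ortho[OF e])
      then show ?thesis using r by (simp add: power_less_imp_less_base)
    qed
    then show "\<exists>N. \<forall>m\<ge>N. \<forall>n. norm (\<Sum>k=m..<n. a k *\<^sub>C e k) < r" by blast
  qed
  then have lim: "(\<lambda>N. \<Sum>n<N. a n *\<^sub>C e n) \<longlonglongrightarrow> (\<Sum>n. a n *\<^sub>C e n)"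
    by (rule summable_LIMSEQ)
  have "(\<lambda>N. (norm (\<Sum>n<N. a n *\<^sub>C e n))\<^sup>2) \<longlonglongrightarrow> (norm (\<Sum>n. a n *\<^sub>C e n))\<^sup>2"
    by (intro tendsto_intros lim)
  moreover have "(\<lambda>N. (norm (\<Sum>n<N. a n *\<^sub>C e n))\<^sup>2) \<longlonglongrightarrow> (\<Sum>n. (cmod (a n))\<^sup>2)"
    using summable_LIMSEQ[OF a] by (simp add: norm_sum_ortho[OF e])
  ultimately show "(norm (\<Sum>n. a n *\<^sub>C e n))\<^sup>2 = (\<Sum>n. (cmod (a n))\<^sup>2)"
    by (rule LIMSEQ_unique)
  have "(\<lambda>N. cinner (\<Sum>n<N. a n *\<^sub>C e n) (e k)) \<longlonglongrightarrow> cinner (\<Sum>n. a n *\<^sub>C e n) (e k)"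
    by (intro cinner.tendsto tendsto_const lim)
  moreover have "(\<lambda>N. cinner (\<Sum>n<N. a n *\<^sub>C e n) (e k)) \<longlonglongrightarrow> a k"
    by (rule tendsto_eventually) (auto simp: cinner_sum_ortho[OF e] eventually_sequentially intro!: exI[of _ "Suc k"])
  ultimately show "cinner (\<Sum>n. a n *\<^sub>C e n) (e k) = a k"
    by (rule LIMSEQ_unique)
qed

section \<open>Diagonal operators\<close>

text \<open>Sends \<open>e n\<close> to \<open>s n\<close> times \<open>f n\<close> and kills the
  orthogonal complement of all \<open>e n\<close>. \<open>Blinfun\<close> says something only if the
  series is a bounded linear map; hence the standing assumptions of orthonormality and boundedness
  below.\<close>

definition diag_op :: "(nat \<Rightarrow> real) \<Rightarrow> (nat \<Rightarrow> 'h::complex_hilbert) \<Rightarrow> (nat \<Rightarrow> 'h) \<Rightarrow> 'h \<Rightarrow>\<^sub>L 'h" where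
  "diag_op s e f = Blinfun (\<lambda>x. \<Sum>n. (complex_of_real (s n) * cinner x (e n)) *\<^sub>C f n)"

context
  fixes s :: "nat \<Rightarrow> real" and e f :: "nat \<Rightarrow> 'h::complex_hilbert" and B :: real
  assumes e: "ortho_seq e" and f: "ortho_seq f" and B: "\<forall>n. \<bar>s n\<bar> \<le> B"
begin

lemma diag_coeff_le: "(cmod (complex_of_real (s n) * cinner x (e n)))\<^sup>2 \<le> B\<^sup>2 * (cmod (cinner x (e n)))\<^sup>2"
  using B[rule_format, of n] by (simp add: norm_mult power_mult_distrib) (metis abs_ge_zero abs_le_square_iff abs_of_nonneg mult_right_mono order.trans zero_le_power2)

lemma diag_coeff_summable: "summable (\<lambda>n. (cmod (complex_of_real (s n) * cinner x (e n)))\<^sup>2)"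
  by (rule summable_comparison_test'[where g = "\<lambda>n. B\<^sup>2 * (cmod (cinner x (e n)))\<^sup>2" and N = 0])
     (auto intro: summable_mult bessel e simp del: norm_mult simp: diag_coeff_le)

lemma diag_summable: "summable (\<lambda>n. (complex_of_real (s n) * cinner x (e n)) *\<^sub>C f n)"
  by (rule summable_ortho(1)[OF f diag_coeff_summable])

lemma norm_diag_series_le: "norm (\<Sum>n. (complex_of_real (s n) * cinner x (e n)) *\<^sub>C f n) \<le> B * norm x"
proof -
  have B0: "0 \<le> B" using B[rule_format, of 0] by simp
  have "(norm (\<Sum>n. (complex_of_real (s n) * cinner x (e n)) *\<^sub>C f n))\<^sup>2
      = (\<Sum>n. (cmod (complex_of_real (s n) * cinner x (e n)))\<^sup>2)"
    by (rule summable_ortho(2)[OF f diag_coeff_summable])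
  also have "\<dots> \<le> (\<Sum>n. B\<^sup>2 * (cmod (cinner x (e n)))\<^sup>2)"
    by (intro suminf_le diag_coeff_le diag_coeff_summable summable_mult bessel(1) e)
  also have "\<dots> = B\<^sup>2 * (\<Sum>n. (cmod (cinner x (e n)))\<^sup>2)"
    by (rule suminf_mult[OF bessel(1)[OF e]])
  also have "\<dots> \<le> B\<^sup>2 * (norm x)\<^sup>2" by (intro mult_left_mono bessel(2) e) simp
  finally show ?thesis using B0 by (simp flip: power_mult_distrib)
qed

lemma diag_op_apply: "blinfun_apply (diag_op s e f) x = (\<Sum>n. (complex_of_real (s n) * cinner x (e n)) *\<^sub>C f n)"
proof -
  have "bounded_linear (\<lambda>x. \<Sum>n. (complex_of_real (s n) * cinner x (e n)) *\<^sub>C f n)"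
  proof (rule bounded_linear_intro[where K = B])
    show "norm (\<Sum>n. (complex_of_real (s n) * cinner x (e n)) *\<^sub>C f n) \<le> norm x * B" for x
      using norm_diag_series_le[of x] by (simp add: mult.commute)
    show "(\<Sum>n. (complex_of_real (s n) * cinner (x + y) (e n)) *\<^sub>C f n)
        = (\<Sum>n. (complex_of_real (s n) * cinner x (e n)) *\<^sub>C f n)
        + (\<Sum>n. (complex_of_real (s n) * cinner y (e n)) *\<^sub>C f n)" for x y
      by (subst suminf_add[OF diag_summable diag_summable])
         (simp add: cinner_add_left distrib_left scaleC_add_left)
    show "(\<Sum>n. (complex_of_real (s n) * cinner (r *\<^sub>R x) (e n)) *\<^sub>C f n)
        = r *\<^sub>R (\<Sum>n. (complex_of_real (s n) * cinner x (e n)) *\<^sub>C f n)" for r x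
      by (subst suminf_scaleR_right[OF diag_summable])
         (simp add: cinner.scaleR_left scaleR_eq_scaleC scaleC_scaleC scaleR_conv_of_real mult_ac
           cinner_scaleC_left)
  qed
  then show ?thesis by (simp add: diag_op_def bounded_linear_Blinfun_apply)
qed

lemma norm_diag_op_le: "norm (blinfun_apply (diag_op s e f) x) \<le> B * norm x"
  unfolding diag_op_apply by (rule norm_diag_series_le)

lemma cinner_diag_op: "cinner (blinfun_apply (diag_op s e f) x) (f n) = s n * cinner x (e n)"
  unfolding diag_op_apply by (rule summable_ortho(3)[OF f diag_coeff_summable])

lemma diag_op_basis: "blinfun_apply (diag_op s e f) (e k) = complex_of_real (s k) *\<^sub>C f k"
proof -
  have "(\<lambda>n. (complex_of_real (s n) * cinner (e k) (e n)) *\<^sub>C f n)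
      = (\<lambda>n. if n = k then complex_of_real (s k) *\<^sub>C f k else 0)"
    by (auto simp: ortho_seqD(1)[OF e] fun_eq_iff)
  then show ?thesis unfolding diag_op_apply
    using sums_single[of k "\<lambda>n. complex_of_real (s n) *\<^sub>C f n"] by (simp add: sums_iff cong: if_cong)
qed

lemma diag_op_carrier: "diag_op s e f \<in> carrier BH"
proof -
  have "(\<Sum>n. (complex_of_real (s n) * cinner (c *\<^sub>C x) (e n)) *\<^sub>C f n)
      = c *\<^sub>C (\<Sum>n. (complex_of_real (s n) * cinner x (e n)) *\<^sub>C f n)" for c x
    by (subst bounded_linear.suminf[OF scaleC.bounded_linear_right diag_summable])
       (simp add: cinner_scaleC_left scaleC_scaleC mult.left_commute)
  then show ?thesis by (simp add: BH_def diag_op_apply)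
qed

end

lemma BseqE_abs:
  assumes "Bseq s" obtains B :: real where "\<forall>n. \<bar>s n :: real\<bar> \<le> B"
  using assms by (auto simp: Bseq_def)

lemma diag_op_compose:
  fixes e :: "nat \<Rightarrow> 'h::complex_hilbert"
  assumes e: "ortho_seq e" and f: "ortho_seq f" and g: "ortho_seq g"
    and s: "Bseq s" and t: "Bseq t"
  shows "diag_op s f g o\<^sub>L diag_op t e f = diag_op (\<lambda>n. s n * t n) e g"
proof -
  obtain B where B: "\<forall>n. \<bar>s n\<bar> \<le> B" using s BseqE_abs by blast
  obtain C where C: "\<forall>n. \<bar>t n\<bar> \<le> C" using t BseqE_abs by blast
  have "\<forall>n. \<bar>s n * t n\<bar> \<le> B * C"
    unfolding abs_mult using B C by (meson abs_ge_zero mult_mono order.trans)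
  note D = diag_op_apply[OF e g this]
  show ?thesis
    by (intro blinfun_eqI)
       (simp add: D diag_op_apply[OF f g B] cinner_diag_op[OF e f C] mult.assoc)
qed

lemma diag_op_add:
  fixes e :: "nat \<Rightarrow> 'h::complex_hilbert"
  assumes e: "ortho_seq e" and f: "ortho_seq f" and s: "Bseq s" and t: "Bseq t"
  shows "diag_op s e f + diag_op t e f = diag_op (\<lambda>n. s n + t n) e f"
proof -
  obtain B where B: "\<forall>n. \<bar>s n\<bar> \<le> B" using s BseqE_abs by blast
  obtain C where C: "\<forall>n. \<bar>t n\<bar> \<le> C" using t BseqE_abs by blast
  have "\<forall>n. \<bar>s n + t n\<bar> \<le> B + C" using B C by (meson abs_triangle_ineq add_mono order.trans)
  note D = diag_op_apply[OF e f this]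
  show ?thesis
    by (intro blinfun_eqI)
      (simp add: D plus_blinfun.rep_eq distrib_right scaleC_add_left suminf_add
        diag_op_apply[OF e f B] diag_op_apply[OF e f C]
        diag_summable[OF e f B] diag_summable[OF e f C])
qed

lemma c0_starD:
  assumes "s \<in> c0_star"
  shows "0 \<le> s n" "decseq s" "s \<longlonglongrightarrow> 0" "Bseq s" "\<bar>s n\<bar> \<le> s 0"
proof -
  show 1: "0 \<le> s n" "decseq s" "s \<longlonglongrightarrow> 0" for n using assms by (auto simp: c0_star_def)
  show "Bseq s" using 1(3) by (rule convergent_imp_Bseq[OF convergentI])
  show "\<bar>s n\<bar> \<le> s 0" using 1 by (simp add: decseq_def)
qed

lemma c0_starI:
  assumes "\<And>n. 0 \<le> s n" "\<And>n. s (Suc n) \<le> s n" "s \<longlonglongrightarrow> 0" shows "s \<in> c0_star"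
  using assms by (auto simp: c0_star_def decseq_Suc_iff)

section \<open>s-numbers of diagonal operators\<close>

lemma cadjoint_diag_op:
  fixes e :: "nat \<Rightarrow> 'h::complex_hilbert"
  assumes e: "ortho_seq e" and f: "ortho_seq f" and s: "Bseq s"
  shows "cadjoint (diag_op s e f) = diag_op s f e"
  unfolding cadjoint_def
proof (rule the_equality)
  obtain B where B: "\<forall>n. \<bar>s n\<bar> \<le> B" using s BseqE_abs by blast
  show *: "\<forall>x y. cinner (blinfun_apply (diag_op s e f) x) y = cinner x (blinfun_apply (diag_op s f e) y)"
  proof (intro allI)
    fix x y :: 'h
    have "cinner (blinfun_apply (diag_op s e f) x) y
        = (\<Sum>n. s n * cinner x (e n) * cinner (f n) y)"
      unfolding diag_op_apply[OF e f B]
      by (subst bounded_linear.suminf[OF cinner.bounded_linear_left diag_summable[OF e f B]])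
         (simp add: cinner_scaleC_left)
    also have "\<dots> = (\<Sum>n. s n * cnj (cinner y (f n)) * cinner x (e n))"
      by (metis (no_types, lifting) cinner_commute mult.assoc mult.commute)
    also have "\<dots> = cinner x (blinfun_apply (diag_op s f e) y)"
      unfolding diag_op_apply[OF f e B]
      by (subst bounded_linear.suminf[OF cinner.bounded_linear_right diag_summable[OF f e B]])
         (simp add: cinner_scaleC_right)
    finally show "cinner (blinfun_apply (diag_op s e f) x) y = cinner x (blinfun_apply (diag_op s f e) y)" .
  qed
  fix S assume S: "\<forall>x y. cinner (blinfun_apply (diag_op s e f) x) y = cinner x (blinfun_apply S y)"
  have "cinner x (blinfun_apply S y - blinfun_apply (diag_op s f e) y) = 0" for x y
    using S * by (simp add: cinner.diff_right)
  then have "blinfun_apply S y - blinfun_apply (diag_op s f e) y = 0" for y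
    by (metis cinner_self of_real_eq_0_iff norm_eq_zero power_eq_0_iff)
  then show "S = diag_op s f e" by (intro blinfun_eqI) simp
qed

text \<open>Gives uniqueness in \<open>s_numbers\<close>. At the first index where the sequences
  differ, the larger value is attained by one of them, while the other can attain it only earlier,
  where both agree; so the multiplicities differ. They are finite since the value is
  positive.\<close>

lemma decseq_eq_if_card_eq:
  fixes s t :: "nat \<Rightarrow> real"
  assumes s: "decseq s" "s \<longlonglongrightarrow> 0" and t: "decseq t" "t \<longlonglongrightarrow> 0"
    and eq: "\<And>r. r > 0 \<Longrightarrow> card {n. s n = r} = card {n. t n = r}"
  shows "s = t"
proof -
  have fin: "finite {n. s n = r}" if "r > 0" "s \<longlonglongrightarrow> 0" for r and s :: "nat \<Rightarrow> real"
  proof -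
    from order_tendstoD(2)[OF that(2,1)] obtain N where "\<And>n. n \<ge> N \<Longrightarrow> s n < r"
      by (auto simp: eventually_sequentially)
    then have "{n. s n = r} \<subseteq> {..<N}" by (force simp flip: not_le)
    then show ?thesis by (rule finite_subset) simp
  qed
  have not_less: "\<not> t n < s n"
    if IH: "\<And>k. k < n \<Longrightarrow> s k = t k" and t: "decseq t" "t \<longlonglongrightarrow> 0" and s: "decseq s" "s \<longlonglongrightarrow> 0"
      and eq: "\<And>r. r > 0 \<Longrightarrow> card {n. s n = r} = card {n. t n = r}" for n and s t :: "nat \<Rightarrow> real"
  proof
    assume less: "t n < s n"
    have "0 \<le> t n" using decseq_ge[OF t] .
    then have pos: "s n > 0" using less by simp
    have "{k. t k = s n} \<subset> {k. s k = s n}"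
    proof
      show "{k. t k = s n} \<subseteq> {k. s k = s n}"
      proof safe
        fix k assume k: "t k = s n"
        have "k < n"
        proof (rule ccontr)
          assume "\<not> k < n" then have "t k \<le> t n" using t(1) by (simp add: decseq_def)
          then show False using k less by simp
        qed
        then show "s k = s n" using IH k by simp
      qed
      have "n \<in> {k. s k = s n}" "n \<notin> {k. t k = s n}" using less by auto
      then show "{k. t k = s n} \<noteq> {k. s k = s n}" by blast
    qed
    then have "card {k. t k = s n} < card {k. s k = s n}"
      by (rule psubset_card_mono[OF fin[OF pos s(2)]])
    then show False using eq[OF pos] by simp
  qed
  have "s n = t n" for n
  proof (induction n rule: less_induct)
    case (less n)
    then show ?case using not_less[of n s t] not_less[of n t s] s t eq by force
  qed
  then show ?thesis by auto
qed

lemma independent_ortho: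
  assumes e: "ortho_seq (e :: nat \<Rightarrow> 'h::complex_hilbert)"
  shows "inj e" "\<not> complex_vector.dependent (e ` A)"
proof -
  show inj: "inj e"
  proof (rule injI, rule ccontr)
    fix m n assume "e m = e n" "m \<noteq> n"
    then show False using ortho_seqD(1)[OF e, of m n] ortho_seqD(1)[OF e, of n n] by simp
  qed
  show "\<not> complex_vector.dependent (e ` A)"
    unfolding complex_vector.dependent_explicit
  proof safe
    fix T u v assume T: "finite T" "T \<subseteq> e ` A" "(\<Sum>v\<in>T. u v *\<^sub>C v) = 0" "v \<in> T" "u v \<noteq> 0"
    obtain B where B: "T = e ` B" using T(2) by (meson subset_imageE)
    have fB: "finite B" using T(1) B inj by (metis finite_imageD inj_on_subset subset_UNIV)
    obtain k where k: "k \<in> B" "v = e k" using T(4) B by auto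
    have "(\<Sum>n\<in>B. u (e n) *\<^sub>C e n) = 0"
      using T(3) unfolding B by (subst (asm) sum.reindex) (auto intro: inj_on_subset[OF inj])
    then have "u (e k) = 0"
      using cinner_sum_ortho[OF e fB, of "\<lambda>n. u (e n)" k] k by (simp add: cinner.zero_left)
    then show False using T(5) k by simp
  qed
qed

text \<open>As \<open>e\<close> need not be a basis, an eigenvector is recovered from its image: its
  coefficients outside \<open>A\<close> vanish, so \<open>D x\<close> is a finite sum, and dividing
  by the nonzero eigenvalue gives \<open>x\<close>.\<close>

lemma cdim_eigenspace_diag:
  fixes e :: "nat \<Rightarrow> 'h::complex_hilbert"
  assumes e: "ortho_seq e" and s: "s \<in> c0_star" and t: "t > 0"
  shows "cdim {x. blinfun_apply (diag_op (\<lambda>n. s n * s n) e e) x = complex_of_real (t\<^sup>2) *\<^sub>C x}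
    = card {n. s n = t}"
proof -
  define A where "A = {n. s n = t}"
  define D where "D = diag_op (\<lambda>n. s n * s n) e e"
  have B: "\<forall>n. \<bar>s n * s n\<bar> \<le> s 0 * s 0"
    unfolding abs_mult using c0_starD[OF s] by (intro allI mult_mono) auto
  have lin: "blinfun_apply D (c *\<^sub>C x) = c *\<^sub>C blinfun_apply D x" for c x
    using diag_op_carrier[OF e e B] by (simp add: BH_def D_def)
  have "finite A"
  proof -
    from order_tendstoD(2)[OF c0_starD(3)[OF s] t] obtain N where "\<And>n. n \<ge> N \<Longrightarrow> s n < t"
      by (auto simp: eventually_sequentially)
    then have "A \<subseteq> {..<N}" by (force simp: A_def simp flip: not_le)
    then show ?thesis by (rule finite_subset) simp
  qed
  have "{x. blinfun_apply D x = complex_of_real (t\<^sup>2) *\<^sub>C x} = cspan (e ` A)" (is "?E = _")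
  proof
    show "cspan (e ` A) \<subseteq> ?E"
    proof (rule complex_vector.span_minimal)
      show "e ` A \<subseteq> ?E"
        by (auto simp: D_def diag_op_basis[OF e e B] A_def power2_eq_square)
      show "complex_vector.subspace ?E"
        by (auto simp: complex_vector.subspace_def blinfun.add_right blinfun.zero_right lin
            scaleC_add_right scaleC_scaleC mult.commute scaleC.zero_right)
    qed
    show "?E \<subseteq> cspan (e ` A)"
    proof
      fix x assume "x \<in> ?E"
      then have x: "blinfun_apply D x = complex_of_real (t\<^sup>2) *\<^sub>C x" by simp
      have c: "cinner x (e n) = 0" if "n \<notin> A" for n
      proof -
        have "(s n)\<^sup>2 * cinner x (e n) = t\<^sup>2 * cinner x (e n)"
          using cinner_diag_op[OF e e B, of x n] x
          by (auto simp: D_def cinner_scaleC_left power2_eq_square)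
        moreover have "(s n)\<^sup>2 \<noteq> t\<^sup>2"
          using that c0_starD(1)[OF s, of n] t by (simp add: A_def)
        then have "complex_of_real ((s n)\<^sup>2) \<noteq> complex_of_real (t\<^sup>2)"
          using of_real_eq_iff by blast
        ultimately show ?thesis by (metis mult_cancel_right)
      qed
      have "blinfun_apply D x = (\<Sum>n. (complex_of_real (s n * s n) * cinner x (e n)) *\<^sub>C e n)"
        unfolding D_def by (rule diag_op_apply[OF e e B])
      also have "\<dots> = (\<Sum>n\<in>A. (complex_of_real (s n * s n) * cinner x (e n)) *\<^sub>C e n)"
        by (rule suminf_finite[OF \<open>finite A\<close>]) (simp add: c scaleC.zero_left)
      also have "\<dots> \<in> cspan (e ` A)"
        by (intro complex_vector.span_sum complex_vector.span_scale complex_vector.span_base) auto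
      finally have "complex_of_real (t\<^sup>2) *\<^sub>C x \<in> cspan (e ` A)" using x by simp
      then have "complex_of_real (inverse (t\<^sup>2)) *\<^sub>C complex_of_real (t\<^sup>2) *\<^sub>C x \<in> cspan (e ` A)"
        by (rule complex_vector.span_scale)
      moreover have "complex_of_real (inverse (t\<^sup>2)) *\<^sub>C complex_of_real (t\<^sup>2) *\<^sub>C x = x"
        using t by (simp add: scaleC_scaleC flip: of_real_mult of_real_inverse of_real_power)
      ultimately show "x \<in> cspan (e ` A)" by simp
    qed
  qed
  moreover have "cdim (cspan (e ` A)) = card A"
    by (simp add: complex_vector.dim_span complex_vector.dim_eq_card_independent independent_ortho[OF e]
        card_image inj_on_subset[OF independent_ortho(1)[OF e]])
  ultimately show ?thesis by (simp add: A_def D_def)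
qed

lemma s_numbers_diag_op:
  fixes e :: "nat \<Rightarrow> 'h::complex_hilbert"
  assumes e: "ortho_seq e" and f: "ortho_seq f" and s: "s \<in> c0_star"
  shows "s_numbers (diag_op s e f) = s"
proof -
  note sD = c0_starD[OF s]
  have D: "cadjoint (diag_op s e f) o\<^sub>L diag_op s e f = diag_op (\<lambda>n. s n * s n) e e"
    by (simp add: cadjoint_diag_op[OF e f sD(4)] diag_op_compose[OF e f e sD(4) sD(4)])
  show ?thesis
    unfolding s_numbers_def D
  proof (rule the_equality)
    show "decseq s \<and> s \<longlonglongrightarrow> 0 \<and> (\<forall>t>0. card {n. s n = t} =
        cdim {x. blinfun_apply (diag_op (\<lambda>n. s n * s n) e e) x = complex_of_real (t\<^sup>2) *\<^sub>C x})"
      using sD cdim_eigenspace_diag[OF e s] by auto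
  next
    fix t assume "decseq t \<and> t \<longlonglongrightarrow> 0 \<and> (\<forall>r>0. card {n. t n = r} =
        cdim {x. blinfun_apply (diag_op (\<lambda>n. s n * s n) e e) x = complex_of_real (r\<^sup>2) *\<^sub>C x})"
    then show "t = s"
      using sD cdim_eigenspace_diag[OF e s] by (intro decseq_eq_if_card_eq) auto
  qed
qed

section \<open>Compact operators\<close>

lemma compact_opsI:
  assumes "T \<in> carrier BH" "blinfun_apply T ` cball 0 1 \<subseteq> K" "compact K"
  shows "T \<in> compact_ops"
proof -
  have "closure (blinfun_apply T ` cball 0 1) \<subseteq> K"
    using assms by (simp add: closure_minimal compact_imp_closed)
  then have "compact (closure (blinfun_apply T ` cball 0 1))"
    using assms(3) compact_Int_closed[of K "closure (blinfun_apply T ` cball 0 1)"]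
    by (simp add: Int_absorb1)
  then show ?thesis using assms by (simp add: compact_ops_def)
qed

lemma compact_opsD:
  assumes "T \<in> compact_ops"
  shows "T \<in> carrier BH" "compact (closure (blinfun_apply T ` cball 0 1))"
  using assms by (auto simp: compact_ops_def)

lemma apply_in_closure_cball:
  assumes "norm x \<le> 1"
  shows "blinfun_apply T x \<in> closure (blinfun_apply T ` cball 0 1)"
proof -
  have "x \<in> cball 0 1" using assms by simp
  then show ?thesis by (rule closure_subset[THEN subsetD, OF imageI])
qed

lemma compact_ops_subseq:
  fixes x :: "nat \<Rightarrow> 'h::complex_hilbert"
  assumes T: "T \<in> compact_ops" and x: "\<And>n. norm (x n) \<le> 1"
  obtains r y where "strict_mono r" "(\<lambda>n. blinfun_apply T (x (r n))) \<longlonglongrightarrow> y"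
proof -
  have im: "\<forall>n. blinfun_apply T (x n) \<in> closure (blinfun_apply T ` cball 0 1)"
    by (intro allI apply_in_closure_cball x)
  have "seq_compact (closure (blinfun_apply T ` cball 0 1))"
    using compact_opsD(2)[OF T] by (simp add: compact_eq_seq_compact_metric)
  from seq_compactE[OF this im]
  obtain y r where "strict_mono r" "((\<lambda>n. blinfun_apply T (x n)) \<circ> r) \<longlonglongrightarrow> y"
    by blast
  then show ?thesis using that[of r y] by (simp add: comp_def)
qed

lemma compact_ops_add:
  assumes "A \<in> compact_ops" "B \<in> compact_ops" shows "A + B \<in> compact_ops"
proof (rule compact_opsI)
  show "A + B \<in> carrier BH"
    using assms by (auto simp: compact_ops_def BH_def blinfun.add_left scaleC_add_right)
  let ?K = "\<lambda>T. closure (blinfun_apply T ` cball 0 1)"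
  show "compact {x + y |x y. x \<in> ?K A \<and> y \<in> ?K B}"
    by (intro compact_sums compact_opsD assms)
  show "blinfun_apply (A + B) ` cball 0 1 \<subseteq> {x + y |x y. x \<in> ?K A \<and> y \<in> ?K B}"
  proof safe
    fix x :: 'a assume "x \<in> cball 0 1"
    then have "blinfun_apply T x \<in> ?K T" for T :: "'a \<Rightarrow>\<^sub>L 'a"
      by (simp add: apply_in_closure_cball)
    then show "\<exists>a b. blinfun_apply (A + B) x = a + b \<and> a \<in> ?K A \<and> b \<in> ?K B"
      by (auto simp: blinfun.add_left)
  qed
qed

lemma compact_ops_compose_left:
  assumes X: "X \<in> carrier BH" and T: "T \<in> compact_ops" shows "X o\<^sub>L T \<in> compact_ops"
proof (rule compact_opsI)
  show "X o\<^sub>L T \<in> carrier BH" using assms by (auto simp: compact_ops_def BH_def)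
  show "compact (blinfun_apply X ` closure (blinfun_apply T ` cball 0 1))"
    by (intro compact_continuous_image compact_opsD(2) T linear_continuous_on blinfun.bounded_linear_right)
  show "blinfun_apply (X o\<^sub>L T) ` cball 0 1 \<subseteq> blinfun_apply X ` closure (blinfun_apply T ` cball 0 1)"
    using closure_subset[of "blinfun_apply T ` cball 0 1"] by auto
qed

lemma compact_ops_compose_right:
  assumes X: "X \<in> carrier BH" and T: "T \<in> compact_ops" shows "T o\<^sub>L X \<in> compact_ops"
proof (rule compact_opsI)
  show "T o\<^sub>L X \<in> carrier BH" using assms by (auto simp: compact_ops_def BH_def)
  \<comment> \<open>The added 1 keeps the scaling factor positive when X = 0.\<close>
  let ?K = "closure (blinfun_apply T ` cball 0 1)" and ?c = "norm X + 1"
  show "compact ((\<lambda>x. ?c *\<^sub>R x) ` ?K)"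
    by (intro compact_scaling compact_opsD T)
  show "blinfun_apply (T o\<^sub>L X) ` cball 0 1 \<subseteq> (\<lambda>x. ?c *\<^sub>R x) ` ?K"
  proof safe
    fix x :: 'a assume "x \<in> cball 0 1"
    then have "norm (blinfun_apply X x) \<le> norm X * 1"
      using norm_blinfun[of X x] mult_left_mono[of "norm x" 1 "norm X"] by simp
    moreover have c: "0 < ?c" using norm_ge_zero[of X] by linarith
    ultimately have "norm ((1 / ?c) *\<^sub>R blinfun_apply X x) \<le> 1"
      by (simp add: pos_divide_le_eq)
    then have "blinfun_apply T ((1 / ?c) *\<^sub>R blinfun_apply X x) \<in> ?K"
      by (rule apply_in_closure_cball)
    moreover have "blinfun_apply (T o\<^sub>L X) x = ?c *\<^sub>R blinfun_apply T ((1 / ?c) *\<^sub>R blinfun_apply X x)"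
      using c by (simp add: blinfun.scaleR_right)
    ultimately show "blinfun_apply (T o\<^sub>L X) x \<in> (\<lambda>x. ?c *\<^sub>R x) ` ?K" by blast
  qed
qed

text \<open>Contains the image of the unit ball under the first N terms of a diagonal operator; this
  is the finite-rank part in \<open>diag_op_compact\<close>.\<close>

lemma compact_ortho_combinations:
  fixes f :: "nat \<Rightarrow> 'h::complex_hilbert"
  shows "compact {\<Sum>n<N. a n *\<^sub>C f n |a. \<forall>n. cmod (a n) \<le> C}"
proof (induction N)
  case 0
  have "{\<Sum>n<0. a n *\<^sub>C f n |a. \<forall>n. cmod (a n) \<le> C} \<subseteq> {0::'h}" by auto
  then have "finite {\<Sum>n<0. a n *\<^sub>C f n |a. \<forall>n. cmod (a n) \<le> C}" by (rule finite_subset) simp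
  then show ?case by (rule finite_imp_compact)
next
  case (Suc N)
  let ?K = "\<lambda>N. {\<Sum>n<N. a n *\<^sub>C f n |a. \<forall>n. cmod (a n) \<le> C}"
  let ?L = "(\<lambda>c. c *\<^sub>C f N) ` cball 0 C"
  have "compact ?L"
    by (intro compact_continuous_image linear_continuous_on scaleC.bounded_linear_left compact_cball)
  with Suc have "compact {x + y |x y. x \<in> ?K N \<and> y \<in> ?L}" by (rule compact_sums)
  moreover have "?K (Suc N) = {x + y |x y. x \<in> ?K N \<and> y \<in> ?L}"
  proof (intro equalityI subsetI)
    fix z assume "z \<in> ?K (Suc N)"
    then obtain a where a: "\<forall>n. cmod (a n) \<le> C" "z = (\<Sum>n<N. a n *\<^sub>C f n) + a N *\<^sub>C f N"
      by auto
    moreover have "a N *\<^sub>C f N \<in> ?L" using a(1) by (intro imageI) simp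
    ultimately show "z \<in> {x + y |x y. x \<in> ?K N \<and> y \<in> ?L}" by blast
  next
    fix z assume "z \<in> {x + y |x y. x \<in> ?K N \<and> y \<in> ?L}"
    then obtain a c where a: "\<forall>n. cmod (a n) \<le> C" "cmod c \<le> C" "z = (\<Sum>n<N. a n *\<^sub>C f n) + c *\<^sub>C f N"
      by auto
    define b where "b = a(N := c)"
    have "(\<Sum>n<N. a n *\<^sub>C f n) = (\<Sum>n<N. b n *\<^sub>C f n)"
      by (rule sum.cong) (simp_all add: b_def)
    then have "z = (\<Sum>n<Suc N. b n *\<^sub>C f n)" using a(3) by (simp add: b_def)
    moreover have "\<forall>n. cmod (b n) \<le> C" using a by (simp add: b_def)
    ultimately show "z \<in> ?K (Suc N)" by blast
  qed
  ultimately show ?case by simp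
qed

text \<open>Total boundedness: dropping the terms with \<bar>s n\<bar> < r / 2 moves the image of a
  unit vector by at most r / 2, and the remaining finite sums lie in a compact set.\<close>

lemma diag_op_compact:
  fixes e :: "nat \<Rightarrow> 'h::complex_hilbert"
  assumes e: "ortho_seq e" and f: "ortho_seq f" and s: "s \<longlonglongrightarrow> 0"
  shows "diag_op s e f \<in> compact_ops"
proof -
  have "Bseq s" using s by (rule convergent_imp_Bseq[OF convergentI])
  then obtain B where B: "\<forall>n. \<bar>s n\<bar> \<le> B" using BseqE_abs by blast
  let ?T = "blinfun_apply (diag_op s e f)" and ?M = "closure (blinfun_apply (diag_op s e f) ` cball 0 1)"
  have "\<exists>k. finite k \<and> ?T ` cball 0 1 \<subseteq> (\<Union>x\<in>k. ball x r)" if r: "r > 0" for r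
  proof -
    have "\<forall>\<^sub>F n in sequentially. \<bar>s n\<bar> < r / 2"
      using tendsto_rabs_zero[OF s] r by (intro order_tendstoD(2)) auto
    then obtain N where N: "\<And>n. n \<ge> N \<Longrightarrow> \<bar>s n\<bar> < r / 2" by (auto simp: eventually_sequentially)
    let ?K = "{\<Sum>n<N. a n *\<^sub>C f n |a. \<forall>n. cmod (a n) \<le> B}"
    have "\<forall>\<epsilon>>0. \<exists>k. finite k \<and> ?K \<subseteq> (\<Union>x\<in>k. ball x \<epsilon>)"
      using compact_ortho_combinations[where N = N and f = f and C = B]
      unfolding compact_eq_totally_bounded by (rule conjunct2)
    then obtain k where k: "finite k" "?K \<subseteq> (\<Union>x\<in>k. ball x (r/2))"
      using half_gt_zero[OF r] by meson
    have "?T ` cball 0 1 \<subseteq> (\<Union>x\<in>k. ball x r)"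
    proof safe
      fix x :: 'h assume x: "x \<in> cball 0 1"
      define a where "a n = complex_of_real (s n) * cinner x (e n)" for n
      have sa: "summable (\<lambda>n. a n *\<^sub>C f n)" unfolding a_def by (rule diag_summable[OF e f B])
      have T: "?T x = (\<Sum>n. a n *\<^sub>C f n)" unfolding a_def by (rule diag_op_apply[OF e f B])
      have "cmod (cinner x (e n)) \<le> 1" for n
        using norm_cinner_le[of x "e n"] x by (simp add: ortho_seqD(2)[OF e])
      then have "cmod (a n) \<le> B" for n
        using mult_mono[OF B[rule_format] \<open>cmod (cinner x (e n)) \<le> 1\<close>, of n] B[rule_format, of n] by (simp add: a_def norm_mult)
      then have "(\<Sum>n<N. a n *\<^sub>C f n) \<in> ?K" by blast
      then obtain z where z: "z \<in> k" "dist z (\<Sum>n<N. a n *\<^sub>C f n) < r/2" using k by auto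
      define s' where "s' n = (if n < N then 0 else s n)" for n
      have s': "\<forall>n. \<bar>s' n\<bar> \<le> r / 2" using N r by (auto simp: s'_def not_less intro: less_imp_le)
      have "?T x - (\<Sum>n<N. a n *\<^sub>C f n) = (\<Sum>n. a (n + N) *\<^sub>C f (n + N))"
        unfolding T using suminf_minus_initial_segment[OF sa, of N] by simp
      also have "\<dots> = blinfun_apply (diag_op s' e f) x"
        unfolding diag_op_apply[OF e f s']
        by (subst suminf_split_initial_segment[OF diag_summable[OF e f s'], where k = N])
           (simp add: s'_def a_def scaleC.zero_left)
      finally have "norm (?T x - (\<Sum>n<N. a n *\<^sub>C f n)) \<le> r / 2 * norm x"
        using norm_diag_op_le[OF e f s', of x] by simp
      also have "\<dots> \<le> r / 2" using x r by (simp add: mult_left_le)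
      finally have "dist z (?T x) < r"
        using z(2) dist_triangle[of z "?T x" "\<Sum>n<N. a n *\<^sub>C f n"] by (simp add: dist_norm norm_minus_commute)
      then show "?T x \<in> (\<Union>x\<in>k. ball x r)" using z(1) by auto
    qed
    then show ?thesis using k(1) by blast
  qed
  then have tb: "\<exists>k. finite k \<and> ?M \<subseteq> (\<Union>x\<in>k. ball x r)" if r: "r > 0" for r
  proof -
    \<comment> \<open>Half the radius leaves room for passing to the closure.\<close>
    obtain k where k: "finite k" "?T ` cball 0 1 \<subseteq> (\<Union>x\<in>k. ball x (r/2))"
      using \<open>\<And>r. r > 0 \<Longrightarrow> \<exists>k. finite k \<and> ?T ` cball 0 1 \<subseteq> (\<Union>x\<in>k. ball x r)\<close>[of "r/2"] r by auto
    have "?M \<subseteq> (\<Union>x\<in>k. cball x (r/2))"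
    proof (rule closure_minimal)
      show "?T ` cball 0 1 \<subseteq> (\<Union>x\<in>k. cball x (r/2))"
        using k(2) by (rule order.trans) (intro UN_mono order.refl ball_subset_cball)
      show "closed (\<Union>x\<in>k. cball x (r/2))" using k(1) by (intro closed_UN) auto
    qed
    also have "\<dots> \<subseteq> (\<Union>x\<in>k. ball x r)" using r by fastforce
    finally show ?thesis using k by blast
  qed
  have "compact ?M"
    unfolding compact_eq_totally_bounded using tb by (simp add: complete_eq_closed)
  then show ?thesis using diag_op_carrier[OF e f B] by (simp add: compact_ops_def)
qed

section \<open>Singular value decomposition\<close>

text \<open>A Gram-Schmidt step. Infinite dimension enters here: it lets the greedy construction go
  on forever, even where the operator vanishes.\<close>

lemma exists_unit_orthogonal:
  fixes e :: "nat \<Rightarrow> 'h::complex_hilbert"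
  assumes inf: "\<nexists>B :: 'h set. finite B \<and> cspan B = UNIV"
    and e: "\<And>j k. j < n \<Longrightarrow> k < n \<Longrightarrow> cinner (e j) (e k) = (if j = k then 1 else 0)"
  obtains x where "norm x = 1" "\<And>k. k < n \<Longrightarrow> cinner x (e k) = 0"
proof -
  have "cspan (e ` {..<n}) \<noteq> UNIV" using inf by blast
  then obtain x where x: "x \<notin> cspan (e ` {..<n})" by blast
  define p where "p = (\<Sum>k<n. cinner x (e k) *\<^sub>C e k)"
  have "p \<in> cspan (e ` {..<n})"
    unfolding p_def by (intro complex_vector.span_sum complex_vector.span_scale complex_vector.span_base) auto
  then have ne: "x - p \<noteq> 0" using x by auto
  have orth: "cinner (x - p) (e k) = 0" if "k < n" for k
  proof -
    have "(\<Sum>j<n. cinner x (e j) * cinner (e j) (e k)) = (\<Sum>j<n. if j = k then cinner x (e j) else 0)"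
      by (rule sum.cong) (simp_all add: e that)
    then show ?thesis
      using that by (simp add: p_def cinner.diff_left cinner.sum_left cinner_scaleC_left)
  qed
  show ?thesis
  proof
    show "norm ((1 / norm (x - p)) *\<^sub>R (x - p)) = 1" using ne by simp
    show "cinner ((1 / norm (x - p)) *\<^sub>R (x - p)) (e k) = 0" if "k < n" for k
      using orth[OF that] by (simp add: cinner.scaleR_left)
  qed
qed

text \<open>By the parallelogram law a maximising sequence of unit vectors is Cauchy as soon as its
  image converges; so the norm is attained without any appeal to weak compactness.\<close>

lemma compact_op_norm_attained:
  fixes T :: "'h::complex_hilbert \<Rightarrow>\<^sub>L 'h"
  assumes T: "T \<in> compact_ops" and V: "closed V" "subspace V" and u: "u \<in> V" "norm u = 1"
  obtains x where "x \<in> V" "norm x = 1" "\<And>z. z \<in> V \<Longrightarrow> norm (blinfun_apply T z) \<le> norm (blinfun_apply T x) * norm z"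
proof -
  define S where "S = (\<lambda>x. norm (blinfun_apply T x)) ` (V \<inter> sphere 0 1)"
  define M where "M = Sup S"
  have S: "S \<noteq> {}" "bdd_above S"
  proof -
    show "S \<noteq> {}" using u by (auto simp: S_def)
    show "bdd_above S"
    proof (rule bdd_aboveI)
      fix a assume "a \<in> S"
      then obtain x where "a = norm (blinfun_apply T x)" "norm x = 1" by (auto simp: S_def)
      then show "a \<le> norm T" using norm_blinfun[of T x] by simp
    qed
  qed
  have M: "norm (blinfun_apply T z) \<le> M * norm z" if "z \<in> V" for z
  proof (cases "z = 0")
    case False
    have "(1 / norm z) *\<^sub>R z \<in> V \<inter> sphere 0 1" using False that V(2) by (simp add: subspace_scale)
    then have "norm (blinfun_apply T ((1 / norm z) *\<^sub>R z)) \<in> S" unfolding S_def by (rule imageI)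
    then have "norm (blinfun_apply T ((1 / norm z) *\<^sub>R z)) \<le> M"
      unfolding M_def using S by (intro cSup_upper)
    then show ?thesis using False by (simp add: blinfun.scaleR_right divide_simps)
  qed (simp add: blinfun.zero_right)
  have M0: "0 \<le> M" using M[OF u(1)] u(2) order_trans[OF norm_ge_zero] by fastforce
  have "\<exists>x. x \<in> V \<and> norm x = 1 \<and> M - 1 / real (Suc n) < norm (blinfun_apply T x)" for n
  proof -
    have "M - 1 / real (Suc n) < Sup S" by (simp add: M_def)
    then obtain a where "a \<in> S" "M - 1 / real (Suc n) < a" using less_cSup_iff[OF S] by blast
    then show ?thesis by (auto simp: S_def)
  qed
  then obtain x where x: "\<And>n. x n \<in> V" "\<And>n. norm (x n) = 1"
      "\<And>n. M - 1 / real (Suc n) < norm (blinfun_apply T (x n))" by metis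
  obtain r y where r: "strict_mono r" and y: "(\<lambda>n. blinfun_apply T (x (r n))) \<longlonglongrightarrow> y"
    using compact_ops_subseq[OF T, of x] x(2) by auto
  have "(\<lambda>n. norm (blinfun_apply T (x n))) \<longlonglongrightarrow> M"
  proof (rule tendsto_sandwich)
    show "\<forall>\<^sub>F n in sequentially. M - 1 / real (Suc n) \<le> norm (blinfun_apply T (x n))"
      using x(3) by (intro always_eventually allI less_imp_le)
    show "\<forall>\<^sub>F n in sequentially. norm (blinfun_apply T (x n)) \<le> M"
      using M x(1,2) by (intro always_eventually allI) (metis mult.right_neutral)
    show "(\<lambda>n. M - 1 / real (Suc n)) \<longlonglongrightarrow> M"
      using tendsto_diff[OF tendsto_const LIMSEQ_inverse_real_of_nat, of M] by (simp add: inverse_eq_divide)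
  qed simp
  then have "(\<lambda>n. norm (blinfun_apply T (x (r n)))) \<longlonglongrightarrow> M"
    using LIMSEQ_subseq_LIMSEQ[OF _ r] by (fastforce simp: comp_def)
  then have ny: "norm y = M" using tendsto_norm[OF y] LIMSEQ_unique by blast
  show ?thesis
  proof (cases "M = 0")
    case True
    then show ?thesis using that[OF u] M by (simp add: mult_nonneg_nonneg order_trans)
  next
    case False
    then have Mp: "0 < M" using M0 by simp
    have "Cauchy (\<lambda>n. x (r n))"
    proof (rule metric_CauchyI)
      fix \<epsilon> :: real assume \<epsilon>: "0 < \<epsilon>"
      \<comment> \<open>Chosen so that the final bound 8 \<delta> equals M \<epsilon>^2 / 2.\<close>
      define \<delta> where "\<delta> = M * \<epsilon>\<^sup>2 / 16"
      have "\<delta> > 0" using Mp \<epsilon> by (simp add: \<delta>_def)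
      then obtain N where N: "\<And>n. n \<ge> N \<Longrightarrow> norm (blinfun_apply T (x (r n)) - y) < \<delta>"
        using y by (auto simp: lim_sequentially dist_norm)
      show "\<exists>N. \<forall>m\<ge>N. \<forall>n\<ge>N. dist (x (r m)) (x (r n)) < \<epsilon>"
      proof (intro exI allI impI)
        fix m n assume mn: "N \<le> m" "N \<le> n"
        let ?a = "x (r m)" and ?b = "x (r n)"
        have "2 * M = norm ((blinfun_apply T (?a + ?b)) - (blinfun_apply T ?a - y) - (blinfun_apply T ?b - y))"
          using ny by (simp add: blinfun.add_right scaleR_2[symmetric])
        also have "\<dots> \<le> norm (blinfun_apply T (?a + ?b)) + norm (blinfun_apply T ?a - y) + norm (blinfun_apply T ?b - y)"
          using norm_triangle_ineq4[of "blinfun_apply T (?a + ?b) - (blinfun_apply T ?a - y)" "blinfun_apply T ?b - y"]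
            norm_triangle_ineq4[of "blinfun_apply T (?a + ?b)" "blinfun_apply T ?a - y"] by linarith
        also have "\<dots> \<le> M * norm (?a + ?b) + \<delta> + \<delta>"
          using M[of "?a + ?b"] x(1) V(2) N[OF mn(1)] N[OF mn(2)] by (simp add: subspace_add)
        finally have l: "2 * M - 2 * \<delta> \<le> M * norm (?a + ?b)" by simp
        have s2: "norm (?a + ?b) \<le> 2" using norm_triangle_ineq[of ?a ?b] x(2) by simp
        have par: "(norm (?a - ?b))\<^sup>2 = 4 - (norm (?a + ?b))\<^sup>2"
          using x(2)[of "r m"] x(2)[of "r n"]
          by (simp add: power2_norm_eq_inner inner_add_left inner_add_right inner_diff_left
              inner_diff_right inner_commute norm_eq_1)
        have "M * (norm (?a - ?b))\<^sup>2 = M * (4 - (norm (?a + ?b))\<^sup>2)" by (simp only: par)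
        also have "\<dots> = (2 * M - M * norm (?a + ?b)) * (2 + norm (?a + ?b))"
          by (simp add: algebra_simps power2_eq_square)
        also have "\<dots> \<le> (2 * \<delta>) * 4"
          using l s2 \<open>\<delta> > 0\<close> by (intro mult_mono) auto
        also have "\<dots> < M * \<epsilon>\<^sup>2" using Mp \<epsilon> by (simp add: \<delta>_def)
        finally have "(norm (?a - ?b))\<^sup>2 < \<epsilon>\<^sup>2" using Mp by simp
        then show "dist ?a ?b < \<epsilon>"
          using \<epsilon> power_less_imp_less_base[of "norm (?a - ?b)" 2 \<epsilon>] by (simp add: dist_norm)
      qed
    qed
    then obtain z where z: "(\<lambda>n. x (r n)) \<longlonglongrightarrow> z" using Cauchy_convergent convergent_def by blast
    have "z \<in> V" using closed_sequentially[OF V(1) _ z] x(1) by blast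
    moreover have "norm z = 1" using LIMSEQ_unique[OF tendsto_norm[OF z]] x(2) by simp
    moreover have "blinfun_apply T z = y"
      using LIMSEQ_unique[OF blinfun.tendsto[OF tendsto_const z] y] .
    ultimately show ?thesis using that[of z] M ny by simp
  qed
qed

text \<open>First variation: passing from x to x + t z changes the squared image norm by 2 t b up to
  terms of order t^2, which for small t of the sign of b would beat maximality unless b = 0.\<close>

lemma norm_maximiser_orthogonal_real:
  fixes T :: "'h::complex_hilbert \<Rightarrow>\<^sub>L 'h"
  assumes V: "subspace V" and x: "x \<in> V" "norm x = 1"
    and max: "\<And>z. z \<in> V \<Longrightarrow> norm (blinfun_apply T z) \<le> norm (blinfun_apply T x) * norm z"
    and z: "z \<in> V" "inner z x = 0"
  shows "inner (blinfun_apply T z) (blinfun_apply T x) = 0"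
proof (rule ccontr)
  define b where "b = inner (blinfun_apply T z) (blinfun_apply T x)"
  define K where "K = (norm (blinfun_apply T x))\<^sup>2 * (norm z)\<^sup>2"
  assume "inner (blinfun_apply T z) (blinfun_apply T x) \<noteq> 0"
  then have b: "b \<noteq> 0" by (simp add: b_def)
  have K: "0 \<le> K" by (simp add: K_def)
  \<comment> \<open>Since t (K + 1) = b, the inequality 2 t b \<le> t^2 K becomes 2 b^2 (K + 1)
    \<le> b^2 K; the 1 excludes a zero denominator.\<close>
  define t where "t = b / (K + 1)"
  have "x + t *\<^sub>R z \<in> V" using V x z by (simp add: subspace_add subspace_scale)
  from power_mono[OF max[OF this] norm_ge_zero, of 2]
  have "(norm (blinfun_apply T x + t *\<^sub>R blinfun_apply T z))\<^sup>2 \<le> (norm (blinfun_apply T x))\<^sup>2 * (norm (x + t *\<^sub>R z))\<^sup>2"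
    by (simp add: power_mult_distrib blinfun.add_right blinfun.scaleR_right)
  moreover have "(norm (blinfun_apply T x + t *\<^sub>R blinfun_apply T z))\<^sup>2
      = (norm (blinfun_apply T x))\<^sup>2 + 2 * t * b + t\<^sup>2 * (norm (blinfun_apply T z))\<^sup>2"
    unfolding power2_norm_eq_inner
    by (simp add: b_def inner_add_left inner_add_right inner_commute power2_eq_square algebra_simps)
  moreover have "(norm (x + t *\<^sub>R z))\<^sup>2 = 1 + t\<^sup>2 * (norm z)\<^sup>2"
    using x(2) z(2) unfolding power2_norm_eq_inner
    by (simp add: inner_add_left inner_add_right inner_commute power2_eq_square norm_eq_1)
  ultimately have "2 * t * b + t\<^sup>2 * (norm (blinfun_apply T z))\<^sup>2 \<le> t\<^sup>2 * K"
    by (simp add: K_def algebra_simps)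
  moreover have "0 \<le> t\<^sup>2 * (norm (blinfun_apply T z))\<^sup>2" by simp
  ultimately have "2 * t * b \<le> t\<^sup>2 * K" by linarith
  then have "2 * t * b * (K + 1)\<^sup>2 \<le> t\<^sup>2 * K * (K + 1)\<^sup>2" by (rule mult_right_mono) simp
  also have "t\<^sup>2 * K * (K + 1)\<^sup>2 = (t * (K + 1))\<^sup>2 * K" by (simp add: power2_eq_square)
  also have "2 * t * b * (K + 1)\<^sup>2 = 2 * b * (t * (K + 1)) * (K + 1)" by (simp add: power2_eq_square)
  also have "t * (K + 1) = b" using K by (simp add: t_def)
  finally have "2 * b\<^sup>2 * (K + 1) \<le> b\<^sup>2 * K"
    by (simp add: power2_eq_square)
  then have "2 * (K + 1) \<le> K" using b by (simp add: mult.commute mult.left_commute)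
  then show False using K by simp
qed

lemma norm_maximiser_orthogonal:
  fixes T :: "'h::complex_hilbert \<Rightarrow>\<^sub>L 'h"
  assumes T: "T \<in> carrier BH" and V: "complex_vector.subspace V" and x: "x \<in> V" "norm x = 1"
    and max: "\<And>z. z \<in> V \<Longrightarrow> norm (blinfun_apply T z) \<le> norm (blinfun_apply T x) * norm z"
    and z: "z \<in> V" "cinner z x = 0"
  shows "cinner (blinfun_apply T z) (blinfun_apply T x) = 0"
proof -
  have V': "subspace V"
    using V by (auto simp: subspace_def complex_vector.subspace_def scaleR_eq_scaleC)
  have R: "Re (cinner (blinfun_apply T z) (blinfun_apply T x)) = 0" if "z \<in> V" "cinner z x = 0" for z
    unfolding Re_cinner using norm_maximiser_orthogonal_real[OF V' x max that(1)] that(2)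
    by (simp flip: Re_cinner)
  \<comment> \<open>The real part for \<i> z is minus the imaginary part for z, so the real case
    covers both parts.\<close>
  have "\<i> *\<^sub>C z \<in> V" using V z by (simp add: complex_vector.subspace_scale)
  from R[OF this] have "Im (cinner (blinfun_apply T z) (blinfun_apply T x)) = 0"
    using T z(2) by (simp add: BH_def cinner_scaleC_left)
  then show ?thesis using R[OF z] by (simp add: complex_eq_iff)
qed

lemma orthogonal_complement_subspace:
  "complex_vector.subspace {z. \<forall>k\<in>A. cinner z (e k :: 'h::complex_hilbert) = 0}"
  by (auto simp: complex_vector.subspace_def cinner.zero_left cinner_add_left cinner_scaleC_left)

lemma orthogonal_complement_closed: "closed {z. \<forall>k\<in>A. cinner z (e k :: 'h::complex_hilbert) = 0}"
proof -
  have "{z. \<forall>k\<in>A. cinner z (e k) = 0} = (\<Inter>k\<in>A. {z. cinner z (e k) = 0})" by auto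
  moreover have "closed {z. cinner z (e k) = 0}" for k
    by (intro closed_Collect_eq linear_continuous_on cinner.bounded_linear_left continuous_on_const)
  ultimately show ?thesis by auto
qed

text \<open>\<open>fst p\<close> and \<open>snd p\<close> are the n-th right and left singular
  vectors after the earlier pairs \<open>g\<close>. The maximality clause makes the singular values
  nonincreasing. The left vector is a component of its own because \<open>T (fst p)\<close> may
  vanish and then does not determine it.\<close>

definition greedy_svd_step ::
  "('h::complex_hilbert \<Rightarrow>\<^sub>L 'h) \<Rightarrow> (nat \<Rightarrow> 'h \<times> 'h) \<Rightarrow> nat \<Rightarrow> 'h \<times> 'h \<Rightarrow> bool" where
  "greedy_svd_step T g n p \<longleftrightarrow> norm (fst p) = 1 \<and> norm (snd p) = 1 \<and>
     (\<forall>k<n. cinner (fst p) (fst (g k)) = 0) \<and> (\<forall>k<n. cinner (snd p) (snd (g k)) = 0) \<and>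
     blinfun_apply T (fst p) = norm (blinfun_apply T (fst p)) *\<^sub>R snd p \<and>
     (\<forall>z. (\<forall>k<n. cinner z (fst (g k)) = 0) \<longrightarrow>
        norm (blinfun_apply T z) \<le> norm (blinfun_apply T (fst p)) * norm z)"

lemma orthonormal_of_triangular:
  fixes e :: "nat \<Rightarrow> 'h::complex_hilbert"
  assumes "norm (e m) = 1" "norm (e n) = 1" "\<And>k. k < n \<Longrightarrow> cinner (e n) (e k) = 0" "\<And>k. k < m \<Longrightarrow> cinner (e m) (e k) = 0"
  shows "cinner (e m) (e n) = (if m = n then 1 else 0)"
  using assms cinner_eq_0_sym[of "e m" "e n"] by (cases m n rule: linorder_cases) (auto simp: cinner_self)

text \<open>Maximality at the earlier steps makes the new image orthogonal to every
  \<open>T (e k)\<close>, hence to \<open>f k\<close>: when the new image is nonzero, so is each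
  \<open>T (e k)\<close>, whose norm is at least as large. When it is zero, any unit vector
  orthogonal to the earlier \<open>f k\<close> will do.\<close>

lemma greedy_svd_step_exists:
  fixes T :: "'h::complex_hilbert \<Rightarrow>\<^sub>L 'h"
  assumes inf: "\<nexists>B :: 'h set. finite B \<and> cspan B = UNIV" and T: "T \<in> compact_ops"
    and g: "\<And>k. k < n \<Longrightarrow> greedy_svd_step T g k (g k)"
  shows "\<exists>p. greedy_svd_step T g n p"
proof -
  define e f where "e k = fst (g k)" and "f k = snd (g k)" for k
  define V where "V n = {z. \<forall>k\<in>{..<n}. cinner z (e k) = 0}" for n
  have V: "closed (V n)" "complex_vector.subspace (V n)" for n
    unfolding V_def by (rule orthogonal_complement_closed orthogonal_complement_subspace)+
  have V': "subspace (V n)" for n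
    using V(2)[of n] by (auto simp: subspace_def complex_vector.subspace_def scaleR_eq_scaleC)
  have gD: "norm (e k) = 1" "norm (f k) = 1" "e k \<in> V k" "\<And>j. j < k \<Longrightarrow> cinner (f k) (f j) = 0"
    "blinfun_apply T (e k) = norm (blinfun_apply T (e k)) *\<^sub>R f k"
    "\<And>z. z \<in> V k \<Longrightarrow> norm (blinfun_apply T z) \<le> norm (blinfun_apply T (e k)) * norm z" if "k < n" for k
    using g[OF that] by (auto simp: greedy_svd_step_def e_def f_def V_def)
  have oe: "cinner (e j) (e k) = (if j = k then 1 else 0)" if "j < n" "k < n" for j k
    using gD(1,3)[OF that(1)] gD(1,3)[OF that(2)] by (intro orthonormal_of_triangular) (auto simp: V_def)
  have of: "cinner (f j) (f k) = (if j = k then 1 else 0)" if "j < n" "k < n" for j k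
    using gD(2,4)[OF that(1)] gD(2,4)[OF that(2)] by (intro orthonormal_of_triangular) auto
  obtain u where u: "norm u = 1" "\<And>k. k < n \<Longrightarrow> cinner u (e k) = 0"
    using exists_unit_orthogonal[OF inf oe] by blast
  then have "u \<in> V n" by (simp add: V_def)
  then obtain x where x: "x \<in> V n" "norm x = 1"
      "\<And>z. z \<in> V n \<Longrightarrow> norm (blinfun_apply T z) \<le> norm (blinfun_apply T x) * norm z"
    using compact_op_norm_attained[OF T V(1) V' _ u(1)] by blast
  have "\<exists>y. norm y = 1 \<and> (\<forall>k<n. cinner y (f k) = 0) \<and> blinfun_apply T x = norm (blinfun_apply T x) *\<^sub>R y"
  proof (cases "blinfun_apply T x = 0")
    case True
    obtain y where "norm y = 1" "\<And>k. k < n \<Longrightarrow> cinner y (f k) = 0"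
      using exists_unit_orthogonal[OF inf of] by blast
    then show ?thesis using True by auto
  next
    case False
    have "cinner (blinfun_apply T x) (f k) = 0" if k: "k < n" for k
    proof -
      have xk: "x \<in> V k" "cinner x (e k) = 0" using x(1) k by (auto simp: V_def)
      have "cinner (blinfun_apply T x) (blinfun_apply T (e k)) = 0"
        using norm_maximiser_orthogonal[OF compact_opsD(1)[OF T] V(2) gD(3)[OF k] gD(1)[OF k] gD(6)[OF k] xk] .
      then have "cinner (blinfun_apply T x) (norm (blinfun_apply T (e k)) *\<^sub>R f k) = 0"
        using gD(5)[OF k] by simp
      moreover have "norm (blinfun_apply T (e k)) \<noteq> 0"
        using gD(6)[OF k xk(1)] False x(2) by auto
      ultimately show ?thesis by (simp add: cinner.scaleR_right)
    qed
    then show ?thesis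
      using False by (intro exI[of _ "(1 / norm (blinfun_apply T x)) *\<^sub>R blinfun_apply T x"])
        (simp add: cinner.scaleR_left)
  qed
  then obtain y where "norm y = 1" "\<forall>k<n. cinner y (f k) = 0" "blinfun_apply T x = norm (blinfun_apply T x) *\<^sub>R y"
    by blast
  then have "greedy_svd_step T g n (x, y)"
    using x by (auto simp: greedy_svd_step_def V_def e_def f_def)
  then show ?thesis by blast
qed

theorem svd_exists:
  fixes T :: "'h::complex_hilbert \<Rightarrow>\<^sub>L 'h"
  assumes inf: "\<nexists>B :: 'h set. finite B \<and> cspan B = UNIV" and T: "T \<in> compact_ops"
  obtains s e f where "s \<in> c0_star" "ortho_seq e" "ortho_seq f" "T = diag_op s e f"
proof -
  have "\<exists>g. \<forall>n. greedy_svd_step T g n (g n)"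
  proof (rule dependent_wellorder_choice)
    show "greedy_svd_step T f n p = greedy_svd_step T g n p" if "\<And>k. k < n \<Longrightarrow> f k = g k" for p f g n
      using that by (simp add: greedy_svd_step_def)
    show "\<exists>p. greedy_svd_step T g n p" if "\<And>k. k < n \<Longrightarrow> greedy_svd_step T g k (g k)" for n g
      using greedy_svd_step_exists[OF inf T that] .
  qed
  then obtain g where g: "\<And>n. greedy_svd_step T g n (g n)" by blast
  define e f where "e k = fst (g k)" and "f k = snd (g k)" for k
  define s where "s k = norm (blinfun_apply T (e k))" for k
  have gD: "norm (e k) = 1" "norm (f k) = 1" "\<And>j. j < k \<Longrightarrow> cinner (e k) (e j) = 0"
    "\<And>j. j < k \<Longrightarrow> cinner (f k) (f j) = 0" "blinfun_apply T (e k) = s k *\<^sub>R f k"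
    "\<And>z. (\<And>j. j < k \<Longrightarrow> cinner z (e j) = 0) \<Longrightarrow> norm (blinfun_apply T z) \<le> s k * norm z" for k
    using g[of k] by (auto simp: greedy_svd_step_def e_def f_def s_def)
  have oe: "ortho_seq e" and of: "ortho_seq f"
    unfolding ortho_seq_def by (intro allI orthonormal_of_triangular gD; assumption)+
  have sdec: "s (Suc n) \<le> s n" for n
  proof -
    have "cinner (e (Suc n)) (e j) = 0" if "j < n" for j by (rule gD(3)) (use that in simp)
    then have "norm (blinfun_apply T (e (Suc n))) \<le> s n * norm (e (Suc n))" by (rule gD(6))
    then show ?thesis by (simp add: gD(1) s_def)
  qed
  have s0: "0 \<le> s n" for n by (simp add: s_def)
  have "decseq s" using sdec by (simp add: decseq_Suc_iff)
  then obtain L where L: "s \<longlonglongrightarrow> L" "\<And>n. L \<le> s n"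
    using decseq_convergent[of s 0] s0 by auto
  \<comment> \<open>The images of the \<open>e n\<close> are mutually orthogonal and of norm at
    least L, so they have no convergent subsequence if L > 0.\<close>
  have "L = 0"
  proof (rule ccontr)
    assume "L \<noteq> 0"
    then have Lp: "0 < L" using LIMSEQ_le_const[OF L(1), of 0] s0 by force
    obtain r y where r: "strict_mono r" "(\<lambda>n. blinfun_apply T (e (r n))) \<longlonglongrightarrow> y"
      using compact_ops_subseq[OF T, of e] gD(1) by auto
    obtain N where N: "\<forall>m\<ge>N. \<forall>n\<ge>N. norm (blinfun_apply T (e (r m)) - blinfun_apply T (e (r n))) < L"
      using CauchyD[OF LIMSEQ_imp_Cauchy[OF r(2)] Lp] by blast
    have ne: "r N \<noteq> r (Suc N)" using strict_monoD[OF r(1), of N "Suc N"] by simp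
    have "cinner (s (r N) *\<^sub>R f (r N)) (- (s (r (Suc N)) *\<^sub>R f (r (Suc N)))) = 0"
      using ne ortho_seqD(1)[OF of, of "r N" "r (Suc N)"]
      by (simp add: cinner.scaleR_left cinner.scaleR_right cinner.minus_right)
    from norm_add_orthogonal_sq[OF this]
    have "(norm (blinfun_apply T (e (r N)) - blinfun_apply T (e (r (Suc N)))))\<^sup>2 = (s (r N))\<^sup>2 + (s (r (Suc N)))\<^sup>2"
      by (simp add: gD)
    moreover have "L\<^sup>2 \<le> (s (r N))\<^sup>2" using L(2) Lp by (simp add: power_mono)
    moreover have "(norm (blinfun_apply T (e (r N)) - blinfun_apply T (e (r (Suc N)))))\<^sup>2 < L\<^sup>2"
      using N by (intro power_strict_mono) auto
    ultimately show False using zero_le_power2[of "s (r (Suc N))"] by linarith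
  qed
  then have s: "s \<in> c0_star" using s0 sdec L by (intro c0_starI) auto
  have B: "\<forall>n. \<bar>s n\<bar> \<le> s 0" using c0_starD(5)[OF s] by blast
  have "T = diag_op s e f"
  proof (rule blinfun_eqI)
    fix x
    \<comment> \<open>The part of x orthogonal to the first n right vectors. Its image has norm at
      most \<open>s n * norm x\<close>, so the series reaches \<open>T x\<close> even if
      \<open>e\<close> is not complete.\<close>
    define y where "y n = x - (\<Sum>k<n. cinner x (e k) *\<^sub>C e k)" for n
    have yo: "cinner (y n) (e k) = 0" if "k < n" for n k
      using that cinner_sum_ortho[OF oe, of "{..<n}" "\<lambda>k. cinner x (e k)" k] by (simp add: y_def cinner.diff_left)
    have "norm (y n) \<le> norm x" for n
    proof -
      have "cinner (y n) (\<Sum>k<n. cinner x (e k) *\<^sub>C e k) = 0"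
        by (simp add: cinner.sum_right cinner_scaleC_right yo)
      from norm_add_orthogonal_sq[OF this] have "(norm x)\<^sup>2 = (norm (y n))\<^sup>2 + (norm (\<Sum>k<n. cinner x (e k) *\<^sub>C e k))\<^sup>2"
        by (simp add: y_def)
      then have "(norm (y n))\<^sup>2 \<le> (norm x)\<^sup>2" by simp
      then show ?thesis by simp
    qed
    then have "s n * norm (y n) \<le> s n * norm x" for n by (rule mult_left_mono) (rule s0)
    moreover have "norm (blinfun_apply T (y n)) \<le> s n * norm (y n)" for n by (rule gD(6)) (rule yo)
    ultimately have Ty: "norm (blinfun_apply T (y n)) \<le> s n * norm x" for n by (rule order_trans[rotated])
    have TC: "blinfun_apply T (c *\<^sub>C z) = c *\<^sub>C blinfun_apply T z" for c z
      using compact_opsD(1)[OF T] by (simp add: BH_def)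
    have "blinfun_apply T (y n) = blinfun_apply T x - (\<Sum>k<n. (complex_of_real (s k) * cinner x (e k)) *\<^sub>C f k)" for n
      by (simp add: y_def blinfun.diff_right blinfun.sum_right TC gD(5) scaleR_eq_scaleC scaleC_scaleC mult.commute)
    moreover have "(\<lambda>n. blinfun_apply T (y n)) \<longlonglongrightarrow> 0"
      using Ty by (rule Lim_null_comparison[OF always_eventually[OF allI]])
        (use tendsto_mult_left_zero[OF c0_starD(3)[OF s]] in simp)
    ultimately have "(\<lambda>n. blinfun_apply T x - (blinfun_apply T x - (\<Sum>k<n. (complex_of_real (s k) * cinner x (e k)) *\<^sub>C f k)))
        \<longlonglongrightarrow> blinfun_apply T x - 0"
      by (intro tendsto_diff tendsto_const) simp
    then have "(\<lambda>k. (complex_of_real (s k) * cinner x (e k)) *\<^sub>C f k) sums blinfun_apply T x"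
      by (simp add: sums_def)
    then show "blinfun_apply T x = blinfun_apply (diag_op s e f) x"
      by (simp add: diag_op_apply[OF oe of B] sums_iff)
  qed
  then show ?thesis using that s oe of by blast
qed

section \<open>Inequalities for s-numbers\<close>

text \<open>Gaussian elimination, by induction on the number of equations. It provides a nonzero
  vector in the span of n + 1 basis vectors on which n given functionals vanish.\<close>

lemma homogeneous_system_nontrivial:
  fixes M :: "nat \<Rightarrow> 'i \<Rightarrow> 'f::field"
  assumes "finite A" "card A = Suc n"
  shows "\<exists>c. (\<exists>i\<in>A. c i \<noteq> 0) \<and> (\<forall>j<n. (\<Sum>i\<in>A. c i * M j i) = 0)"
  using assms
proof (induction n arbitrary: A M)
  case 0
  then obtain a where "A = {a}" by (auto simp: card_Suc_eq)
  then show ?case by (intro exI[of _ "\<lambda>_. 1"]) auto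
next
  case (Suc n)
  have "A \<noteq> {}" using Suc.prems by auto
  have extend: ?case
    if p: "p \<in> A" and c: "\<exists>i\<in>A - {p}. c i \<noteq> 0" and sol: "\<And>j. j \<le> n \<Longrightarrow> d * M j p + (\<Sum>i\<in>A - {p}. c i * M j i) = 0"
    for p c d
  proof (intro exI conjI allI impI)
    show "\<exists>i\<in>A. (c(p := d)) i \<noteq> 0" using c by auto
    fix j assume "j < Suc n"
    have "(\<Sum>i\<in>A - {p}. (c(p := d)) i * M j i) = (\<Sum>i\<in>A - {p}. c i * M j i)"
      by (rule sum.cong) simp_all
    then show "(\<Sum>i\<in>A. (c(p := d)) i * M j i) = 0"
      using sol[of j] \<open>j < Suc n\<close> by (simp add: sum.remove[OF Suc.prems(1) p])
  qed
  show ?case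
  proof (cases "\<forall>i\<in>A. M n i = 0")
    case True
    obtain p where p: "p \<in> A" using \<open>A \<noteq> {}\<close> by blast
    have "finite (A - {p})" "card (A - {p}) = Suc n" using Suc.prems p by simp_all
    from Suc.IH[OF this, of M]
    obtain c where c: "\<exists>i\<in>A - {p}. c i \<noteq> 0" "\<forall>j<n. (\<Sum>i\<in>A - {p}. c i * M j i) = 0"
      by blast
    show ?thesis
    proof (rule extend[OF p c(1)])
      fix j assume "j \<le> n"
      then consider "j < n" | "j = n" by linarith
      then show "0 * M j p + (\<Sum>i\<in>A - {p}. c i * M j i) = 0"
        using c(2) True by cases simp_all
    qed
  next
    case False
    then obtain p where p: "p \<in> A" "M n p \<noteq> 0" by blast
    have "finite (A - {p})" "card (A - {p}) = Suc n" using Suc.prems p by simp_all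
    \<comment> \<open>The last equation is solved for the pivot unknown p and substituted into the
      others.\<close>
    from Suc.IH[OF this, of "\<lambda>j i. M j i - M j p * M n i / M n p"]
    obtain c where c: "\<exists>i\<in>A - {p}. c i \<noteq> 0"
        "\<forall>j<n. (\<Sum>i\<in>A - {p}. c i * (M j i - M j p * M n i / M n p)) = 0"
      by blast
    show ?thesis
    proof (rule extend[OF p(1) c(1)])
      fix j assume "j \<le> n"
      have "(\<Sum>i\<in>A - {p}. c i * (M j i - M j p * M n i / M n p))
         = (\<Sum>i\<in>A - {p}. c i * M j i) - M j p / M n p * (\<Sum>i\<in>A - {p}. c i * M n i)"
        unfolding sum_distrib_left sum_subtractf[symmetric]
        by (rule sum.cong) (simp_all add: right_diff_distrib)
      moreover have "(\<Sum>i\<in>A - {p}. c i * (M j i - M j p * M n i / M n p)) = 0"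
      proof (cases "j = n")
        case True
        then show ?thesis using p(2) by simp
      next
        case False
        then show ?thesis using c(2) \<open>j \<le> n\<close> by simp
      qed
      ultimately show "(- (\<Sum>i\<in>A - {p}. c i * M n i) / M n p) * M j p + (\<Sum>i\<in>A - {p}. c i * M j i) = 0"
        by simp
    qed
  qed
qed

text \<open>The upper half of the minimax principle: the first n right singular vectors, taken as
  functionals, achieve the bound \<open>s n\<close>.\<close>

lemma norm_diag_op_orthogonal_le:
  fixes e :: "nat \<Rightarrow> 'h::complex_hilbert"
  assumes e: "ortho_seq e" and f: "ortho_seq f" and s: "s \<in> c0_star"
    and z: "\<And>k. k < n \<Longrightarrow> cinner z (e k) = 0"
  shows "norm (blinfun_apply (diag_op s e f) z) \<le> s n * norm z"
proof -
  define s' where "s' k = (if k < n then 0 else s k)" for k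
  have B: "\<forall>k. \<bar>s k\<bar> \<le> s 0" using c0_starD(5)[OF s] by blast
  have B': "\<forall>k. \<bar>s' k\<bar> \<le> s n" using c0_starD(1,2)[OF s] by (auto simp: s'_def decseq_def)
  have "(complex_of_real (s k) * cinner z (e k)) *\<^sub>C f k = (complex_of_real (s' k) * cinner z (e k)) *\<^sub>C f k" for k
    using z by (auto simp: s'_def)
  then have "blinfun_apply (diag_op s e f) z = blinfun_apply (diag_op s' e f) z"
    unfolding diag_op_apply[OF e f B] diag_op_apply[OF e f B'] by (rule suminf_cong)
  then show ?thesis using norm_diag_op_le[OF e f B'] by simp
qed

text \<open>The lower half: n functionals have a common nonzero zero in the span of e 0, ..., e n,
  and there the operator stretches by at least \<open>s n\<close>. Working with functionals rather
  than subspaces lets bounds for two operators be combined by joining the two lists.\<close>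

lemma s_number_le_of_functionals:
  fixes e :: "nat \<Rightarrow> 'h::complex_hilbert" and \<phi> :: "nat \<Rightarrow> 'h \<Rightarrow> complex"
  assumes e: "ortho_seq e" and f: "ortho_seq f" and s: "s \<in> c0_star"
    and \<phi>: "\<And>j x y. \<phi> j (x + y) = \<phi> j x + \<phi> j y" "\<And>j a x. \<phi> j (a *\<^sub>C x) = a * \<phi> j x"
    and c: "\<And>z. (\<And>j. j < n \<Longrightarrow> \<phi> j z = 0) \<Longrightarrow> norm (blinfun_apply (diag_op s e f) z) \<le> c * norm z"
  shows "s n \<le> c"
proof -
  have B: "\<forall>k. \<bar>s k\<bar> \<le> s 0" using c0_starD(5)[OF s] by blast
  have \<phi>0: "\<phi> j 0 = 0" for j using \<phi>(2)[of j 0 0] by (simp add: scaleC.zero_left)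
  have \<phi>sum: "\<phi> j (\<Sum>i\<in>A. a i *\<^sub>C e i) = (\<Sum>i\<in>A. a i * \<phi> j (e i))" for j a and A :: "nat set"
    by (induction A rule: infinite_finite_induct) (simp_all add: \<phi> \<phi>0)
  obtain a where a: "\<exists>i\<in>{..n}. a i \<noteq> 0" "\<forall>j<n. (\<Sum>i\<in>{..n}. a i * \<phi> j (e i)) = 0"
    using homogeneous_system_nontrivial[of "{..n}" n "\<lambda>j i. \<phi> j (e i)"] by auto
  define z where "z = (\<Sum>i\<le>n. a i *\<^sub>C e i)"
  have lin: "blinfun_apply (diag_op s e f) (b *\<^sub>C x) = b *\<^sub>C blinfun_apply (diag_op s e f) x" for b x
    using diag_op_carrier[OF e f B] by (simp add: BH_def)
  have nz: "(norm z)\<^sup>2 = (\<Sum>i\<le>n. (cmod (a i))\<^sup>2)" by (simp add: z_def norm_sum_ortho[OF e])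
  have Tz: "blinfun_apply (diag_op s e f) z = (\<Sum>i\<le>n. (a i * complex_of_real (s i)) *\<^sub>C f i)"
    by (simp add: z_def blinfun.sum_right lin diag_op_basis[OF e f B] scaleC_scaleC)
  have "(s n)\<^sup>2 * (norm z)\<^sup>2 \<le> (\<Sum>i\<le>n. (s i)\<^sup>2 * (cmod (a i))\<^sup>2)"
    unfolding nz sum_distrib_left using c0_starD(1,2)[OF s]
    by (intro sum_mono mult_right_mono power_mono) (auto simp: decseq_def)
  also have "\<dots> = (norm (blinfun_apply (diag_op s e f) z))\<^sup>2"
    by (simp add: Tz norm_sum_ortho[OF f] norm_mult power_mult_distrib mult.commute)
  finally have "(s n * norm z)\<^sup>2 \<le> (norm (blinfun_apply (diag_op s e f) z))\<^sup>2"
    by (simp add: power_mult_distrib)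
  then have "s n * norm z \<le> norm (blinfun_apply (diag_op s e f) z)"
    by (rule power2_le_imp_le) simp
  also have "\<dots> \<le> c * norm z" by (rule c) (simp add: z_def \<phi>sum a(2))
  finally have "s n * norm z \<le> c * norm z" .
  moreover obtain i where "i \<le> n" "a i \<noteq> 0" using a(1) by auto
  then have "0 < (norm z)\<^sup>2" unfolding nz by (intro sum_pos2[of _ i]) auto
  ultimately show ?thesis by simp
qed

section \<open>Calkin correspondence\<close>

text \<open>The ampliation with parameter m reads n div m because indices start at 0.\<close>

definition calkin_set :: "(nat \<Rightarrow> real) set \<Rightarrow> bool" where
  "calkin_set S \<longleftrightarrow> S \<subseteq> c0_star \<and> (\<lambda>_. 0) \<in> S \<and> (\<forall>\<xi>\<in>S. \<forall>\<eta>\<in>S. (\<lambda>n. \<xi> n + \<eta> n) \<in> S) \<and>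
     (\<forall>\<xi>\<in>S. \<forall>\<eta>\<in>c0_star. (\<forall>n. \<eta> n \<le> \<xi> n) \<longrightarrow> \<eta> \<in> S) \<and>
     (\<forall>\<xi>\<in>S. \<forall>m>0. (\<lambda>n. \<xi> (n div m)) \<in> S)"

lemma calkin_setD:
  assumes "calkin_set S"
  shows "S \<subseteq> c0_star" "(\<lambda>_. 0) \<in> S" "\<xi> \<in> S \<Longrightarrow> \<eta> \<in> S \<Longrightarrow> (\<lambda>n. \<xi> n + \<eta> n) \<in> S"
    "\<xi> \<in> S \<Longrightarrow> \<eta> \<in> c0_star \<Longrightarrow> (\<And>n. \<eta> n \<le> \<xi> n) \<Longrightarrow> \<eta> \<in> S"
    "\<xi> \<in> S \<Longrightarrow> m > 0 \<Longrightarrow> (\<lambda>n. \<xi> (n div m)) \<in> S"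
  using assms unfolding calkin_set_def by blast+

lemma calkin_set_dominated:
  assumes S: "calkin_set S" and \<xi>: "\<xi> \<in> S" and \<eta>: "\<eta> \<in> c0_star" "\<And>n. \<eta> n \<le> c * \<xi> n"
  shows "\<eta> \<in> S"
proof -
  have "(\<lambda>n. real k * \<xi> n) \<in> S" for k
  proof (induction k)
    case (Suc k)
    then show ?case using calkin_setD(3)[OF S Suc \<xi>] by (simp add: algebra_simps)
  qed (simp add: calkin_setD(2)[OF S])
  moreover obtain k where k: "c \<le> real k" using real_arch_simple by blast
  moreover have "\<xi> \<in> c0_star" using \<xi> calkin_setD(1)[OF S] by blast
  then have "\<eta> n \<le> real k * \<xi> n" for n
    by (rule order_trans[OF \<eta>(2) mult_right_mono[OF k c0_starD(1)]])
  ultimately show ?thesis using calkin_setD(4)[OF S _ \<eta>(1)] by blast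
qed

context
  assumes inf: "\<nexists>B :: 'h::complex_hilbert set. finite B \<and> cspan B = UNIV"
begin

lemma svd_s_numbers:
  fixes T :: "'h \<Rightarrow>\<^sub>L 'h"
  assumes "T \<in> compact_ops"
  obtains e f where "s_numbers T \<in> c0_star" "ortho_seq e" "ortho_seq f" "T = diag_op (s_numbers T) e f"
proof -
  obtain s e f where *: "s \<in> c0_star" "ortho_seq e" "ortho_seq f" "T = diag_op s e f"
    by (rule svd_exists[OF inf assms])
  have sn: "s_numbers T = s" unfolding *(4) by (rule s_numbers_diag_op[OF *(2,3,1)])
  show ?thesis by (rule that[of e f, unfolded sn]) (rule *)+
qed

lemma ortho_seq_exists: obtains e :: "nat \<Rightarrow> 'h" where "ortho_seq e"
proof -
  have "(0 :: 'h \<Rightarrow>\<^sub>L 'h) \<in> compact_ops"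
    by (rule compact_opsI[where K = "{0}"]) (auto simp: BH_def scaleC.zero_right)
  then obtain e f where "ortho_seq (e :: nat \<Rightarrow> 'h)" by (rule svd_s_numbers)
  then show ?thesis by (rule that)
qed

lemma s_numbers_in_c0_star: "T \<in> compact_ops \<Longrightarrow> s_numbers T \<in> c0_star" for T :: "'h \<Rightarrow>\<^sub>L 'h"
  by (rule svd_s_numbers)

lemma s_numbers_add_le:
  fixes A B :: "'h \<Rightarrow>\<^sub>L 'h"
  assumes A: "A \<in> compact_ops" and B: "B \<in> compact_ops"
  shows "s_numbers (A + B) (m + n) \<le> s_numbers A m + s_numbers B n"
proof -
  obtain e f where a: "s_numbers A \<in> c0_star" "ortho_seq e" "ortho_seq f" "A = diag_op (s_numbers A) e f"
    by (rule svd_s_numbers[OF A])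
  obtain e' f' where b: "s_numbers B \<in> c0_star" "ortho_seq e'" "ortho_seq f'" "B = diag_op (s_numbers B) e' f'"
    by (rule svd_s_numbers[OF B])
  obtain e'' f'' where c: "s_numbers (A + B) \<in> c0_star" "ortho_seq e''" "ortho_seq f''" "A + B = diag_op (s_numbers (A + B)) e'' f''"
    by (rule svd_s_numbers[OF compact_ops_add[OF A B]])
  \<comment> \<open>The first m right singular vectors of A followed by the first n of B.\<close>
  define \<phi> where "\<phi> j x = cinner x (if j < m then e j else e' (j - m))" for j x
  show ?thesis
  proof (rule s_number_le_of_functionals[OF c(2,3,1), of \<phi>])
    fix z assume z: "\<And>j. j < m + n \<Longrightarrow> \<phi> j z = 0"
    have "cinner z (e j) = 0" if "j < m" for j using z[of j] that by (simp add: \<phi>_def)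
    then have "norm (blinfun_apply A z) \<le> s_numbers A m * norm z"
      by (rule norm_diag_op_orthogonal_le[OF a(2,3,1), folded a(4)])
    moreover have "cinner z (e' j) = 0" if "j < n" for j using z[of "m + j"] that by (simp add: \<phi>_def)
    then have "norm (blinfun_apply B z) \<le> s_numbers B n * norm z"
      by (rule norm_diag_op_orthogonal_le[OF b(2,3,1), folded b(4)])
    ultimately have "norm (blinfun_apply (A + B) z) \<le> (s_numbers A m + s_numbers B n) * norm z"
      using norm_triangle_ineq[of "blinfun_apply A z" "blinfun_apply B z"]
      by (simp add: blinfun.add_left distrib_right)
    then show "norm (blinfun_apply (diag_op (s_numbers (A + B)) e'' f'') z) \<le> (s_numbers A m + s_numbers B n) * norm z"
      unfolding c(4)[symmetric] .
  qed (simp_all add: \<phi>_def cinner_add_left cinner_scaleC_left)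
qed

lemma s_numbers_compose_le:
  fixes T X :: "'h \<Rightarrow>\<^sub>L 'h"
  assumes T: "T \<in> compact_ops" and X: "X \<in> carrier BH"
  shows "s_numbers (X o\<^sub>L T) n \<le> norm X * s_numbers T n" "s_numbers (T o\<^sub>L X) n \<le> norm X * s_numbers T n"
proof -
  obtain e f where a: "s_numbers T \<in> c0_star" "ortho_seq e" "ortho_seq f" "T = diag_op (s_numbers T) e f"
    by (rule svd_s_numbers[OF T])
  have le: "norm (blinfun_apply T z) \<le> s_numbers T n * norm z" if "\<And>j. j < n \<Longrightarrow> cinner z (e j) = 0" for z
    by (rule norm_diag_op_orthogonal_le[OF a(2,3,1), folded a(4)]) (rule that)
  show "s_numbers (X o\<^sub>L T) n \<le> norm X * s_numbers T n"
  proof -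
    obtain e' f' where b: "s_numbers (X o\<^sub>L T) \<in> c0_star" "ortho_seq e'" "ortho_seq f'" "X o\<^sub>L T = diag_op (s_numbers (X o\<^sub>L T)) e' f'"
      by (rule svd_s_numbers[OF compact_ops_compose_left[OF X T]])
    show ?thesis
    proof (rule s_number_le_of_functionals[OF b(2,3,1), of "\<lambda>j x. cinner x (e j)"])
      fix z assume "\<And>j. j < n \<Longrightarrow> cinner z (e j) = 0"
      then have "norm X * norm (blinfun_apply T z) \<le> norm X * (s_numbers T n * norm z)"
        by (intro mult_left_mono le) auto
      moreover have "norm (blinfun_apply (X o\<^sub>L T) z) \<le> norm X * norm (blinfun_apply T z)"
        by (simp add: norm_blinfun)
      ultimately show "norm (blinfun_apply (diag_op (s_numbers (X o\<^sub>L T)) e' f') z) \<le> norm X * s_numbers T n * norm z"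
        unfolding b(4)[symmetric] by (simp add: mult.assoc)
    qed (simp_all add: cinner_add_left cinner_scaleC_left)
  qed
  show "s_numbers (T o\<^sub>L X) n \<le> norm X * s_numbers T n"
  proof -
    obtain e' f' where b: "s_numbers (T o\<^sub>L X) \<in> c0_star" "ortho_seq e'" "ortho_seq f'" "T o\<^sub>L X = diag_op (s_numbers (T o\<^sub>L X)) e' f'"
      by (rule svd_s_numbers[OF compact_ops_compose_right[OF X T]])
    \<comment> \<open>Pulling the functionals back along X replaces an adjoint of X.\<close>
    show ?thesis
    proof (rule s_number_le_of_functionals[OF b(2,3,1), of "\<lambda>j x. cinner (blinfun_apply X x) (e j)"])
      fix z assume "\<And>j. j < n \<Longrightarrow> cinner (blinfun_apply X z) (e j) = 0"
      then have "norm (blinfun_apply T (blinfun_apply X z)) \<le> s_numbers T n * norm (blinfun_apply X z)"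
        by (rule le)
      also have "\<dots> \<le> s_numbers T n * (norm X * norm z)"
        by (intro mult_left_mono norm_blinfun c0_starD(1)[OF a(1)])
      finally show "norm (blinfun_apply (diag_op (s_numbers (T o\<^sub>L X)) e' f') z) \<le> norm X * s_numbers T n * norm z"
        unfolding b(4)[symmetric] by (simp add: mult_ac)
    qed (use X in \<open>simp_all add: cinner_add_left cinner_scaleC_left blinfun.add_right BH_def\<close>)
  qed
qed

end

section \<open>Operator ideals and the bijection with characteristic sets\<close>

text \<open>An explicit form of what \<open>ideal_with\<close> only describes;
  \<open>calkin_correspondence\<close> shows that they agree.\<close>

definition ops_of :: "(nat \<Rightarrow> real) set \<Rightarrow> ('h::complex_hilbert \<Rightarrow>\<^sub>L 'h) set" where
  "ops_of S = {T \<in> compact_ops. s_numbers T \<in> S}"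

lemma a_inv_BH:
  assumes "T \<in> carrier (BH :: ('h::complex_hilbert \<Rightarrow>\<^sub>L 'h) ring)"
  shows "inv\<^bsub>add_monoid BH\<^esub> T = - T"
proof -
  interpret ring "BH :: ('h \<Rightarrow>\<^sub>L 'h) ring" by (rule ring_BH)
  have "- T \<in> carrier BH"
    using assms by (simp add: BH_def blinfun.minus_left complex_vector.scale_minus_right)
  moreover have "(- T) \<oplus>\<^bsub>BH\<^esub> T = \<zero>\<^bsub>BH\<^esub>" by (simp add: BH_def)
  ultimately have "\<ominus>\<^bsub>BH\<^esub> T = - T" using minus_equality assms by blast
  then show ?thesis by (simp add: a_inv_def)
qed

lemma minus_id_in_BH: "- id_blinfun \<in> carrier (BH :: ('h::complex_hilbert \<Rightarrow>\<^sub>L 'h) ring)"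
  by (simp add: BH_def blinfun.minus_left complex_vector.scale_minus_right)

lemma op_idealI:
  fixes J :: "('h::complex_hilbert \<Rightarrow>\<^sub>L 'h) set"
  assumes J: "J \<subseteq> compact_ops" "0 \<in> J"
    and add: "\<And>A B. A \<in> J \<Longrightarrow> B \<in> J \<Longrightarrow> A + B \<in> J"
    and l: "\<And>X T. X \<in> carrier BH \<Longrightarrow> T \<in> J \<Longrightarrow> X o\<^sub>L T \<in> J"
    and r: "\<And>X T. X \<in> carrier BH \<Longrightarrow> T \<in> J \<Longrightarrow> T o\<^sub>L X \<in> J"
  shows "op_ideal J"
proof -
  have Jc: "J \<subseteq> carrier BH" using J compact_opsD(1) by blast
  have neg: "- T \<in> J" if "T \<in> J" for T
  proof -
    have "(- id_blinfun) o\<^sub>L T = - T" by (rule blinfun_eqI) (simp add: blinfun.minus_left)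
    then show ?thesis using l[OF minus_id_in_BH that] by simp
  qed
  have "subgroup J (add_monoid BH)"
  proof (rule group.subgroupI)
    interpret ring "BH :: ('h \<Rightarrow>\<^sub>L 'h) ring" by (rule ring_BH)
    show "Group.group (add_monoid (BH :: ('h \<Rightarrow>\<^sub>L 'h) ring))" by (rule a_group)
    show "J \<subseteq> carrier (add_monoid BH)" using Jc by simp
    show "J \<noteq> {}" using J by blast
    show "inv\<^bsub>add_monoid BH\<^esub> T \<in> J" if "T \<in> J" for T
      using neg[OF that] Jc that by (subst a_inv_BH) auto
    show "A \<otimes>\<^bsub>add_monoid BH\<^esub> B \<in> J" if "A \<in> J" "B \<in> J" for A B
      using add[OF that] by (simp add: BH_def)
  qed
  then have "ideal J BH"
    by (rule idealI[OF ring_BH]) (use l r in \<open>simp_all add: BH_def\<close>)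
  then show ?thesis using J by (simp add: op_ideal_def)
qed

lemma op_idealD:
  fixes J :: "('h::complex_hilbert \<Rightarrow>\<^sub>L 'h) set"
  assumes "op_ideal J"
  shows "J \<subseteq> compact_ops" "0 \<in> J" "A \<in> J \<Longrightarrow> B \<in> J \<Longrightarrow> A + B \<in> J"
    "X \<in> carrier BH \<Longrightarrow> T \<in> J \<Longrightarrow> X o\<^sub>L T \<in> J" "X \<in> carrier BH \<Longrightarrow> T \<in> J \<Longrightarrow> T o\<^sub>L X \<in> J"
proof -
  interpret ideal J BH using assms by (simp add: op_ideal_def)
  show "J \<subseteq> compact_ops" using assms by (simp add: op_ideal_def)
  show "0 \<in> J" using additive_subgroup.zero_closed[OF is_additive_subgroup] by (simp add: BH_def)
  show "A \<in> J \<Longrightarrow> B \<in> J \<Longrightarrow> A + B \<in> J" using additive_subgroup.a_closed[OF is_additive_subgroup, of A B] by (simp add: BH_def)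
  show "X \<in> carrier BH \<Longrightarrow> T \<in> J \<Longrightarrow> X o\<^sub>L T \<in> J" using I_l_closed[of T X] by (simp add: BH_def)
  show "X \<in> carrier BH \<Longrightarrow> T \<in> J \<Longrightarrow> T o\<^sub>L X \<in> J" using I_r_closed[of T X] by (simp add: BH_def)
qed

lemma op_ideal_Int: "op_ideal I \<Longrightarrow> op_ideal J \<Longrightarrow> op_ideal (I \<inter> J)"
  by (rule op_idealI) (auto dest: op_idealD)

lemma diag_op_zero: "ortho_seq e \<Longrightarrow> ortho_seq f \<Longrightarrow> diag_op (\<lambda>_. 0) e f = 0"
  by (rule blinfun_eqI) (simp add: diag_op_apply[where B = 0] scaleC.zero_left)

text \<open>Changing the orthonormal systems is multiplication by partial isometries from both
  sides, one of them merged with the multiplier m. So membership does not depend on the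
  systems.\<close>

lemma diag_op_in_ideal:
  fixes e :: "nat \<Rightarrow> 'h::complex_hilbert"
  assumes J: "op_ideal J" and T: "diag_op s e f \<in> J" and s: "Bseq s" and m: "Bseq m"
    and o: "ortho_seq e" "ortho_seq f" "ortho_seq e'" "ortho_seq f'"
  shows "diag_op (\<lambda>n. m n * s n) e' f' \<in> J"
proof -
  have one: "Bseq (\<lambda>_::nat. 1 :: real)" by simp
  obtain B where B: "\<forall>n. \<bar>m n\<bar> \<le> B" using m BseqE_abs by blast
  have c: "diag_op m f f' \<in> carrier BH" by (rule diag_op_carrier[OF o(2,4) B])
  have c1: "diag_op (\<lambda>_. 1) e' e \<in> carrier BH" by (rule diag_op_carrier[OF o(3,1), of _ 1]) simp
  have "diag_op m f f' o\<^sub>L (diag_op s e f o\<^sub>L diag_op (\<lambda>_. 1) e' e) \<in> J"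
    by (intro op_idealD(4,5)[OF J] c c1 T)
  moreover have "diag_op s e f o\<^sub>L diag_op (\<lambda>_. 1) e' e = diag_op s e' f"
    using diag_op_compose[OF o(3,1,2) s one] by simp
  moreover have "diag_op m f f' o\<^sub>L diag_op s e' f = diag_op (\<lambda>n. m n * s n) e' f'"
    by (rule diag_op_compose[OF o(3,2,4) m s])
  ultimately show ?thesis by simp
qed

text \<open>The ampliation by m splits along the residues of n modulo m; each piece is a copy of the
  original operator on a subsequence of \<open>e\<close>.\<close>

lemma diag_op_subsequence:
  fixes e :: "nat \<Rightarrow> 'h::complex_hilbert"
  assumes e: "ortho_seq e" and s: "Bseq s" and m: "m > 0" and r: "r < m"
  shows "diag_op (\<lambda>n. if n mod m = r then s (n div m) else 0) e e
    = diag_op s (\<lambda>k. e (m * k + r)) (\<lambda>k. e (m * k + r))" (is "diag_op ?s e e = diag_op s ?e ?e")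
proof (rule blinfun_eqI)
  fix x
  obtain B where B: "\<forall>n. \<bar>s n\<bar> \<le> B" using s BseqE_abs by blast
  then have "0 \<le> B" using abs_ge_zero order_trans by blast
  then have B': "\<forall>n. \<bar>?s n\<bar> \<le> B" using B by auto
  have e': "ortho_seq ?e"
    using m unfolding ortho_seq_def by (simp add: ortho_seqD(1)[OF e])
  let ?g = "\<lambda>n. (complex_of_real (?s n) * cinner x (e n)) *\<^sub>C e n"
  have "(\<Sum>k. ?g (m * k + r)) = (\<Sum>n. ?g n)"
  proof (rule suminf_mono_reindex)
    show "strict_mono (\<lambda>k. m * k + r)" using m by (simp add: strict_mono_def)
    fix n assume n: "n \<notin> range (\<lambda>k. m * k + r)"
    have "n mod m \<noteq> r"
    proof
      assume "n mod m = r"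
      then have "n = m * (n div m) + r" using mult_div_mod_eq[of m n] by simp
      then show False using n by blast
    qed
    then show "?g n = 0" by (simp add: scaleC.zero_left)
  qed
  moreover have "(m * k + r) mod m = r" "(m * k + r) div m = k" for k using r by simp_all
  ultimately show "blinfun_apply (diag_op ?s e e) x = blinfun_apply (diag_op s ?e ?e) x"
    by (simp add: diag_op_apply[OF e e B'] diag_op_apply[OF e' e' B])
qed

lemma c0_star_add: "\<xi> \<in> c0_star \<Longrightarrow> \<eta> \<in> c0_star \<Longrightarrow> (\<lambda>n. \<xi> n + \<eta> n) \<in> c0_star"
proof (rule c0_starI)
  assume a: "\<xi> \<in> c0_star" "\<eta> \<in> c0_star"
  show "0 \<le> \<xi> n + \<eta> n" for n using c0_starD(1)[OF a(1)] c0_starD(1)[OF a(2)] by (rule add_nonneg_nonneg)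
  show "\<xi> (Suc n) + \<eta> (Suc n) \<le> \<xi> n + \<eta> n" for n
    using decseq_SucD[OF c0_starD(2)[OF a(1)]] decseq_SucD[OF c0_starD(2)[OF a(2)]] by (rule add_mono)
  show "(\<lambda>n. \<xi> n + \<eta> n) \<longlonglongrightarrow> 0"
    using tendsto_add[OF c0_starD(3)[OF a(1)] c0_starD(3)[OF a(2)]] by simp
qed

lemma filterlim_div_at_top: "m > 0 \<Longrightarrow> filterlim (\<lambda>n::nat. n div m) at_top sequentially"
  unfolding filterlim_at_top eventually_sequentially
proof
  fix Z assume m: "m > (0::nat)"
  show "\<exists>N. \<forall>n\<ge>N. Z \<le> n div m"
    using m by (intro exI[of _ "Z * m"]) (simp add: less_eq_div_iff_mult_less_eq)
qed

lemma c0_star_ampliation: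
  assumes "\<xi> \<in> c0_star" "m > 0" shows "(\<lambda>n. \<xi> (n div m)) \<in> c0_star"
proof (rule c0_starI)
  show "0 \<le> \<xi> (n div m)" for n by (rule c0_starD(1)[OF assms(1)])
  show "\<xi> (Suc n div m) \<le> \<xi> (n div m)" for n
    using c0_starD(2)[OF assms(1)] by (rule decseqD) (simp add: div_le_mono)
  show "(\<lambda>n. \<xi> (n div m)) \<longlonglongrightarrow> 0"
    by (rule filterlim_compose[OF c0_starD(3)[OF assms(1)] filterlim_div_at_top[OF assms(2)]])
qed

context
  assumes inf: "\<nexists>B :: 'h::complex_hilbert set. finite B \<and> cspan B = UNIV"
begin

lemma s_numbers_zero: "(0 :: 'h \<Rightarrow>\<^sub>L 'h) \<in> compact_ops" "s_numbers (0 :: 'h \<Rightarrow>\<^sub>L 'h) = (\<lambda>_. 0)"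
proof -
  obtain e :: "nat \<Rightarrow> 'h" where e: "ortho_seq e" by (rule ortho_seq_exists[OF inf])
  have z: "(\<lambda>_. 0) \<in> c0_star" by (rule c0_starI) auto
  show "s_numbers (0 :: 'h \<Rightarrow>\<^sub>L 'h) = (\<lambda>_. 0)"
    using s_numbers_diag_op[OF e e z] diag_op_zero[OF e e] by simp
  show "(0 :: 'h \<Rightarrow>\<^sub>L 'h) \<in> compact_ops"
    using diag_op_compact[OF e e c0_starD(3)[OF z]] diag_op_zero[OF e e] by simp
qed

text \<open>Ampliation invariance serves the sums: \<open>s_numbers_add_le\<close> splits the index,
  so A + B is controlled by the ampliations by 2.\<close>

lemma op_ideal_ops_of:
  assumes S: "calkin_set S"
  shows "op_ideal (ops_of S :: ('h \<Rightarrow>\<^sub>L 'h) set)"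
proof (rule op_idealI)
  show "(0 :: 'h \<Rightarrow>\<^sub>L 'h) \<in> ops_of S" using calkin_setD(2)[OF S] by (simp add: ops_of_def s_numbers_zero)
next
  fix A B :: "'h \<Rightarrow>\<^sub>L 'h" assume AB: "A \<in> ops_of S" "B \<in> ops_of S"
  then have c: "A \<in> compact_ops" "B \<in> compact_ops" "s_numbers A \<in> S" "s_numbers B \<in> S"
    by (simp_all add: ops_of_def)
  have c0: "s_numbers (A + B) \<in> c0_star" by (rule s_numbers_in_c0_star[OF inf compact_ops_add[OF c(1,2)]])
  have "(\<lambda>n. s_numbers A (n div 2) + s_numbers B (n div 2)) \<in> S"
    using calkin_setD(3)[OF S calkin_setD(5)[OF S c(3), of 2] calkin_setD(5)[OF S c(4), of 2]] by simp
  then have "s_numbers (A + B) \<in> S"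
  proof (rule calkin_setD(4)[OF S _ c0])
    fix n
    have "s_numbers (A + B) n \<le> s_numbers (A + B) (n div 2 + n div 2)"
      by (rule decseqD[OF c0_starD(2)[OF c0]]) simp
    also have "\<dots> \<le> s_numbers A (n div 2) + s_numbers B (n div 2)"
      by (rule s_numbers_add_le[OF inf c(1,2)])
    finally show "s_numbers (A + B) n \<le> s_numbers A (n div 2) + s_numbers B (n div 2)" .
  qed
  then show "A + B \<in> ops_of S" using c by (simp add: ops_of_def compact_ops_add)
next
  fix X T :: "'h \<Rightarrow>\<^sub>L 'h" assume X: "X \<in> carrier BH" and "T \<in> ops_of S"
  then have T: "T \<in> compact_ops" "s_numbers T \<in> S" by (simp_all add: ops_of_def)
  note l = compact_ops_compose_left[OF X T(1)] and r = compact_ops_compose_right[OF X T(1)]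
  show "X o\<^sub>L T \<in> ops_of S"
    using l calkin_set_dominated[OF S T(2) s_numbers_in_c0_star[OF inf l] s_numbers_compose_le(1)[OF inf T(1) X]]
    by (simp add: ops_of_def)
  show "T o\<^sub>L X \<in> ops_of S"
    using r calkin_set_dominated[OF S T(2) s_numbers_in_c0_star[OF inf r] s_numbers_compose_le(2)[OF inf T(1) X]]
    by (simp add: ops_of_def)
qed (auto simp: ops_of_def)

lemma char_set_ops_of:
  assumes S: "S \<subseteq> c0_star"
  shows "char_set (ops_of S :: ('h \<Rightarrow>\<^sub>L 'h) set) = S"
proof
  obtain e :: "nat \<Rightarrow> 'h" where e: "ortho_seq e" by (rule ortho_seq_exists[OF inf])
  show "S \<subseteq> char_set (ops_of S :: ('h \<Rightarrow>\<^sub>L 'h) set)"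
  proof
    fix s assume "s \<in> S"
    then have s: "s \<in> c0_star" using S by blast
    have "diag_op s e e \<in> ops_of S"
      using \<open>s \<in> S\<close> diag_op_compact[OF e e c0_starD(3)[OF s]] s_numbers_diag_op[OF e e s] by (simp add: ops_of_def)
    then show "s \<in> char_set (ops_of S :: ('h \<Rightarrow>\<^sub>L 'h) set)"
      unfolding char_set_def using s_numbers_diag_op[OF e e s] by (metis imageI)
  qed
qed (auto simp: char_set_def ops_of_def)

text \<open>An operator of J with s-numbers s is moved to the prescribed systems and shrunk by the
  multiplier t / s, which may be set to 0 where s vanishes because t vanishes there too.\<close>

lemma char_set_diag_op:
  assumes J: "op_ideal (J :: ('h \<Rightarrow>\<^sub>L 'h) set)" and s: "s \<in> char_set J" and e: "ortho_seq (e :: nat \<Rightarrow> 'h)" "ortho_seq f"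
    and t: "\<And>n. 0 \<le> t n" "\<And>n. t n \<le> s n"
  shows "s \<in> c0_star" "diag_op t e f \<in> J"
proof -
  obtain T where T: "T \<in> J" "s = s_numbers T" using s by (auto simp: char_set_def)
  then have "T \<in> compact_ops" using op_idealD(1)[OF J] by blast
  then obtain e' f' where d: "s_numbers T \<in> c0_star" "ortho_seq e'" "ortho_seq f'" "T = diag_op (s_numbers T) e' f'"
    by (rule svd_s_numbers[OF inf])
  show s0: "s \<in> c0_star" using d T by simp
  define m where "m n = (if s n = 0 then 0 else t n / s n)" for n
  have "\<bar>m n\<bar> \<le> 1" for n
    using t(1)[of n] t(2)[of n] by (auto simp: m_def divide_le_eq)
  then have m: "Bseq m" by (intro BseqI[of 1]) auto
  have "m n * s n = t n" for n using t(1)[of n] t(2)[of n] by (auto simp: m_def)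
  moreover have "diag_op s e' f' \<in> J" using T d(4) by simp
  ultimately show "diag_op t e f \<in> J"
    using diag_op_in_ideal[OF J _ c0_starD(4)[OF s0] m d(2,3) e] by simp
qed

lemma calkin_set_char_set:
  assumes J: "op_ideal (J :: ('h \<Rightarrow>\<^sub>L 'h) set)"
  shows "calkin_set (char_set J)"
proof -
  obtain e :: "nat \<Rightarrow> 'h" where e: "ortho_seq e" by (rule ortho_seq_exists[OF inf])
  have sub: "char_set J \<subseteq> c0_star"
    using op_idealD(1)[OF J] s_numbers_in_c0_star[OF inf] by (auto simp: char_set_def)
  have nonneg: "0 \<le> \<xi> n" if "\<xi> \<in> char_set J" for \<xi> n using sub that c0_starD(1) by blast
  have mem: "\<xi> \<in> char_set J" if "diag_op \<xi> e e \<in> J" "\<xi> \<in> c0_star" for \<xi>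
    unfolding char_set_def using that s_numbers_diag_op[OF e e that(2)] by (metis imageI)
  have d: "diag_op \<xi> e e \<in> J" if "\<xi> \<in> char_set J" for \<xi>
    by (rule char_set_diag_op(2)[OF J that e e nonneg[OF that] order_refl])
  have "(\<lambda>_. 0) \<in> c0_star" by (rule c0_starI) auto
  then have "(\<lambda>_. 0) \<in> char_set J"
    using mem op_idealD(2)[OF J] diag_op_zero[OF e e] by simp
  moreover have "(\<lambda>n. \<xi> n + \<eta> n) \<in> char_set J" if "\<xi> \<in> char_set J" "\<eta> \<in> char_set J" for \<xi> \<eta>
  proof (rule mem)
    have c: "\<xi> \<in> c0_star" "\<eta> \<in> c0_star" using that sub by blast+
    show "(\<lambda>n. \<xi> n + \<eta> n) \<in> c0_star" by (rule c0_star_add[OF c])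
    show "diag_op (\<lambda>n. \<xi> n + \<eta> n) e e \<in> J"
      using op_idealD(3)[OF J d[OF that(1)] d[OF that(2)]]
        diag_op_add[OF e e c0_starD(4)[OF c(1)] c0_starD(4)[OF c(2)]] by simp
  qed
  moreover have "\<eta> \<in> char_set J" if "\<xi> \<in> char_set J" "\<eta> \<in> c0_star" "\<forall>n. \<eta> n \<le> \<xi> n" for \<xi> \<eta>
  proof (rule mem[OF _ that(2)])
    show "diag_op \<eta> e e \<in> J"
      using that(3) by (intro char_set_diag_op(2)[OF J that(1) e e c0_starD(1)[OF that(2)]]) blast
  qed
  moreover have "(\<lambda>n. \<xi> (n div m)) \<in> char_set J" if "\<xi> \<in> char_set J" and m: "m > 0" for \<xi> and m :: nat
  proof (rule mem)
    have c: "\<xi> \<in> c0_star" using that sub by blast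
    show "(\<lambda>n. \<xi> (n div m)) \<in> c0_star" by (rule c0_star_ampliation[OF c m])
    \<comment> \<open>The residue classes are added one at a time; q = m gives the whole
      ampliation.\<close>
    have "diag_op (\<lambda>n. if n mod m < q then \<xi> (n div m) else 0) e e \<in> J" if "q \<le> m" for q
      using that
    proof (induction q)
      case 0
      then show ?case using op_idealD(2)[OF J] diag_op_zero[OF e e] by simp
    next
      case (Suc q)
      have o: "ortho_seq (\<lambda>k. e (m * k + q))"
        using m unfolding ortho_seq_def by (simp add: ortho_seqD(1)[OF e])
      have "diag_op \<xi> (\<lambda>k. e (m * k + q)) (\<lambda>k. e (m * k + q)) \<in> J"
        by (rule char_set_diag_op(2)[OF J \<open>\<xi> \<in> char_set J\<close> o o nonneg[OF \<open>\<xi> \<in> char_set J\<close>] order_refl])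
      then have 1: "diag_op (\<lambda>n. if n mod m = q then \<xi> (n div m) else 0) e e \<in> J"
        using diag_op_subsequence[OF e c0_starD(4)[OF c] m] Suc.prems by simp
      have 2: "diag_op (\<lambda>n. if n mod m < q then \<xi> (n div m) else 0) e e \<in> J"
        using Suc by simp
      have b: "Bseq (\<lambda>n. if P n then \<xi> (n div m) else 0)" for P
        using c0_starD(1,5)[OF c] by (intro BseqI'[of _ "\<xi> 0"]) simp
      have "(\<lambda>n. if n mod m < Suc q then \<xi> (n div m) else 0)
          = (\<lambda>n. (if n mod m < q then \<xi> (n div m) else 0) + (if n mod m = q then \<xi> (n div m) else 0))"
        by (auto simp: less_Suc_eq)
      then show ?case using op_idealD(3)[OF J 2 1] diag_op_add[OF e e b b] by simp
    qed
    from this[of m] show "diag_op (\<lambda>n. \<xi> (n div m)) e e \<in> J" using m by simp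
  qed
  ultimately show ?thesis using sub unfolding calkin_set_def by blast
qed

lemma ops_of_char_set:
  assumes J: "op_ideal (J :: ('h \<Rightarrow>\<^sub>L 'h) set)"
  shows "ops_of (char_set J) = J"
proof
  show "J \<subseteq> ops_of (char_set J)" using op_idealD(1)[OF J] by (auto simp: ops_of_def char_set_def)
  show "ops_of (char_set J) \<subseteq> J"
  proof
    fix T :: "'h \<Rightarrow>\<^sub>L 'h" assume "T \<in> ops_of (char_set J)"
    then have T: "T \<in> compact_ops" "s_numbers T \<in> char_set J" by (auto simp: ops_of_def)
    obtain e f where d: "s_numbers T \<in> c0_star" "ortho_seq e" "ortho_seq f" "T = diag_op (s_numbers T) e f"
      by (rule svd_s_numbers[OF inf T(1)])
    have "diag_op (s_numbers T) e f \<in> J"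
      by (rule char_set_diag_op(2)[OF J T(2) d(2,3) c0_starD(1)[OF d(1)] order_refl])
    then show "T \<in> J" unfolding d(4)[symmetric] .
  qed
qed

theorem calkin_correspondence:
  assumes S: "calkin_set S"
  shows "op_ideal (ideal_with S :: ('h \<Rightarrow>\<^sub>L 'h) set)" "char_set (ideal_with S :: ('h \<Rightarrow>\<^sub>L 'h) set) = S"
proof -
  have "ideal_with S = (ops_of S :: ('h \<Rightarrow>\<^sub>L 'h) set)"
    unfolding ideal_with_def
  proof (rule the_equality)
    show "op_ideal (ops_of S :: ('h \<Rightarrow>\<^sub>L 'h) set) \<and> char_set (ops_of S :: ('h \<Rightarrow>\<^sub>L 'h) set) = S"
      using op_ideal_ops_of[OF S] char_set_ops_of[OF calkin_setD(1)[OF S]] by simp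
    show "J = ops_of S" if "op_ideal J \<and> char_set J = S" for J :: "('h \<Rightarrow>\<^sub>L 'h) set"
      using ops_of_char_set[of J] that by simp
  qed
  then show "op_ideal (ideal_with S :: ('h \<Rightarrow>\<^sub>L 'h) set)" "char_set (ideal_with S :: ('h \<Rightarrow>\<^sub>L 'h) set) = S"
    using op_ideal_ops_of[OF S] char_set_ops_of[OF calkin_setD(1)[OF S]] by simp_all
qed

lemma char_set_mono_iff:
  assumes "op_ideal (J :: ('h \<Rightarrow>\<^sub>L 'h) set)" "op_ideal K"
  shows "char_set J \<subseteq> char_set K \<longleftrightarrow> J \<subseteq> K"
proof
  assume "char_set J \<subseteq> char_set K"
  then have "ops_of (char_set J) \<subseteq> (ops_of (char_set K) :: ('h \<Rightarrow>\<^sub>L 'h) set)" by (auto simp: ops_of_def)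
  then show "J \<subseteq> K" using ops_of_char_set assms by simp
qed (auto simp: char_set_def)

lemma char_set_eq_iff:
  assumes "op_ideal (J :: ('h \<Rightarrow>\<^sub>L 'h) set)" "op_ideal K"
  shows "char_set J = char_set K \<longleftrightarrow> J = K"
  using char_set_mono_iff[OF assms] char_set_mono_iff[OF assms(2,1)] by auto

text \<open>Membership depends only on the s-numbers, so an operator of J realising s lies in K as
  soon as s belongs to the characteristic set of K.\<close>

lemma char_set_Int:
  assumes "op_ideal (J :: ('h \<Rightarrow>\<^sub>L 'h) set)" "op_ideal K"
  shows "char_set (J \<inter> K) = char_set J \<inter> char_set K"
proof
  show "char_set J \<inter> char_set K \<subseteq> char_set (J \<inter> K)"
  proof
    fix s assume s: "s \<in> char_set J \<inter> char_set K"
    then obtain T where T: "T \<in> J" "s = s_numbers T" by (auto simp: char_set_def)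
    then have "T \<in> ops_of (char_set K)" using s op_idealD(1)[OF assms(1)] by (auto simp: ops_of_def)
    then have "T \<in> K" using ops_of_char_set[OF assms(2)] by simp
    then show "s \<in> char_set (J \<inter> K)" using T by (auto simp: char_set_def)
  qed
qed (auto simp: char_set_def)

lemma char_set_zero_iff:
  assumes J: "op_ideal (J :: ('h \<Rightarrow>\<^sub>L 'h) set)"
  shows "(\<forall>\<xi>\<in>char_set J. \<xi> 0 = 0) \<longleftrightarrow> J = {0}"
proof
  assume z: "\<forall>\<xi>\<in>char_set J. \<xi> 0 = 0"
  have "T = 0" if "T \<in> J" for T
  proof -
    have T: "T \<in> compact_ops" using that op_idealD(1)[OF J] by blast
    obtain e f where d: "s_numbers T \<in> c0_star" "ortho_seq e" "ortho_seq f" "T = diag_op (s_numbers T) e f"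
      by (rule svd_s_numbers[OF inf T])
    have "s_numbers T 0 = 0" using z that by (auto simp: char_set_def)
    then have *: "s_numbers T = (\<lambda>_. 0)" using c0_starD(5)[OF d(1)] by (intro ext) simp
    show "T = 0" using d(4) diag_op_zero[OF d(2,3)] unfolding * by (rule trans)
  qed
  then show "J = {0}" using op_idealD(2)[OF J] by blast
next
  assume "J = {0}"
  then show "\<forall>\<xi>\<in>char_set J. \<xi> 0 = 0" by (simp add: char_set_def s_numbers_zero)
qed

end

section \<open>Characteristic sets and means at infinity\<close>

lemma bigo_nonneg_iff:
  fixes f g :: "nat \<Rightarrow> real"
  assumes "\<And>n. 0 \<le> f n" "\<And>n. 0 \<le> g n"
  shows "f \<in> O(g) \<longleftrightarrow> (\<exists>C N. \<forall>n\<ge>N. f n \<le> C * g n)"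
proof
  assume "f \<in> O(g)"
  then obtain C where "\<forall>\<^sub>F n in sequentially. norm (f n) \<le> C * norm (g n)" by (auto elim: landau_o.bigE)
  then show "\<exists>C N. \<forall>n\<ge>N. f n \<le> C * g n" using assms by (auto simp: eventually_sequentially)
next
  assume "\<exists>C N. \<forall>n\<ge>N. f n \<le> C * g n"
  then obtain C N where "\<forall>n\<ge>N. f n \<le> C * g n" by blast
  then show "f \<in> O(g)"
    using assms by (intro bigoI[of _ C]) (auto simp: eventually_sequentially)
qed

lemma l1_starD: "\<xi> \<in> l1_star \<Longrightarrow> \<xi> \<in> c0_star" "\<xi> \<in> l1_star \<Longrightarrow> summable \<xi>"
  by (auto simp: l1_star_def)

lemma c0_star_antimono: "\<xi> \<in> c0_star \<Longrightarrow> m \<le> n \<Longrightarrow> \<xi> n \<le> \<xi> m"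
  using c0_starD(2) decseqD by blast

lemma zero_in_l1_star: "(\<lambda>_. 0) \<in> l1_star"
  by (auto simp: l1_star_def intro!: c0_starI)

lemma l1_star_dominated:
  assumes "\<xi> \<in> l1_star" "\<eta> \<in> c0_star" "\<And>n. \<eta> n \<le> c * \<xi> n" shows "\<eta> \<in> l1_star"
proof -
  have "summable \<eta>"
    by (rule summable_comparison_test'[OF summable_mult[OF l1_starD(2)[OF assms(1)], of c], of 0])
      (use assms(3) c0_starD(1)[OF assms(2)] in simp)
  then show ?thesis using assms(2) by (simp add: l1_star_def)
qed

lemma l1_star_add: "\<xi> \<in> l1_star \<Longrightarrow> \<eta> \<in> l1_star \<Longrightarrow> (\<lambda>n. \<xi> n + \<eta> n) \<in> l1_star"
  by (simp add: l1_star_def c0_star_add summable_add)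

section \<open>Tails and means at infinity\<close>

text \<open>Clears the denominator: \<open>real (Suc k) * am_inf \<xi> k\<close> is the tail at
  \<open>Suc k\<close>. Monotonicity and splitting into blocks are immediate for tails.\<close>

definition seq_tail :: "(nat \<Rightarrow> real) \<Rightarrow> nat \<Rightarrow> real" where
  "seq_tail \<xi> n = (\<Sum>j. \<xi> (j + n))"

lemma am_inf_eq: "am_inf \<xi> k = seq_tail \<xi> (Suc k) / real (Suc k)"
  by (simp add: am_inf_def seq_tail_def)

context
  fixes \<xi> assumes \<xi>: "\<xi> \<in> l1_star"
begin

lemma seq_tail_eq: "seq_tail \<xi> n = suminf \<xi> - (\<Sum>j<n. \<xi> j)"
  unfolding seq_tail_def by (rule suminf_minus_initial_segment[OF l1_starD(2)[OF \<xi>]])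

lemma seq_tail_nonneg: "0 \<le> seq_tail \<xi> n"
  unfolding seq_tail_def
  by (rule suminf_nonneg[OF summable_ignore_initial_segment[OF l1_starD(2)[OF \<xi>]]])
    (rule c0_starD(1)[OF l1_starD(1)[OF \<xi>]])

lemma seq_tail_split: "m \<le> n \<Longrightarrow> seq_tail \<xi> m = (\<Sum>j=m..<n. \<xi> j) + seq_tail \<xi> n"
  unfolding seq_tail_eq using sum.atLeastLessThan_concat[of 0 m n \<xi>]
  by (simp add: atLeast0LessThan)

lemma seq_tail_antimono: "m \<le> n \<Longrightarrow> seq_tail \<xi> n \<le> seq_tail \<xi> m"
  using seq_tail_split[of m n] c0_starD(1)[OF l1_starD(1)[OF \<xi>]] by (simp add: sum_nonneg)

lemma seq_tail_tendsto_0: "seq_tail \<xi> \<longlonglongrightarrow> 0"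
  using tendsto_diff[OF tendsto_const summable_LIMSEQ[OF l1_starD(2)[OF \<xi>]], of "suminf \<xi>"]
  by (simp add: seq_tail_eq[abs_def])

lemma sum_le_seq_tail: "(\<Sum>j=m..<n. \<xi> j) \<le> seq_tail \<xi> m"
  using seq_tail_split[of m n] seq_tail_nonneg[of n] seq_tail_nonneg[of m] by (cases "m \<le> n") auto

lemma am_inf_c0_star: "am_inf \<xi> \<in> c0_star"
proof (rule c0_starI)
  show "0 \<le> am_inf \<xi> n" for n using seq_tail_nonneg by (simp add: am_inf_eq)
  show "am_inf \<xi> (Suc n) \<le> am_inf \<xi> n" for n
    unfolding am_inf_eq using seq_tail_nonneg seq_tail_antimono by (intro frac_le) auto
  have "(\<lambda>k. seq_tail \<xi> (Suc k) * inverse (real (Suc k))) \<longlonglongrightarrow> 0 * 0"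
    by (intro tendsto_mult LIMSEQ_Suc[OF seq_tail_tendsto_0] LIMSEQ_inverse_real_of_nat)
  then show "am_inf \<xi> \<longlonglongrightarrow> 0" by (simp add: am_inf_eq[abs_def] divide_inverse)
qed

lemma le_am_inf: assumes "1 \<le> n" shows "\<xi> n \<le> am_inf \<xi> (n div 3)"
proof -
  define k where "k = n div 3"
  \<comment> \<open>The k + 1 indices from k + 1 to 2 k + 1 are then all at most n. This is why the
    divisor is 3, and why n = 0 is excluded: the mean at 0 omits the first term.\<close>
  have "2 * k + 1 \<le> n" using assms unfolding k_def by presburger
  have "real (Suc k) * \<xi> n = (\<Sum>j=Suc k..<2 * k + 2. \<xi> n)" by simp
  also have "\<dots> \<le> (\<Sum>j=Suc k..<2 * k + 2. \<xi> j)"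
    using \<open>2 * k + 1 \<le> n\<close> by (intro sum_mono c0_star_antimono[OF l1_starD(1)[OF \<xi>]]) auto
  also have "\<dots> \<le> seq_tail \<xi> (Suc k)" by (rule sum_le_seq_tail)
  finally show ?thesis by (simp add: am_inf_eq k_def field_simps)
qed

lemma sum_ampliation:
  assumes "m > 0" shows "(\<Sum>n<N * m. \<xi> (n div m)) = real m * (\<Sum>k<N. \<xi> k)"
proof -
  have "(\<Sum>n\<in>{i * m..<i * m + m}. \<xi> (n div m)) = real m * \<xi> i" for i
  proof -
    have "n div m = i" if "n \<in> {i * m..<i * m + m}" for n
      using that assms by (intro div_nat_eqI) (auto simp: mult.commute)
    then have "(\<Sum>n\<in>{i * m..<i * m + m}. \<xi> (n div m)) = (\<Sum>n\<in>{i * m..<i * m + m}. \<xi> i)"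
      by (intro sum.cong) auto
    then show ?thesis by simp
  qed
  then show ?thesis by (simp flip: sum.nat_group add: sum_distrib_left)
qed

lemma l1_star_ampliation: assumes m: "m > 0" shows "(\<lambda>n. \<xi> (n div m)) \<in> l1_star"
proof -
  have nn: "0 \<le> \<xi> n" for n by (rule c0_starD(1)[OF l1_starD(1)[OF \<xi>]])
  have "summable (\<lambda>n. \<xi> (n div m))"
  proof (rule summableI_nonneg_bounded[OF nn])
    fix n
    have "n \<le> n * m" using m by simp
    then have "(\<Sum>i<n. \<xi> (i div m)) \<le> (\<Sum>i<n * m. \<xi> (i div m))"
      using nn by (intro sum_mono2) auto
    also have "\<dots> \<le> real m * suminf \<xi>"
      unfolding sum_ampliation[OF m] using nn
      by (intro mult_left_mono sum_le_suminf l1_starD(2)[OF \<xi>]) auto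
    finally show "(\<Sum>i<n. \<xi> (i div m)) \<le> real m * suminf \<xi>" .
  qed
  then show ?thesis using c0_star_ampliation[OF l1_starD(1)[OF \<xi>] m] by (simp add: l1_star_def)
qed

end

lemma seq_tail_ampliation:
  assumes \<xi>: "\<xi> \<in> l1_star" and m: "m > 0"
  shows "seq_tail (\<lambda>n. \<xi> (n div m)) (N * m) = real m * seq_tail \<xi> N"
proof -
  have "(\<lambda>N. \<Sum>n<N * m. \<xi> (n div m)) \<longlonglongrightarrow> (\<Sum>n. \<xi> (n div m))"
    using LIMSEQ_subseq_LIMSEQ[OF summable_LIMSEQ[OF l1_starD(2)[OF l1_star_ampliation[OF \<xi> m]]], of "\<lambda>N. N * m"] m
    by (simp add: strict_mono_def comp_def)
  moreover have "(\<lambda>N. \<Sum>n<N * m. \<xi> (n div m)) \<longlonglongrightarrow> real m * suminf \<xi>"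
    unfolding sum_ampliation[OF \<xi> m] by (intro tendsto_mult tendsto_const summable_LIMSEQ l1_starD(2)[OF \<xi>])
  ultimately have "(\<Sum>n. \<xi> (n div m)) = real m * suminf \<xi>" by (rule LIMSEQ_unique)
  then show ?thesis
    by (simp add: seq_tail_eq[OF \<xi>] seq_tail_eq[OF l1_star_ampliation[OF \<xi> m]] sum_ampliation[OF \<xi> m] right_diff_distrib)
qed

text \<open>Means and ampliations commute up to a change of ampliation:
  \<open>seq_tail_ampliation\<close> is exact at multiples of m, and \<open>Suc n\<close> is rounded
  up to such a multiple here, rounded down in \<open>am_inf_ampliation_le\<close>.\<close>

lemma am_inf_le_am_inf_ampliation:
  assumes \<xi>: "\<xi> \<in> l1_star" and m: "m > 0"
  shows "am_inf \<xi> (n div m) \<le> am_inf (\<lambda>n. \<xi> (n div m)) n"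
proof -
  define q where "q = n div m"
  have n: "Suc n \<le> Suc q * m" using m dividend_less_div_times[of m n] by (simp add: q_def)
  have "real (Suc n) * am_inf \<xi> q \<le> real (Suc q * m) * am_inf \<xi> q"
    using n c0_starD(1)[OF am_inf_c0_star[OF \<xi>]] of_nat_mono by (intro mult_right_mono) blast+
  also have "\<dots> = real m * seq_tail \<xi> (Suc q)" by (simp add: am_inf_eq field_simps)
  also have "\<dots> = seq_tail (\<lambda>n. \<xi> (n div m)) (Suc q * m)" by (rule seq_tail_ampliation[OF \<xi> m, symmetric])
  also have "\<dots> \<le> seq_tail (\<lambda>n. \<xi> (n div m)) (Suc n)"
    by (rule seq_tail_antimono[OF l1_star_ampliation[OF \<xi> m] n])
  finally show ?thesis unfolding q_def[symmetric] by (simp add: am_inf_eq[of _ n] field_simps)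
qed

lemma am_inf_ampliation_le:
  assumes \<xi>: "\<xi> \<in> l1_star" and m: "m > 0" and n: "m \<le> n"
  shows "am_inf (\<lambda>n. \<xi> (n div m)) n \<le> am_inf \<xi> (n div (2 * m))"
proof -
  define q where "q = Suc n div m"
  have q1: "1 \<le> q" using n m by (simp add: q_def Suc_le_eq div_greater_zero_iff)
  have qn: "q * m \<le> Suc n" by (simp add: q_def)
  \<comment> \<open>The tail from q belongs to the mean at q - 1; the factor 2 in the ampliation
    absorbs this shift.\<close>
  have qq: "n div (2 * m) \<le> q - 1"
  proof -
    have "n div (2 * m) = n div m div 2" by (simp add: div_mult2_eq mult.commute)
    also have "\<dots> \<le> q div 2" unfolding q_def by (intro div_le_mono) simp
    also have "\<dots> \<le> q - 1" using q1 by simp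
    finally show ?thesis .
  qed
  have "seq_tail (\<lambda>n. \<xi> (n div m)) (Suc n) \<le> seq_tail (\<lambda>n. \<xi> (n div m)) (q * m)"
    by (rule seq_tail_antimono[OF l1_star_ampliation[OF \<xi> m] qn])
  also have "\<dots> = real (q * m) * am_inf \<xi> (q - 1)"
    using q1 by (simp add: seq_tail_ampliation[OF \<xi> m] am_inf_eq)
  also have "\<dots> \<le> real (Suc n) * am_inf \<xi> (q - 1)"
    using qn c0_starD(1)[OF am_inf_c0_star[OF \<xi>]] of_nat_mono by (intro mult_right_mono) blast+
  also have "\<dots> \<le> real (Suc n) * am_inf \<xi> (n div (2 * m))"
    by (intro mult_left_mono c0_star_antimono[OF am_inf_c0_star[OF \<xi>] qq]) simp
  finally show ?thesis by (simp add: am_inf_eq[of _ n] field_simps)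
qed

lemma am_inf_mono:
  assumes "\<xi> \<in> l1_star" "\<eta> \<in> l1_star" "\<And>n. \<eta> n \<le> c * \<xi> n" shows "am_inf \<eta> n \<le> c * am_inf \<xi> n"
proof -
  have "seq_tail \<eta> (Suc n) \<le> (\<Sum>j. c * \<xi> (j + Suc n))"
    unfolding seq_tail_def
    by (intro suminf_le assms(3) summable_ignore_initial_segment summable_mult l1_starD(2) assms(1,2))
  also have "\<dots> = c * seq_tail \<xi> (Suc n)"
    unfolding seq_tail_def
    by (intro suminf_mult summable_ignore_initial_segment l1_starD(2) assms(1))
  finally show ?thesis by (simp add: am_inf_eq divide_right_mono)
qed

lemma am_inf_add:
  assumes "\<xi> \<in> l1_star" "\<eta> \<in> l1_star" shows "am_inf (\<lambda>n. \<xi> n + \<eta> n) k = am_inf \<xi> k + am_inf \<eta> k"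
  unfolding am_inf_eq seq_tail_def add_divide_distrib[symmetric]
  by (subst suminf_add) (intro summable_ignore_initial_segment l1_starD(2) assms refl)+

lemma am_inf_zero: "am_inf (\<lambda>_. 0) = (\<lambda>_. 0)" by (simp add: am_inf_def fun_eq_iff)

section \<open>The two mean operations on characteristic sets\<close>

text \<open>The zero set must be kept apart: its \<open>pre_set\<close> consists of the multiples of
  \<open>unit_seq\<close> and is not invariant under ampliations. For all other sets a bound that
  holds only for large n is enough for membership.\<close>

definition nontrivial_calkin_set :: "(nat \<Rightarrow> real) set \<Rightarrow> bool" where
  "nontrivial_calkin_set S \<longleftrightarrow> calkin_set S \<and> (\<exists>\<xi>\<in>S. \<xi> 0 \<noteq> 0)"

lemma nontrivial_calkin_setI: "calkin_set S \<Longrightarrow> \<xi> \<in> S \<Longrightarrow> \<xi> 0 \<noteq> 0 \<Longrightarrow> nontrivial_calkin_set S"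
  by (auto simp: nontrivial_calkin_set_def)

text \<open>The first N terms are absorbed by ampliating a member with nonzero first term until it
  is constant on them.\<close>

lemma eventually_dominated_mem:
  assumes S: "nontrivial_calkin_set S" and \<xi>: "\<xi> \<in> S" and \<eta>: "\<eta> \<in> c0_star" "\<And>n. n \<ge> N \<Longrightarrow> \<eta> n \<le> c * \<xi> n"
  shows "\<eta> \<in> S"
proof -
  have C: "calkin_set S" using S by (simp add: nontrivial_calkin_set_def)
  note nn = c0_starD(1)[OF subsetD[OF calkin_setD(1)[OF C]]]
  obtain \<zeta> where \<zeta>: "\<zeta> \<in> S" "\<zeta> 0 \<noteq> 0" using S by (auto simp: nontrivial_calkin_set_def)
  have z0: "0 < \<zeta> 0" using nn[OF \<zeta>(1), of 0] \<zeta>(2) by simp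
  define a where "a = \<eta> 0 / \<zeta> 0"
  have a: "0 \<le> a" using z0 c0_starD(1)[OF \<eta>(1)] by (simp add: a_def)
  have mem: "(\<lambda>n. \<xi> n + \<zeta> (n div Suc N)) \<in> S"
    by (intro calkin_setD(3)[OF C \<xi>] calkin_setD(5)[OF C \<zeta>(1)]) simp
  show ?thesis
  proof (rule calkin_set_dominated[OF C mem \<eta>(1)])
    fix n
    have p: "0 \<le> \<bar>c\<bar> * \<xi> n" "0 \<le> a * \<zeta> (n div Suc N)" "0 \<le> a * \<xi> n" "0 \<le> \<bar>c\<bar> * \<zeta> (n div Suc N)"
      using nn[OF \<xi>] nn[OF \<zeta>(1)] a by (simp_all only: mult_nonneg_nonneg abs_ge_zero)
    show "\<eta> n \<le> (\<bar>c\<bar> + a) * (\<xi> n + \<zeta> (n div Suc N))"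
    proof (cases "n \<ge> N")
      case True
      have "\<eta> n \<le> c * \<xi> n" by (rule \<eta>(2)[OF True])
      also have "\<dots> \<le> \<bar>c\<bar> * \<xi> n" using nn[OF \<xi>] by (intro mult_right_mono) auto
      finally show ?thesis using p by (simp add: algebra_simps)
    next
      case False
      have "\<eta> n \<le> \<eta> 0" by (rule c0_star_antimono[OF \<eta>(1)]) simp
      also have "\<dots> = a * \<zeta> (n div Suc N)" using False z0 by (simp add: a_def)
      finally show ?thesis using p by (simp add: algebra_simps)
    qed
  qed
qed

text \<open>The s-numbers of a rank-one projection. Its mean at infinity is 0, so it witnesses
  nontriviality of the derived sets.\<close>

definition unit_seq :: "nat \<Rightarrow> real" where "unit_seq n = (if n = 0 then 1 else 0)"

lemma unit_seq_l1: "unit_seq \<in> l1_star"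
proof -
  have "summable unit_seq" by (rule summable_finite[of "{0}"]) (auto simp: unit_seq_def)
  moreover have "unit_seq \<in> c0_star"
    by (rule c0_starI) (use summable_LIMSEQ_zero[OF calculation] in \<open>auto simp: unit_seq_def\<close>)
  ultimately show ?thesis by (simp add: l1_star_def)
qed

lemma am_inf_unit_seq: "am_inf unit_seq = (\<lambda>_. 0)"
  by (simp add: am_inf_def unit_seq_def fun_eq_iff)

text \<open>The action of \<open>pre_am_inf\<close> on characteristic sets; \<open>post_set\<close>
  plays the same part for \<open>am_inf_ideal\<close>.\<close>

definition pre_set :: "(nat \<Rightarrow> real) set \<Rightarrow> (nat \<Rightarrow> real) set" where
  "pre_set S = {\<xi> \<in> l1_star. am_inf \<xi> \<in> S}"

definition post_set :: "(nat \<Rightarrow> real) set \<Rightarrow> (nat \<Rightarrow> real) set" where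
  "post_set S = {\<xi> \<in> c0_star. \<exists>\<eta>\<in>S \<inter> l1_star. \<xi> \<in> O(am_inf \<eta>)}"

lemma post_setI:
  assumes "\<xi> \<in> c0_star" "\<eta> \<in> S" "\<eta> \<in> l1_star" "\<And>n. n \<ge> N \<Longrightarrow> \<xi> n \<le> C * am_inf \<eta> n"
  shows "\<xi> \<in> post_set S"
  using assms bigo_nonneg_iff[of \<xi> "am_inf \<eta>"] c0_starD(1)[OF assms(1)]
    c0_starD(1)[OF am_inf_c0_star[OF assms(3)]] unfolding post_set_def by blast

lemma post_setE:
  assumes "\<xi> \<in> post_set S"
  obtains \<eta> C N where "\<xi> \<in> c0_star" "\<eta> \<in> S" "\<eta> \<in> l1_star" "0 \<le> C" "\<And>n. n \<ge> N \<Longrightarrow> \<xi> n \<le> C * am_inf \<eta> n"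
proof -
  obtain \<eta> where \<eta>: "\<xi> \<in> c0_star" "\<eta> \<in> S" "\<eta> \<in> l1_star" "\<xi> \<in> O(am_inf \<eta>)"
    using assms by (auto simp: post_set_def)
  note nn = c0_starD(1)[OF am_inf_c0_star[OF \<eta>(3)]]
  obtain C N where "\<forall>n\<ge>N. \<xi> n \<le> C * am_inf \<eta> n"
    using \<eta>(4) bigo_nonneg_iff[of \<xi> "am_inf \<eta>"] c0_starD(1)[OF \<eta>(1)] nn by blast
  moreover have "C * am_inf \<eta> n \<le> \<bar>C\<bar> * am_inf \<eta> n" for n
    using nn by (intro mult_right_mono) auto
  ultimately show ?thesis using that[OF \<eta>(1-3), of "\<bar>C\<bar>" N] order_trans by fastforce
qed

lemma nontrivial_pre_set:
  assumes S: "nontrivial_calkin_set S" shows "nontrivial_calkin_set (pre_set S)"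
proof -
  have C: "calkin_set S" using S by (simp add: nontrivial_calkin_set_def)
  have "calkin_set (pre_set S)"
    unfolding calkin_set_def
  proof (intro conjI ballI allI impI)
    show "pre_set S \<subseteq> c0_star" by (auto simp: pre_set_def l1_star_def)
    show "(\<lambda>_. 0) \<in> pre_set S"
      using zero_in_l1_star calkin_setD(2)[OF C] by (simp add: pre_set_def am_inf_zero)
    fix \<xi> assume "\<xi> \<in> pre_set S"
    then have \<xi>: "\<xi> \<in> l1_star" "am_inf \<xi> \<in> S" by (auto simp: pre_set_def)
    show "(\<lambda>n. \<xi> n + \<eta> n) \<in> pre_set S" if "\<eta> \<in> pre_set S" for \<eta>
    proof -
      have \<eta>: "\<eta> \<in> l1_star" "am_inf \<eta> \<in> S" using that by (auto simp: pre_set_def)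
      have "am_inf (\<lambda>n. \<xi> n + \<eta> n) = (\<lambda>n. am_inf \<xi> n + am_inf \<eta> n)"
        by (rule ext) (rule am_inf_add[OF \<xi>(1) \<eta>(1)])
      then show ?thesis using calkin_setD(3)[OF C \<xi>(2) \<eta>(2)] l1_star_add[OF \<xi>(1) \<eta>(1)] by (simp add: pre_set_def)
    qed
    show "\<eta> \<in> pre_set S" if "\<eta> \<in> c0_star" "\<forall>n. \<eta> n \<le> \<xi> n" for \<eta>
    proof -
      have \<eta>: "\<eta> \<in> l1_star" using that by (intro l1_star_dominated[OF \<xi>(1), of _ 1]) auto
      have "am_inf \<eta> n \<le> 1 * am_inf \<xi> n" for n using that by (intro am_inf_mono[OF \<xi>(1) \<eta>]) auto
      then have "am_inf \<eta> \<in> S" by (rule calkin_set_dominated[OF C \<xi>(2) am_inf_c0_star[OF \<eta>]])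
      then show ?thesis using \<eta> by (simp add: pre_set_def)
    qed
    show "(\<lambda>n. \<xi> (n div m)) \<in> pre_set S" if m: "m > 0" for m
    proof -
      note l = l1_star_ampliation[OF \<xi>(1) m]
      have "(\<lambda>n. am_inf \<xi> (n div (2 * m))) \<in> S" using calkin_setD(5)[OF C \<xi>(2)] m by simp
      then have "am_inf (\<lambda>n. \<xi> (n div m)) \<in> S"
        using am_inf_ampliation_le[OF \<xi>(1) m]
        by (intro eventually_dominated_mem[OF S _ am_inf_c0_star[OF l], of _ m 1]) auto
      then show ?thesis using l by (simp add: pre_set_def)
    qed
  qed
  moreover have "unit_seq \<in> pre_set S"
    using unit_seq_l1 calkin_setD(2)[OF C] by (simp add: pre_set_def am_inf_unit_seq)
  ultimately show ?thesis by (rule nontrivial_calkin_setI) (simp add: unit_seq_def)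
qed

lemma nontrivial_post_set:
  assumes S: "nontrivial_calkin_set S" shows "nontrivial_calkin_set (post_set S)"
proof -
  have C: "calkin_set S" using S by (simp add: nontrivial_calkin_set_def)
  have "calkin_set (post_set S)"
    unfolding calkin_set_def
  proof (intro conjI ballI allI impI)
    show "post_set S \<subseteq> c0_star" by (auto simp: post_set_def)
    show "(\<lambda>_. 0) \<in> post_set S"
      using zero_in_l1_star calkin_setD(2)[OF C] l1_starD(1)
      by (intro post_setI[of _ "\<lambda>_. 0" _ 0 0]) auto
    fix \<xi> assume "\<xi> \<in> post_set S"
    then obtain a A M where a: "\<xi> \<in> c0_star" "a \<in> S" "a \<in> l1_star" "0 \<le> A" "\<And>n. n \<ge> M \<Longrightarrow> \<xi> n \<le> A * am_inf a n"
      by (rule post_setE) blast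
    note nna = c0_starD(1)[OF am_inf_c0_star[OF a(3)]]
    show "(\<lambda>n. \<xi> n + \<eta> n) \<in> post_set S" if \<eta>: "\<eta> \<in> post_set S" for \<eta>
    proof -
      obtain b B N where b: "\<eta> \<in> c0_star" "b \<in> S" "b \<in> l1_star" "0 \<le> B" "\<And>n. n \<ge> N \<Longrightarrow> \<eta> n \<le> B * am_inf b n"
        using \<eta> by (rule post_setE) blast
      note nnb = c0_starD(1)[OF am_inf_c0_star[OF b(3)]]
      show ?thesis
      proof (rule post_setI[OF c0_star_add[OF a(1) b(1)] calkin_setD(3)[OF C a(2) b(2)] l1_star_add[OF a(3) b(3)]])
        fix n assume "max M N \<le> n"
        then have "\<xi> n + \<eta> n \<le> A * am_inf a n + B * am_inf b n"
          by (intro add_mono a(5) b(5)) auto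
        also have "\<dots> \<le> A * am_inf a n + B * am_inf b n + (B * am_inf a n + A * am_inf b n)"
          using nna[of n] nnb[of n] a(4) b(4) by simp
        also have "\<dots> = (A + B) * am_inf (\<lambda>n. a n + b n) n"
          by (simp add: am_inf_add[OF a(3) b(3)] algebra_simps)
        finally show "\<xi> n + \<eta> n \<le> (A + B) * am_inf (\<lambda>n. a n + b n) n" .
      qed
    qed
    show "\<eta> \<in> post_set S" if "\<eta> \<in> c0_star" "\<forall>n. \<eta> n \<le> \<xi> n" for \<eta>
      using that a(5) order_trans by (intro post_setI[OF that(1) a(2,3), of M A]) blast
    show "(\<lambda>n. \<xi> (n div m)) \<in> post_set S" if m: "m > 0" for m
    proof (rule post_setI[OF c0_star_ampliation[OF a(1) m] calkin_setD(5)[OF C a(2) m] l1_star_ampliation[OF a(3) m]])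
      fix n assume "M * m \<le> n"
      then have "M \<le> n div m" using m by (simp add: less_eq_div_iff_mult_less_eq)
      then have "\<xi> (n div m) \<le> A * am_inf a (n div m)" by (rule a(5))
      also have "\<dots> \<le> A * am_inf (\<lambda>n. a (n div m)) n"
        by (intro mult_left_mono am_inf_le_am_inf_ampliation[OF a(3) m] a(4))
      finally show "\<xi> (n div m) \<le> A * am_inf (\<lambda>n. a (n div m)) n" .
    qed
  qed
  \<comment> \<open>Domination is required only from index 1 on, where \<open>unit_seq\<close>
    vanishes; so the zero sequence serves as witness.\<close>
  moreover have "unit_seq \<in> post_set S"
    using l1_starD(1)[OF unit_seq_l1] zero_in_l1_star calkin_setD(2)[OF C]
    by (intro post_setI[of _ "\<lambda>_. 0" _ 1 0]) (auto simp: unit_seq_def)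
  ultimately show ?thesis by (rule nontrivial_calkin_setI) (simp add: unit_seq_def)
qed

lemma pre_set_mono: "S \<subseteq> T \<Longrightarrow> pre_set S \<subseteq> pre_set T" by (auto simp: pre_set_def)

lemma post_set_mono: "S \<subseteq> T \<Longrightarrow> post_set S \<subseteq> post_set T" by (auto simp: post_set_def)

context
  fixes S assumes S: "nontrivial_calkin_set S"
begin

lemma calkin_set_of_nontrivial: "calkin_set S" using S by (simp add: nontrivial_calkin_set_def)

text \<open>The ampliation by 3 undoes the index shift in \<open>le_am_inf\<close>; the same device
  gives \<open>pre_set_subset\<close>.\<close>

lemma l1_subset_post_set: "S \<inter> l1_star \<subseteq> post_set S"
proof
  fix \<xi> assume "\<xi> \<in> S \<inter> l1_star"
  then have \<xi>: "\<xi> \<in> S" "\<xi> \<in> l1_star" by auto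
  show "\<xi> \<in> post_set S"
  proof (rule post_setI[OF l1_starD(1)[OF \<xi>(2)] calkin_setD(5)[OF calkin_set_of_nontrivial \<xi>(1)] l1_star_ampliation[OF \<xi>(2)], of 3 1 1])
    fix n :: nat assume "1 \<le> n"
    then show "\<xi> n \<le> 1 * am_inf (\<lambda>n. \<xi> (n div 3)) n"
      using le_am_inf[OF \<xi>(2)] am_inf_le_am_inf_ampliation[OF \<xi>(2), of 3 n] by fastforce
  qed auto
qed

lemma pre_set_subset: "pre_set S \<subseteq> S"
proof
  fix \<xi> assume "\<xi> \<in> pre_set S"
  then have \<xi>: "\<xi> \<in> l1_star" "am_inf \<xi> \<in> S" by (auto simp: pre_set_def)
  have "(\<lambda>n. am_inf \<xi> (n div 3)) \<in> S" using calkin_setD(5)[OF calkin_set_of_nontrivial \<xi>(2)] by simp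
  then show "\<xi> \<in> S"
    by (rule eventually_dominated_mem[OF S _ l1_starD(1)[OF \<xi>(1)], of _ 1 1]) (use le_am_inf[OF \<xi>(1)] in simp)
qed

text \<open>The counit of the Galois connection; \<open>subset_pre_post\<close> is the unit, cut
  down to \<open>l1_star\<close>, where every \<open>pre_set\<close> lives.\<close>

lemma post_pre_subset: "post_set (pre_set S) \<subseteq> S"
proof
  fix \<xi> assume "\<xi> \<in> post_set (pre_set S)"
  then obtain a A M where a: "\<xi> \<in> c0_star" "a \<in> pre_set S" "\<And>n. n \<ge> M \<Longrightarrow> \<xi> n \<le> A * am_inf a n"
    by (rule post_setE) blast
  have "am_inf a \<in> S" using a(2) by (simp add: pre_set_def)
  then show "\<xi> \<in> S" using a(1,3) by (rule eventually_dominated_mem[OF S])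
qed

lemma subset_pre_post: "S \<inter> l1_star \<subseteq> pre_set (post_set S)"
  using am_inf_c0_star by (auto simp: pre_set_def intro: post_setI[of _ _ _ 0 1])

end

lemma pre_set_subset_l1: "pre_set S \<subseteq> l1_star" by (auto simp: pre_set_def)

lemma post_pre_post:
  assumes S: "nontrivial_calkin_set S" shows "post_set (pre_set (post_set S)) = post_set S"
proof
  show "post_set (pre_set (post_set S)) \<subseteq> post_set S"
    by (rule post_pre_subset[OF nontrivial_post_set[OF S]])
  have "post_set S = post_set (S \<inter> l1_star)" by (simp add: post_set_def)
  then show "post_set S \<subseteq> post_set (pre_set (post_set S))"
    using post_set_mono[OF subset_pre_post[OF S]] by simp
qed

lemma pre_post_pre:
  assumes S: "nontrivial_calkin_set S" shows "pre_set (post_set (pre_set S)) = pre_set S"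
proof
  show "pre_set (post_set (pre_set S)) \<subseteq> pre_set S" by (rule pre_set_mono[OF post_pre_subset[OF S]])
  show "pre_set S \<subseteq> pre_set (post_set (pre_set S))"
    using subset_pre_post[OF nontrivial_pre_set[OF S]] pre_set_subset_l1 by blast
qed

text \<open>The easy direction of the theorem: a stable set is fixed by both operations, so its
  interior, its closure and its am-infinity set coincide with it.\<close>

lemma stable_imp_post_eq:
  assumes S: "nontrivial_calkin_set S" "S = pre_set S" shows "post_set S = S"
proof
  show "post_set S \<subseteq> S" using post_pre_subset[OF S(1)] S(2) by simp
  show "S \<subseteq> post_set S" using l1_subset_post_set[OF S(1)] S(2) pre_set_subset_l1[of S] by blast
qed

section \<open>Constructions of summable sequences with prescribed means\<close>

text \<open>Cauchy condensation leads back to the harmonic series. This divergence is behind both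
  degenerate cases: the reciprocals of logarithms occur as tails, so these are the sizes of the
  resulting means.\<close>

lemma not_summable_inverse_mult_ln: "\<not> summable (\<lambda>n. 1 / (real (Suc n) * ln (real n + 4)))"
proof
  define f where "f m = 1 / (real m * ln (real m + 3))" for m
  assume "summable (\<lambda>n. 1 / (real (Suc n) * ln (real n + 4)))"
  then have "summable (\<lambda>n. f (Suc n))" by (simp add: f_def add.commute)
  then have "summable f" by (simp only: summable_Suc_iff)
  moreover have "f (Suc m) \<le> f m" if "0 < m" for m
    unfolding f_def using that by (intro divide_left_mono mult_mono) auto
  moreover have "0 \<le> f n" for n by (simp add: f_def)
  ultimately have *: "summable (\<lambda>n. 2 ^ n * f (2 ^ n))" by (simp add: condensation_test)
  have "summable (\<lambda>n. inverse (real (n + 2)))"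
  proof (rule summable_comparison_test'[OF *, of 0])
    fix n :: nat
    have p: "(1::real) \<le> 2 ^ n" by simp
    have "ln (2 ^ n + 3 :: real) \<le> ln (2 ^ (n + 2))"
      using p by (subst ln_le_cancel_iff) (auto simp: add_pos_pos)
    also have "\<dots> = real (n + 2) * ln 2" by (simp only: ln_realpow)
    also have "\<dots> \<le> real (n + 2) * 1" using ln_le_minus_one[of 2] by (intro mult_left_mono) auto
    finally have "ln (2 ^ n + 3 :: real) \<le> real (n + 2)" by simp
    moreover have "0 < ln (2 ^ n + 3 :: real)" using p by (intro ln_gt_zero) linarith
    ultimately have "inverse (real (n + 2)) \<le> inverse (ln (2 ^ n + 3))" by (intro le_imp_inverse_le)
    also have "\<dots> = 2 ^ n * f (2 ^ n)" by (simp add: f_def field_simps)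
    finally show "norm (inverse (real (n + 2))) \<le> 2 ^ n * f (2 ^ n)" by simp
  qed
  then have "summable (\<lambda>n. inverse (real n))"
    by (rule summable_iff_shift[of "\<lambda>n. inverse (real n)" 2, THEN iffD1])
  then show False using not_summable_harmonic[where 'a = real] by simp
qed

text \<open>With the partial sums X of \<open>\<xi>\<close>, the decrements of 1 / ln (X + 3) are summable and at most
  a multiple of \<open>\<xi>\<close>, while their tails 1 / ln (X + 3) are at least 1 / ln (n + 3).\<close>

lemma summable_minorant_with_large_means:
  assumes \<xi>: "\<xi> \<in> c0_star" and ns: "\<not> summable \<xi>"
  obtains \<eta> C where "\<eta> \<in> l1_star" "\<And>n. \<eta> n \<le> C * \<xi> n" "\<not> summable (am_inf \<eta>)"
proof -
  note nn = c0_starD(1)[OF \<xi>]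
  have pos: "0 < \<xi> n" for n
  proof (rule ccontr)
    assume "\<not> 0 < \<xi> n"
    then have "\<xi> n = 0" using nn[of n] by simp
    then have "\<xi> k = 0" if "k \<notin> {..<n}" for k
      using c0_star_antimono[OF \<xi>, of n k] nn[of k] that by simp
    then have "summable \<xi>" by (intro summable_finite[of "{..<n}"]) auto
    then show False using ns by contradiction
  qed
  \<comment> \<open>Scaled so that the partial sums satisfy X n \<le> n; this gives the lower bound
    of the tails in terms of n alone.\<close>
  define x where "x n = \<xi> n / \<xi> 0" for n
  have x: "0 < x n" "x n \<le> 1" "x (Suc n) \<le> x n" for n
    using pos c0_star_antimono[OF \<xi>, of 0 n] c0_star_antimono[OF \<xi>, of n "Suc n"]
    by (simp_all add: x_def divide_right_mono less_imp_le)
  define X where "X n = (\<Sum>j<n. x j)" for n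
  have X0: "0 \<le> X n" for n unfolding X_def using x(1) by (intro sum_nonneg less_imp_le)
  have Xn: "X n \<le> real n" for n unfolding X_def using sum_bounded_above[of "{..<n}" x 1] x(2) by simp
  have XS: "X (Suc n) = X n + x n" for n by (simp add: X_def)
  \<comment> \<open>The shift by 3 makes the logarithm at least 1 for nonnegative t.\<close>
  define T where "T t = 1 / ln (t + 3)" for t :: real
  define h where "h t = 1 / ((t + 3) * (ln (t + 3))\<^sup>2)" for t :: real
  have ln1: "1 \<le> ln (t + 3)" if "0 \<le> t" for t :: real
    using that exp_le by (subst ln_ge_iff) auto
  have hanti: "h t \<le> h s" if "0 \<le> s" "s \<le> t" for s t
    unfolding h_def using that ln1[of s] ln1[of t]
    by (intro divide_left_mono mult_mono power_mono mult_pos_pos) (auto intro: zero_less_power)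
  have h1: "h t \<le> 1" if "0 \<le> t" for t
  proof -
    have "1 * 1 \<le> (t + 3) * (ln (t + 3))\<^sup>2" using ln1[OF that] that by (intro mult_mono) auto
    then show ?thesis unfolding h_def by simp
  qed
  \<comment> \<open>By the mean value theorem a decrement of T is \<open>x n\<close> times a value
    of h between consecutive partial sums: a product of two nonincreasing factors, and at most
    \<open>x n\<close>.\<close>
  have "\<exists>z>X n. z < X (Suc n) \<and> T (X (Suc n)) - T (X n) = (X (Suc n) - X n) * - h z" for n
  proof (rule MVT2)
    show "X n < X (Suc n)" using x(1) by (simp add: XS)
    fix t assume "X n \<le> t" "t \<le> X (Suc n)"
    then have "0 \<le> t" using X0[of n] by linarith
    then show "(T has_real_derivative - h t) (at t)"
      using ln1[of t] unfolding T_def[abs_def] h_def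
      by (auto intro!: derivative_eq_intros simp: power2_eq_square field_simps)
  qed
  then have "\<forall>n. \<exists>z. X n < z \<and> z < X (Suc n) \<and> T (X (Suc n)) - T (X n) = - (x n * h z)"
    by (simp add: XS)
  from choice[OF this]
  obtain \<theta> where \<theta>: "\<And>n. X n < \<theta> n" "\<And>n. \<theta> n < X (Suc n)" "\<And>n. T (X (Suc n)) - T (X n) = - (x n * h (\<theta> n))"
    by blast
  define \<eta> where "\<eta> n = T (X n) - T (X (Suc n))" for n
  have \<eta>: "\<eta> n = x n * h (\<theta> n)" for n using \<theta>(3)[of n] by (simp add: \<eta>_def)
  have \<theta>0: "0 \<le> \<theta> n" for n using \<theta>(1)[of n] X0[of n] by linarith
  have h0: "0 \<le> h (\<theta> n)" for n using \<theta>0[of n] by (simp add: h_def)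
  have "filterlim X at_top sequentially"
    unfolding filterlim_at_top
  proof
    fix Z
    obtain N where N: "Z \<le> X N"
    proof (rule ccontr)
      assume "\<not> thesis"
      then have "X n \<le> Z" for n using that[of n] by linarith
      then have "summable x" unfolding X_def using x(1) by (intro summableI_nonneg_bounded[of x Z]) (auto intro: less_imp_le)
      then have "summable (\<lambda>n. \<xi> 0 * x n)" by (rule summable_mult)
      then show False using ns pos[of 0] by (simp add: x_def)
    qed
    have "X N \<le> X n" if "N \<le> n" for n
      unfolding X_def using that x(1) by (intro sum_mono2) (auto intro: less_imp_le)
    then show "\<forall>\<^sub>F n in sequentially. Z \<le> X n"
      using N order_trans unfolding eventually_sequentially by blast
  qed
  then have "filterlim (\<lambda>n. X n + 3) at_top sequentially"
    by (rule filterlim_at_top_mono) simp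
  then have "filterlim (\<lambda>n. ln (X n + 3)) at_top sequentially"
    by (rule filterlim_compose[OF ln_at_top])
  then have lim: "(\<lambda>n. T (X n)) \<longlonglongrightarrow> 0"
    unfolding T_def using tendsto_inverse_0_at_top by (simp add: divide_inverse)
  have sums: "(\<lambda>j. \<eta> (j + n)) sums T (X n)" for n
    using telescope_sums'[OF LIMSEQ_ignore_initial_segment[OF lim, of n]] by (simp add: \<eta>_def)
  have sm: "summable \<eta>" using sums[of 0] by (simp add: sums_iff)
  have "\<eta> \<in> c0_star"
  proof (rule c0_starI)
    show "0 \<le> \<eta> n" for n unfolding \<eta> by (rule mult_nonneg_nonneg[OF less_imp_le[OF x(1)] h0])
    show "\<eta> (Suc n) \<le> \<eta> n" for n
      unfolding \<eta> using \<theta>(2)[of n] \<theta>(1)[of "Suc n"]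
      by (intro mult_mono hanti x(3) h0 \<theta>0 less_imp_le[OF x(1)]) linarith
    show "\<eta> \<longlonglongrightarrow> 0" by (rule summable_LIMSEQ_zero[OF sm])
  qed
  then have l1: "\<eta> \<in> l1_star" using sm by (simp add: l1_star_def)
  have le: "\<eta> n \<le> (1 / \<xi> 0) * \<xi> n" for n
    unfolding \<eta> using mult_left_mono[OF h1[OF \<theta>0], of "x n" n] x(1)[of n] by (simp add: x_def)
  have "\<not> summable (am_inf \<eta>)"
  proof
    assume s: "summable (am_inf \<eta>)"
    have "summable (\<lambda>n. 1 / (real (Suc n) * ln (real n + 4)))"
    proof (rule summable_comparison_test'[OF s, of 0])
      fix n :: nat
      have "0 < ln (X (Suc n) + 3)" using ln1[OF X0[of "Suc n"]] by linarith
      moreover have "ln (X (Suc n) + 3) \<le> ln (real n + 4)"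
        using Xn[of "Suc n"] X0[of "Suc n"] by (subst ln_le_cancel_iff) auto
      ultimately have "1 / ln (real n + 4) \<le> T (X (Suc n))"
        unfolding T_def by (intro divide_left_mono mult_pos_pos) auto
      moreover have "am_inf \<eta> n = T (X (Suc n)) / real (Suc n)"
        using sums[of "Suc n"] by (simp add: am_inf_eq seq_tail_def sums_iff)
      ultimately have "1 / ln (real n + 4) / real (Suc n) \<le> am_inf \<eta> n"
        by (simp only: divide_right_mono of_nat_0_le_iff)
      moreover have "0 \<le> ln (real n + 4)" by simp
      ultimately show "norm (1 / (real (Suc n) * ln (real n + 4))) \<le> am_inf \<eta> n"
        by (simp add: mult.commute)
    qed
    then show False using not_summable_inverse_mult_ln by contradiction
  qed
  then show ?thesis using that[OF l1 le] by blast
qed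

text \<open>With w N = N \<open>\<mu>\<close> (N - 1), averaging w against N / (t (t + 1)) over t \<open>\<ge>\<close> N turns each step of w into
  a convex function of N; hence the averages are the tails of a nonincreasing sequence.\<close>

lemma convexification:
  assumes \<mu>0: "\<And>n. 0 \<le> \<mu> n" and dec: "decseq (\<lambda>n. real (Suc n) * \<mu> n)"
    and lim: "(\<lambda>n. real (Suc n) * \<mu> n) \<longlonglongrightarrow> 0"
  obtains \<rho> where "\<rho> \<in> l1_star" "\<And>n. am_inf \<rho> n \<le> \<mu> n" "\<And>n. \<mu> (2 * n + 1) \<le> am_inf \<rho> n"
proof -
  \<comment> \<open>The truncated subtraction gives w 0 = w 1, so w is nonincreasing from index 0
    on. Division by zero makes g 0 = 0.\<close>
  define w where "w N = real (Suc (N - 1)) * \<mu> (N - 1)" for N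
  define g where "g t = w t / (real t * real (Suc t))" for t
  define R where "R N = (\<Sum>j. g (j + N))" for N
  have w0: "0 \<le> w N" for N using \<mu>0 by (simp add: w_def)
  have wdec: "w n \<le> w m" if "m \<le> n" for m n
    using decseqD[OF dec, of "m - 1" "n - 1"] that by (simp add: w_def)
  have wlim: "w \<longlonglongrightarrow> 0"
    by (rule LIMSEQ_offset[of _ 1]) (use lim in \<open>simp add: w_def\<close>)
  have g0: "0 \<le> g t" for t using w0 by (simp add: g_def)
  have frac: "1 / real k - 1 / real (Suc k) = 1 / (real k * real (Suc k))" if "1 \<le> k" for k
    using that by (simp add: field_simps)
  have tele: "(\<lambda>j. 1 / (real (j + N) * real (Suc (j + N)))) sums (1 / real N)" if "N \<ge> 1" for N
  proof -
    have "(\<lambda>j. 1 / real (j + N)) \<longlonglongrightarrow> 0"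
      by (rule LIMSEQ_ignore_initial_segment[of "\<lambda>j. 1 / real j" 0 N]) (rule lim_1_over_n)
    from telescope_sums'[OF this]
    have "(\<lambda>j. 1 / real (j + N) - 1 / real (Suc j + N)) sums (1 / real N)" by simp
    then show ?thesis using frac[of "_ + N"] that by (simp only: add_Suc trans_le_add2)
  qed
  have gle: "g (j + N) \<le> w N * (1 / (real (j + N) * real (Suc (j + N))))" for j N
    using wdec[of N "j + N"] by (simp add: g_def divide_right_mono)
  have sg1: "summable (\<lambda>j. g (j + N))" if "N \<ge> 1" for N
    by (rule summable_comparison_test'[OF summable_mult[OF sums_summable[OF tele[OF that]]], of 0])
      (use gle g0 in simp)
  have "summable g" using sg1[of 1] by (simp only: summable_iff_shift)
  then have sg: "summable (\<lambda>j. g (j + N))" for N by (rule summable_ignore_initial_segment)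
  have RS: "R N = g N + R (Suc N)" for N
    unfolding R_def using suminf_split_head[OF sg[of N]] by simp
  have Rle: "R N \<le> w N / real N" if "N \<ge> 1" for N
  proof -
    have "R N \<le> (\<Sum>j. w N * (1 / (real (j + N) * real (Suc (j + N)))))"
      unfolding R_def by (intro suminf_le gle sg summable_mult sums_summable[OF tele[OF that]])
    also have "\<dots> = w N * (1 / real N)"
      by (simp only: suminf_mult[OF sums_summable[OF tele[OF that]]] sums_unique[OF tele[OF that], symmetric])
    finally show ?thesis by simp
  qed
  have R0: "0 \<le> R N" for N unfolding R_def by (intro suminf_nonneg sg g0)
  \<comment> \<open>The weights N / (t (t + 1)) have total mass 1 on t \<ge> N, and half of it lies
    on t < 2 N, where w is at least w (2 N).\<close>
  have Rge: "w (2 * N) / (2 * real N) \<le> R N" if "N \<ge> 1" for N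
  proof -
    have "w (2 * N) / (2 * real N) = w (2 * N) * (1 / real N - 1 / real (2 * N))"
      using that by (simp add: field_simps)
    also have "1 / real N - 1 / real (2 * N) = (\<Sum>j<N. 1 / real (j + N) - 1 / real (Suc j + N))"
      using sum_lessThan_telescope'[of "\<lambda>j. 1 / real (j + N)" N] by (simp only: add_0 mult_2)
    also have "\<dots> = (\<Sum>j<N. 1 / (real (j + N) * real (Suc (j + N))))"
      using frac[of "_ + N"] that by (simp only: add_Suc trans_le_add2)
    also have "w (2 * N) * \<dots> = (\<Sum>j<N. w (2 * N) * (1 / (real (j + N) * real (Suc (j + N)))))"
      by (rule sum_distrib_left)
    also have "\<dots> \<le> (\<Sum>j<N. g (j + N))"
    proof (rule sum_mono)
      fix j assume "j \<in> {..<N}"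
      then show "w (2 * N) * (1 / (real (j + N) * real (Suc (j + N)))) \<le> g (j + N)"
        using wdec[of "j + N" "2 * N"] by (simp add: g_def divide_right_mono)
    qed
    also have "\<dots> \<le> R N" unfolding R_def by (intro sum_le_suminf sg) (use g0 in auto)
    finally show ?thesis .
  qed
  \<comment> \<open>For N \<ge> 1 this is the decrement of N R N. At index 0 that decrement would be
    - R 1; the present form is nonnegative and nonincreasing there too.\<close>
  define \<rho> where "\<rho> i = w i / real (Suc i) - R (Suc i)" for i
  have tailstep: "real N * R N - real (Suc N) * R (Suc N) = \<rho> N" if "N \<ge> 1" for N
  proof -
    have "real N * g N = w N / real (Suc N)" using that by (simp add: g_def)
    moreover have "real N * R N = real N * g N + real N * R (Suc N)" by (simp only: RS[of N] distrib_left)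
    moreover have "real (Suc N) * R (Suc N) = real N * R (Suc N) + R (Suc N)" by (simp add: distrib_right)
    ultimately show ?thesis unfolding \<rho>_def by linarith
  qed
  have Tlim: "(\<lambda>N. real N * R N) \<longlonglongrightarrow> 0"
  proof (rule tendsto_sandwich[OF _ _ tendsto_const wlim])
    show "\<forall>\<^sub>F N in sequentially. 0 \<le> real N * R N" using R0 by simp
    show "\<forall>\<^sub>F N in sequentially. real N * R N \<le> w N"
      using Rle unfolding eventually_sequentially by (intro exI[of _ 1]) (auto simp: field_simps)
  qed
  have tail: "(\<lambda>j. \<rho> (j + N)) sums (real N * R N)" if "N \<ge> 1" for N
  proof -
    have "(\<lambda>j. real (j + N) * R (j + N) - real (Suc j + N) * R (Suc j + N)) sums (real (0 + N) * R (0 + N) - 0)"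
      by (rule telescope_sums'[OF LIMSEQ_ignore_initial_segment[OF Tlim]])
    then show ?thesis using tailstep[of "_ + N"] that by (simp only: add_0 add_Suc trans_le_add2 diff_0_right)
  qed
  have \<rho>: "\<rho> \<in> l1_star"
  proof -
    have sm: "summable \<rho>" 
      using sums_summable[OF tail[OF order_refl]] by (rule summable_iff_shift[THEN iffD1])
    have "\<rho> \<in> c0_star"
    proof (rule c0_starI[OF _ _ summable_LIMSEQ_zero[OF sm]])
      show "0 \<le> \<rho> i" for i
        using Rle[of "Suc i"] wdec[of i "Suc i"] divide_right_mono[of "w (Suc i)" "w i" "real (Suc i)"]
        by (simp add: \<rho>_def)
      show "\<rho> (Suc i) \<le> \<rho> i" for i
      proof -
        have "w i / real (Suc i) \<ge> w (Suc i) / real (Suc i)" using wdec[of i "Suc i"] by (simp add: divide_right_mono)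
        moreover have "w (Suc i) / real (Suc i) = w (Suc i) / real (Suc (Suc i)) + g (Suc i)"
        proof -
          have "w (Suc i) * (1 / real (Suc i) - 1 / real (Suc (Suc i))) = g (Suc i)"
            by (subst frac) (simp_all add: g_def)
          then show ?thesis by (simp only: right_diff_distrib times_divide_eq_right mult_1_right)
        qed
        ultimately show ?thesis using RS[of "Suc i"] by (simp add: \<rho>_def)
      qed
    qed
    then show ?thesis using sm by (simp add: l1_star_def)
  qed
  have am: "am_inf \<rho> n = R (Suc n)" for n
  proof -
    have "seq_tail \<rho> (Suc n) = real (Suc n) * R (Suc n)"
      unfolding seq_tail_def by (rule sums_unique[symmetric, OF tail]) simp
    then show ?thesis by (simp add: am_inf_eq del: of_nat_Suc)
  qed
  show ?thesis
  proof (rule that[OF \<rho>])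
    show "am_inf \<rho> n \<le> \<mu> n" for n using Rle[of "Suc n"] by (simp add: am w_def)
    show "\<mu> (2 * n + 1) \<le> am_inf \<rho> n" for n
    proof -
      have "w (2 * Suc n) = 2 * real (Suc n) * \<mu> (2 * n + 1)" by (simp add: w_def)
      then show ?thesis using Rge[of "Suc n"] by (simp add: am del: of_nat_Suc)
    qed
  qed
qed

section \<open>Principal characteristic sets\<close>

text \<open>The smallest characteristic set containing \<xi>. Sums need no clause of their own,
  since the ampliation by m k dominates those by m and by k.\<close>

definition principal_set :: "(nat \<Rightarrow> real) \<Rightarrow> (nat \<Rightarrow> real) set" where
  "principal_set \<xi> = {\<eta> \<in> c0_star. \<exists>m>0. \<exists>C. \<forall>n. \<eta> n \<le> C * \<xi> (n div m)}"

context
  fixes \<xi> assumes \<xi>: "\<xi> \<in> c0_star"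
begin

lemma principal_setI:
  assumes "\<eta> \<in> c0_star" "0 < m" "\<And>n. \<eta> n \<le> C * \<xi> (n div m)" shows "\<eta> \<in> principal_set \<xi>"
  unfolding principal_set_def by (intro CollectI conjI exI[of _ m] exI[of _ C] allI assms)

lemma principal_setE:
  assumes "\<eta> \<in> principal_set \<xi>"
  obtains m C where "\<eta> \<in> c0_star" "0 < m" "0 \<le> C" "\<And>n. \<eta> n \<le> C * \<xi> (n div m)"
proof -
  obtain m C where *: "\<eta> \<in> c0_star" "0 < m" "\<forall>n. \<eta> n \<le> C * \<xi> (n div m)"
    using assms by (auto simp: principal_set_def)
  have "C * \<xi> (n div m) \<le> \<bar>C\<bar> * \<xi> (n div m)" for n
    using c0_starD(1)[OF \<xi>] by (intro mult_right_mono) auto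
  then have "\<eta> n \<le> \<bar>C\<bar> * \<xi> (n div m)" for n by (rule order_trans[OF spec[OF *(3)]])
  then show ?thesis by (rule that[OF *(1,2) abs_ge_zero])
qed

lemma ampliation_mono: assumes "0 < m" "m \<le> k" shows "\<xi> (n div m) \<le> \<xi> (n div k)"
  using assms by (intro c0_star_antimono[OF \<xi>] div_le_mono2)

lemma generator_mem: "\<xi> \<in> principal_set \<xi>"
  by (rule principal_setI[OF \<xi>, of 1 1]) auto

lemma calkin_set_principal: "calkin_set (principal_set \<xi>)"
  unfolding calkin_set_def
proof (intro conjI ballI allI impI)
  show "principal_set \<xi> \<subseteq> c0_star" by (auto simp: principal_set_def)
  show "(\<lambda>_. 0) \<in> principal_set \<xi>"
    by (rule principal_setI[OF l1_starD(1)[OF zero_in_l1_star], of 1 0]) auto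
  fix a assume "a \<in> principal_set \<xi>"
  then obtain m C where a: "a \<in> c0_star" "0 < m" "0 \<le> C" "\<And>n. a n \<le> C * \<xi> (n div m)"
    by (rule principal_setE) blast
  show "(\<lambda>n. a n + b n) \<in> principal_set \<xi>" if b0: "b \<in> principal_set \<xi>" for b
  proof -
    obtain k D where b: "b \<in> c0_star" "0 < k" "0 \<le> D" "\<And>n. b n \<le> D * \<xi> (n div k)"
      using b0 by (rule principal_setE) blast
    show ?thesis
    proof (rule principal_setI[OF c0_star_add[OF a(1) b(1)], of "m * k" "C + D"])
      fix n
      have "a n \<le> C * \<xi> (n div (m * k))"
        using a(2) b(2) by (intro order_trans[OF a(4)] mult_left_mono ampliation_mono a(3)) auto
      moreover have "b n \<le> D * \<xi> (n div (m * k))"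
        using a(2) b(2) by (intro order_trans[OF b(4)] mult_left_mono ampliation_mono b(3)) auto
      ultimately show "a n + b n \<le> (C + D) * \<xi> (n div (m * k))" by (simp add: distrib_right)
    qed (use a(2) b(2) in simp)
  qed
  show "b \<in> principal_set \<xi>" if "b \<in> c0_star" "\<forall>n. b n \<le> a n" for b
    by (rule principal_setI[OF that(1) a(2) order_trans[OF spec[OF that(2)] a(4)]])
  show "(\<lambda>n. a (n div k)) \<in> principal_set \<xi>" if "0 < k" for k
    using that a(2,4) by (intro principal_setI[OF c0_star_ampliation[OF a(1) that], of "k * m" C])
      (simp_all add: div_mult2_eq)
qed

lemma principal_set_subset:
  assumes T: "calkin_set T" "\<xi> \<in> T" shows "principal_set \<xi> \<subseteq> T"
proof
  fix \<eta> assume "\<eta> \<in> principal_set \<xi>"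
  then obtain m C where a: "\<eta> \<in> c0_star" "0 < m" "0 \<le> C" "\<And>n. \<eta> n \<le> C * \<xi> (n div m)"
    by (rule principal_setE) blast
  show "\<eta> \<in> T" by (rule calkin_set_dominated[OF T(1) calkin_setD(5)[OF T a(2)] a(1,4)])
qed

lemma nontrivial_principal: "\<xi> 0 \<noteq> 0 \<Longrightarrow> nontrivial_calkin_set (principal_set \<xi>)"
  using calkin_set_principal generator_mem by (auto simp: nontrivial_calkin_set_def)

end

text \<open>Each doubling of the endpoint contributes at least 1 / 2.\<close>

lemma harmonic_block_sum:
  assumes "1 \<le> M" shows "real r / 2 \<le> (\<Sum>j=M..<2 ^ r * M. 1 / real (Suc j))"
proof (induction r)
  case (Suc r)
  define a where "a = 2 ^ r * M"
  have "(1::nat) \<le> 2 ^ r" by simp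
  then have Ma: "M \<le> a" "1 \<le> a" using assms by (simp_all add: a_def)
  have "1 / 2 = (\<Sum>j=a..<2 * a. 1 / real (2 * a))" using Ma by simp
  also have "\<dots> \<le> (\<Sum>j=a..<2 * a. 1 / real (Suc j))"
    by (intro sum_mono frac_le) auto
  finally have "1 / 2 \<le> (\<Sum>j=a..<2 * a. 1 / real (Suc j))" .
  moreover have "(\<Sum>j=M..<2 * a. 1 / real (Suc j))
     = (\<Sum>j=M..<a. 1 / real (Suc j)) + (\<Sum>j=a..<2 * a. 1 / real (Suc j))"
    using sum.atLeastLessThan_concat[of M a "2 * a" "\<lambda>j. 1 / real (Suc j)"] Ma by simp
  moreover have "2 ^ Suc r * M = 2 * a" by (simp add: a_def)
  ultimately have "real (Suc r) / 2 \<le> (\<Sum>j=M..<2 * a. 1 / real (Suc j))" "2 ^ Suc r * M = 2 * a"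
    using Suc unfolding a_def[symmetric] by simp_all
  then show ?case by (simp only:)
qed simp

text \<open>Between n and 2 ^ r * n the tail of \<open>\<mu>\<close> picks up at least r / 2 times the value of \<open>(n + 1) \<mu>\<close> at
  the right end, while stability bounds it by a fixed multiple of the value at the left end.\<close>

lemma stable_imp_decay:
  assumes \<mu>: "\<mu> \<in> l1_star" and dec: "decseq (\<lambda>n. real (Suc n) * \<mu> n)" and st: "am_inf \<mu> \<in> principal_set \<mu>"
  obtains K :: nat where "0 < K" "\<And>n. real (Suc (K * Suc n)) * \<mu> (K * Suc n) \<le> real (Suc n) * \<mu> n / 2"
proof -
  define g where "g n = real (Suc n) * \<mu> n" for n
  have g0: "0 \<le> g n" for n using c0_starD(1)[OF l1_starD(1)[OF \<mu>]] by (simp add: g_def)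
  have gdec: "g n \<le> g m" if "m \<le> n" for m n using decseqD[OF dec that] by (simp add: g_def)
  obtain m C where "am_inf \<mu> \<in> c0_star" and m: "0 < m" "0 \<le> C" "\<And>n. am_inf \<mu> n \<le> C * \<mu> (n div m)"
    by (rule principal_setE[OF l1_starD(1)[OF \<mu>] st]) blast
  \<comment> \<open>The block sum gives r / 2 times the right-hand value and stability gives C m
    times the left-hand one; r \<ge> 4 C m makes the quotient 1 / 2, and the 1 keeps r
    positive.\<close>
  obtain r :: nat where r: "4 * C * real m + 1 \<le> real r" using real_arch_simple by blast
  show ?thesis
  proof (rule that[of "2 ^ r * m"])
    show "0 < 2 ^ r * m" using m by simp
    fix q
    \<comment> \<open>The mean at m q uses the tail from M, and its bound reads \<mu> at (m q) div m
      = q.\<close>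
    define M where "M = m * q + 1"
    have "real (Suc (m * q)) \<le> real m * real (Suc q)" using m(1) by (simp add: distrib_left)
    then have "real (Suc (m * q)) * \<mu> q \<le> real m * g q"
      unfolding g_def mult.assoc[symmetric] using c0_starD(1)[OF l1_starD(1)[OF \<mu>]] by (rule mult_right_mono)
    then have up: "C * (real (Suc (m * q)) * \<mu> q) \<le> C * (real m * g q)" using m(2) by (rule mult_left_mono)
    have "g (2 ^ r * M) * (real r / 2) \<le> g (2 ^ r * M) * (\<Sum>j=M..<2 ^ r * M. 1 / real (Suc j))"
      by (intro mult_left_mono harmonic_block_sum g0) (simp add: M_def)
    also have "\<dots> = (\<Sum>j=M..<2 ^ r * M. g (2 ^ r * M) / real (Suc j))" by (simp add: sum_distrib_left)
    also have "\<dots> \<le> (\<Sum>j=M..<2 ^ r * M. \<mu> j)"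
    proof (rule sum_mono)
      fix j assume "j \<in> {M..<2 ^ r * M}"
      then have "g (2 ^ r * M) \<le> real (Suc j) * \<mu> j" using gdec[of j "2 ^ r * M"] by (simp add: g_def)
      then show "g (2 ^ r * M) / real (Suc j) \<le> \<mu> j" by (simp add: pos_divide_le_eq mult.commute)
    qed
    also have "\<dots> \<le> seq_tail \<mu> M" by (rule sum_le_seq_tail[OF \<mu>])
    also have "\<dots> = real (Suc (m * q)) * am_inf \<mu> (m * q)" by (simp add: am_inf_eq M_def del: of_nat_Suc)
    also have "\<dots> \<le> real (Suc (m * q)) * (C * \<mu> q)"
      using m(3)[of "m * q"] m(1) by (intro mult_left_mono) auto
    also have "\<dots> \<le> C * (real m * g q)" using up by (simp add: mult_ac)
    also have "\<dots> \<le> real r / 4 * g q"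
      using mult_right_mono[of "4 * C * real m" "real r" "g q"] r g0 by simp
    finally have "real r * g (2 ^ r * M) \<le> real r * (g q / 2)" by simp
    moreover have "0 < real r" using r m(2) mult_nonneg_nonneg[of "4 * C" "real m"] by linarith
    ultimately have "g (2 ^ r * M) \<le> g q / 2" by simp
    moreover have "2 ^ r * M \<le> 2 ^ r * m * Suc q" using m(1) by (simp add: M_def)
    then have "g (2 ^ r * m * Suc q) \<le> g (2 ^ r * M)" by (rule gdec)
    ultimately have "g (2 ^ r * m * Suc q) \<le> g q / 2" by linarith
    then show "real (Suc (2 ^ r * m * Suc q)) * \<mu> (2 ^ r * m * Suc q) \<le> real (Suc q) * \<mu> q / 2"
      by (simp only: g_def)
  qed
qed

section \<open>Stability of derived sets\<close>

lemma harmonic_c0_star: "harmonic \<in> c0_star"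
proof (rule c0_starI)
  show "0 \<le> harmonic n" "harmonic (Suc n) \<le> harmonic n" for n
    by (auto simp: harmonic_def intro: divide_left_mono)
  show "harmonic \<longlonglongrightarrow> 0"
    using LIMSEQ_inverse_real_of_nat by (simp add: harmonic_def[abs_def] inverse_eq_divide)
qed

lemma not_summable_harmonic_seq: "\<not> summable harmonic"
proof
  assume "summable harmonic"
  then have "summable (\<lambda>n. inverse (real (Suc n)))" by (simp add: harmonic_def[abs_def] inverse_eq_divide)
  then have "summable (\<lambda>n. inverse (real n))" by (rule summable_Suc_iff[THEN iffD1])
  then show False using not_summable_harmonic[where 'a = real] by simp
qed

text \<open>Restates the lower bound with an ampliation by 3, the form in which membership in a
  characteristic set is tested.\<close>

lemma convexification_c0_star:
  assumes \<mu>: "\<mu> \<in> c0_star" and dec: "decseq (\<lambda>n. real (Suc n) * \<mu> n)"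
    and lim: "(\<lambda>n. real (Suc n) * \<mu> n) \<longlonglongrightarrow> 0"
  obtains \<rho> where "\<rho> \<in> l1_star" "\<And>n. am_inf \<rho> n \<le> \<mu> n" "\<And>n. 1 \<le> n \<Longrightarrow> \<mu> n \<le> am_inf \<rho> (n div 3)"
proof -
  obtain \<rho> where \<rho>: "\<rho> \<in> l1_star" "\<And>n. am_inf \<rho> n \<le> \<mu> n" "\<And>n. \<mu> (2 * n + 1) \<le> am_inf \<rho> n"
    by (rule convexification[OF c0_starD(1)[OF \<mu>] dec lim]) blast
  have "\<mu> n \<le> am_inf \<rho> (n div 3)" if "1 \<le> n" for n
  proof -
    have "2 * (n div 3) + 1 \<le> n" using that by presburger
    then have "\<mu> n \<le> \<mu> (2 * (n div 3) + 1)" by (rule c0_star_antimono[OF \<mu>])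
    then show ?thesis using \<rho>(3) by (rule order_trans)
  qed
  then show ?thesis by (rule that[OF \<rho>(1,2)])
qed

lemma stableD:
  assumes "S = pre_set S" "\<xi> \<in> S" shows "\<xi> \<in> l1_star" "am_inf \<xi> \<in> S"
proof -
  have "\<xi> \<in> pre_set S" using assms by simp
  then show "\<xi> \<in> l1_star" "am_inf \<xi> \<in> S" by (simp_all add: pre_set_def)
qed

lemma Suc_le_mult_Suc_div: "0 < m \<Longrightarrow> real (Suc n) \<le> real m * real (Suc (n div m))"
proof -
  assume "0 < m"
  then have "Suc n \<le> m * Suc (n div m)" using dividend_less_div_times[of m n] by (simp add: mult.commute)
  then show ?thesis by (simp only: of_nat_mult[symmetric] of_nat_le_iff)
qed

context
  fixes \<xi> assumes \<xi>: "\<xi> \<in> c0_star" and \<xi>0: "\<xi> 0 \<noteq> 0"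
begin

lemma nontrivial_generated: "nontrivial_calkin_set (principal_set \<xi>)"
  by (rule nontrivial_principal[OF \<xi> \<xi>0])

lemma principal_eqI:
  assumes "nontrivial_calkin_set T" "\<xi> \<in> T" "T \<subseteq> principal_set \<xi>" shows "principal_set \<xi> = T"
  using principal_set_subset[OF \<xi> _ assms(2)] assms(1,3) by (auto simp: nontrivial_calkin_set_def)

text \<open>Means of summable sequences are O(harmonic), so with \<open>harmonic\<close> in the set
  every summable sequence would lie in its \<open>pre_set\<close>; stability would then make all
  their means summable, which fails.\<close>

lemma harmonic_notin_if_pre_stable:
  assumes st: "pre_set (principal_set \<xi>) = pre_set (pre_set (principal_set \<xi>))"
  shows "harmonic \<notin> principal_set \<xi>"
proof
  assume h: "harmonic \<in> principal_set \<xi>"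
  obtain \<eta> C where \<eta>: "\<eta> \<in> l1_star" "\<not> summable (am_inf \<eta>)"
    by (rule summable_minorant_with_large_means[OF harmonic_c0_star not_summable_harmonic_seq]) blast
  have "am_inf \<eta> n \<le> seq_tail \<eta> 0 * harmonic n" for n
    using seq_tail_antimono[OF \<eta>(1), of 0 "Suc n"] by (simp add: am_inf_eq harmonic_def divide_right_mono del: of_nat_Suc)
  then have "am_inf \<eta> \<in> principal_set \<xi>"
    by (rule calkin_set_dominated[OF calkin_set_principal[OF \<xi>] h am_inf_c0_star[OF \<eta>(1)]])
  then have "\<eta> \<in> pre_set (principal_set \<xi>)" using \<eta>(1) by (simp add: pre_set_def)
  from stableD(2)[OF st this] have "am_inf \<eta> \<in> l1_star" using pre_set_subset_l1 by blast
  then show False using \<eta>(2) l1_starD(2) by blast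
qed

text \<open>For u the largest nonincreasing minorant of \<open>(n + 1) \<xi>\<close> and \<open>\<mu> = u / (n + 1)\<close>, the stable set
  contains \<open>\<mu>\<close>; decay of u bounds the gaps between the indices where u and \<open>(n + 1) \<xi>\<close> agree,
  hence \<open>\<xi> = O(\<mu>)\<close>.\<close>

lemma stable_if_pre_stable:
  assumes st: "pre_set (principal_set \<xi>) = pre_set (pre_set (principal_set \<xi>))"
  shows "principal_set \<xi> = pre_set (principal_set \<xi>)"
proof -
  define S J where "S = principal_set \<xi>" and "J = pre_set S"
  have S: "nontrivial_calkin_set S" and \<xi>S: "\<xi> \<in> S"
    using nontrivial_generated generator_mem[OF \<xi>] by (simp_all add: S_def)
  have SC: "calkin_set S" using S by (simp add: nontrivial_calkin_set_def)
  have J: "nontrivial_calkin_set J" unfolding J_def by (rule nontrivial_pre_set[OF S])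
  have JC: "calkin_set J" using J by (simp add: nontrivial_calkin_set_def)
  have JS: "J \<subseteq> S" unfolding J_def by (rule pre_set_subset[OF S])
  have stJ: "J = pre_set J" using st by (simp add: J_def S_def)
  define g where "g k = real (Suc k) * \<xi> k" for k
  define u where "u n = Min (g ` {..n})" for n
  have g0: "0 \<le> g k" for k using c0_starD(1)[OF \<xi>] by (simp add: g_def)
  have ule: "u n \<le> g k" if "k \<le> n" for n k unfolding u_def using that by (intro Min_le) auto
  have uex: "\<exists>p\<le>n. u n = g p" for n
  proof -
    have "u n \<in> g ` {..n}" unfolding u_def by (rule Min_in) auto
    then show ?thesis by auto
  qed
  have u0: "0 \<le> u n" for n using uex[of n] g0 by auto
  have udec: "u n \<le> u m" if "m \<le> n" for m n
  proof -
    obtain p where "p \<le> m" "u m = g p" using uex by blast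
    then show ?thesis using ule[of p n] that by simp
  qed
  have "decseq u" using udec by (simp add: decseq_def)
  moreover have "\<forall>n. 0 \<le> u n" using u0 by blast
  ultimately
  obtain L where L: "u \<longlonglongrightarrow> L" "\<forall>n. L \<le> u n" by (rule decseq_convergent)
  have "L = 0"
  proof (rule ccontr)
    assume "L \<noteq> 0"
    moreover have "0 \<le> L" using LIMSEQ_le_const[OF L(1), of 0] u0 by blast
    ultimately have Lp: "0 < L" by simp
    have "harmonic n \<le> (1 / L) * \<xi> n" for n
    proof -
      have "L \<le> real (Suc n) * \<xi> n" using spec[OF L(2), of n] ule[of n n] by (simp add: g_def)
      then show ?thesis using Lp by (simp add: harmonic_def field_simps)
    qed
    then have "harmonic \<in> S" by (rule calkin_set_dominated[OF SC \<xi>S harmonic_c0_star])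
    then show False using harmonic_notin_if_pre_stable[OF st] by (simp add: S_def)
  qed
  then have ulim: "u \<longlonglongrightarrow> 0" using L(1) by simp
  define \<mu> where "\<mu> n = u n / real (Suc n)" for n
  have n\<mu>: "real (Suc n) * \<mu> n = u n" for n by (simp add: \<mu>_def del: of_nat_Suc)
  have \<mu>le: "\<mu> n \<le> \<xi> n" for n using ule[of n n] by (simp add: \<mu>_def g_def field_simps)
  have \<mu>: "\<mu> \<in> c0_star"
  proof (rule c0_starI)
    show \<mu>0: "0 \<le> \<mu> n" for n using u0 by (simp add: \<mu>_def)
    show "\<mu> (Suc n) \<le> \<mu> n" for n unfolding \<mu>_def using udec[of n "Suc n"] u0 by (intro frac_le) auto
    show "\<mu> \<longlonglongrightarrow> 0"
      by (rule tendsto_sandwich[OF _ _ tendsto_const c0_starD(3)[OF \<xi>]]) (simp_all add: \<mu>0 \<mu>le)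
  qed
  have dec: "decseq (\<lambda>n. real (Suc n) * \<mu> n)" unfolding n\<mu> using udec by (simp add: decseq_def)
  have lim: "(\<lambda>n. real (Suc n) * \<mu> n) \<longlonglongrightarrow> 0" unfolding n\<mu> by (rule ulim)
  obtain \<rho> where \<rho>: "\<rho> \<in> l1_star" "\<And>n. am_inf \<rho> n \<le> \<mu> n" "\<And>n. 1 \<le> n \<Longrightarrow> \<mu> n \<le> am_inf \<rho> (n div 3)"
    by (rule convexification_c0_star[OF \<mu> dec lim]) blast
  have "am_inf \<rho> \<in> S"
    by (rule calkin_setD(4)[OF SC \<xi>S am_inf_c0_star[OF \<rho>(1)] order_trans[OF \<rho>(2) \<mu>le]])
  then have "\<rho> \<in> J" using \<rho>(1) by (simp add: J_def pre_set_def)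
  then have "am_inf \<rho> \<in> J" by (rule stableD(2)[OF stJ])
  then have "(\<lambda>n. am_inf \<rho> (n div 3)) \<in> J" by (rule calkin_setD(5)[OF JC]) simp
  then have \<mu>J: "\<mu> \<in> J"
    by (rule eventually_dominated_mem[OF J _ \<mu>, of _ 1 1]) (simp add: \<rho>(3))
  have \<mu>1: "\<mu> \<in> l1_star" by (rule stableD(1)[OF stJ \<mu>J])
  have "am_inf \<mu> \<in> principal_set \<xi>" using stableD(2)[OF stJ \<mu>J] JS by (auto simp: S_def)
  then obtain m C where m: "0 < m" "0 \<le> C" "\<And>n. am_inf \<mu> n \<le> C * \<xi> (n div m)"
    by (rule principal_setE[OF \<xi>]) blast
  have tail: "seq_tail \<mu> (Suc n) \<le> C * real m * g (n div m)" for n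
  proof -
    have "seq_tail \<mu> (Suc n) = real (Suc n) * am_inf \<mu> n" by (simp add: am_inf_eq del: of_nat_Suc)
    also have "\<dots> \<le> real (Suc n) * (C * \<xi> (n div m))" by (intro mult_left_mono m(3)) simp
    also have "\<dots> \<le> (real m * real (Suc (n div m))) * (C * \<xi> (n div m))"
      by (intro mult_right_mono Suc_le_mult_Suc_div m mult_nonneg_nonneg c0_starD(1)[OF \<xi>])
    finally show ?thesis by (simp add: g_def mult_ac)
  qed
  \<comment> \<open>So far the tail is bounded through g, not through its running minimum u. But
    tails decrease, so the bound may be taken at the earlier index p m, with p a point where the
    minimum up to n div m is attained.\<close>
  have "am_inf \<mu> n \<le> C * real m * \<mu> (n div m)" for n
  proof -
    obtain p where p: "p \<le> n div m" "u (n div m) = g p" using uex by blast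
    have "p * m \<le> n" using p(1) m(1) by (simp add: less_eq_div_iff_mult_less_eq)
    then have "seq_tail \<mu> (Suc n) \<le> seq_tail \<mu> (Suc (p * m))" by (intro seq_tail_antimono[OF \<mu>1]) simp
    also have "\<dots> \<le> C * real m * g p" using tail[of "p * m"] m(1) by simp
    also have "\<dots> = C * real m * u (n div m)" by (simp add: p(2))
    finally have "am_inf \<mu> n \<le> C * real m * u (n div m) / real (Suc n)"
      by (simp add: am_inf_eq divide_right_mono del: of_nat_Suc)
    also have "\<dots> \<le> C * real m * u (n div m) / real (Suc (n div m))"
      using m(2) u0 by (intro divide_left_mono mult_nonneg_nonneg) auto
    finally show ?thesis by (simp add: \<mu>_def)
  qed
  then have "am_inf \<mu> \<in> principal_set \<mu>" by (rule principal_setI[OF \<mu> am_inf_c0_star[OF \<mu>1] m(1)])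
  then obtain K :: nat where K: "0 < K" "\<And>n. u (K * Suc n) \<le> u n / 2"
    by (rule stable_imp_decay[OF \<mu>1 dec, unfolded n\<mu>]) blast
  have "\<xi> n \<le> real K * \<mu> n" for n
  proof -
    obtain p where p: "p \<le> n" "u n = g p" using uex by blast
    have up: "u p = u n" using ule[of p p] udec[OF p(1)] p(2) by simp
    have \<xi>p: "\<xi> n \<le> \<xi> p" by (rule c0_star_antimono[OF \<xi> p(1)])
    show ?thesis
    proof (cases "u n = 0")
      case True
      then have "\<xi> p = 0" using p(2) by (simp add: g_def)
      then show ?thesis using \<xi>p True by (simp add: \<mu>_def)
    next
      case False
      \<comment> \<open>u is constant from p to n, so the halving promised by the decay cannot occur
        in between.\<close>
      have "n < K * Suc p"
      proof (rule ccontr)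
        assume "\<not> n < K * Suc p"
        then have "u n \<le> u (K * Suc p)" by (intro udec) simp
        also have "\<dots> \<le> u n / 2" using K(2)[of p] up by simp
        finally show False using False u0[of n] by simp
      qed
      then have "Suc n \<le> K * Suc p" by simp
      then have "real (Suc n) \<le> real K * real (Suc p)" by (simp only: of_nat_mult[symmetric] of_nat_le_iff)
      then have "real (Suc n) * \<xi> p \<le> real K * real (Suc p) * \<xi> p"
        using c0_starD(1)[OF \<xi>] by (rule mult_right_mono)
      also have "\<dots> = real K * u n" by (simp add: p(2) g_def)
      finally have "\<xi> p \<le> real K * \<mu> n" by (simp add: \<mu>_def field_simps)
      then show ?thesis using \<xi>p by simp
    qed
  qed
  then have "\<xi> \<in> J" by (rule calkin_set_dominated[OF JC \<mu>J \<xi>])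
  from principal_eqI[OF J this] JS show ?thesis by (simp add: J_def S_def)
qed

text \<open>Here \<open>\<mu> = am_inf \<xi>\<close>, so that the decaying quantity \<open>(n + 1) \<mu>\<close> is the tail of \<open>\<xi>\<close>: half of it
  lies in a block of length K (n + 1), on which \<open>\<xi>\<close> is at most \<open>\<xi> n\<close>.\<close>

lemma stable_if_post_stable:
  assumes st: "post_set (principal_set \<xi>) = pre_set (post_set (principal_set \<xi>))"
  shows "principal_set \<xi> = pre_set (principal_set \<xi>)"
proof -
  define S J where "S = principal_set \<xi>" and "J = post_set S"
  have S: "nontrivial_calkin_set S" and \<xi>S: "\<xi> \<in> S"
    using nontrivial_generated generator_mem[OF \<xi>] by (simp_all add: S_def)
  have SC: "calkin_set S" using S by (simp add: nontrivial_calkin_set_def)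
  have stJ: "J = pre_set J" using st by (simp add: J_def S_def)
  have amJ: "am_inf \<eta> \<in> J" if "\<eta> \<in> S" "\<eta> \<in> l1_star" for \<eta>
    unfolding J_def by (rule post_setI[OF am_inf_c0_star[OF that(2)] that, of 0 1]) simp
  have "summable \<xi>"
  proof (rule ccontr)
    assume "\<not> summable \<xi>"
    then obtain \<eta> C where \<eta>: "\<eta> \<in> l1_star" "\<And>n. \<eta> n \<le> C * \<xi> n" "\<not> summable (am_inf \<eta>)"
      by (rule summable_minorant_with_large_means[OF \<xi>]) blast
    have "\<eta> \<in> S" by (rule calkin_set_dominated[OF SC \<xi>S l1_starD(1)[OF \<eta>(1)] \<eta>(2)])
    then have "am_inf \<eta> \<in> l1_star" using stableD(1)[OF stJ] amJ \<eta>(1) by blast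
    then show False using \<eta>(3) l1_starD(2) by blast
  qed
  then have \<xi>1: "\<xi> \<in> l1_star" using \<xi> by (simp add: l1_star_def)
  define \<mu> where "\<mu> = am_inf \<xi>"
  have \<mu>: "\<mu> \<in> c0_star" unfolding \<mu>_def by (rule am_inf_c0_star[OF \<xi>1])
  have n\<mu>: "real (Suc n) * \<mu> n = seq_tail \<xi> (Suc n)" for n by (simp add: \<mu>_def am_inf_eq del: of_nat_Suc)
  have \<mu>J: "\<mu> \<in> J" unfolding \<mu>_def by (rule amJ[OF \<xi>S \<xi>1])
  \<comment> \<open>If \<mu> 0 = 0 then \<mu> vanishes and generates only the trivial set, for which
    eventual domination does not give membership; hence the case distinction.\<close>
  have "\<mu> \<in> S"
  proof (cases "\<mu> 0 = 0")
    case True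
    have "\<mu> = (\<lambda>_. 0)" using c0_starD(5)[OF \<mu>] True by (intro ext) simp
    then show ?thesis using calkin_setD(2)[OF SC] by simp
  next
    case False
    have dec: "decseq (\<lambda>n. real (Suc n) * \<mu> n)"
      unfolding n\<mu> decseq_def using seq_tail_antimono[OF \<xi>1] by simp
    have \<mu>1: "\<mu> \<in> l1_star" and am\<mu>: "am_inf \<mu> \<in> post_set S"
      using stableD[OF stJ \<mu>J] by (simp_all add: J_def)
    obtain \<zeta> C N where \<zeta>: "\<zeta> \<in> S" "\<zeta> \<in> l1_star" "0 \<le> C" "\<And>n. n \<ge> N \<Longrightarrow> am_inf \<mu> n \<le> C * am_inf \<zeta> n"
      using am\<mu> by (rule post_setE) blast
    obtain m D where m: "0 < m" "0 \<le> D" "\<And>n. \<zeta> n \<le> D * \<xi> (n div m)"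
      by (rule principal_setE[OF \<xi> \<zeta>(1)[unfolded S_def]]) blast
    have "(\<lambda>n. \<mu> (n div (2 * m))) \<in> principal_set \<mu>"
      by (rule calkin_setD(5)[OF calkin_set_principal[OF \<mu>] generator_mem[OF \<mu>]]) (use m(1) in simp)
    then have "am_inf \<mu> \<in> principal_set \<mu>"
    proof (rule eventually_dominated_mem[OF nontrivial_principal[OF \<mu> False] _ am_inf_c0_star[OF \<mu>1]])
      fix n assume n: "max N m \<le> n"
      have "am_inf \<mu> n \<le> C * am_inf \<zeta> n" using n by (intro \<zeta>(4)) simp
      also have "\<dots> \<le> C * (D * am_inf (\<lambda>n. \<xi> (n div m)) n)"
        by (intro mult_left_mono \<zeta>(3) am_inf_mono[OF l1_star_ampliation[OF \<xi>1 m(1)] \<zeta>(2) m(3)])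
      also have "\<dots> \<le> C * (D * \<mu> (n div (2 * m)))"
        unfolding \<mu>_def using n by (intro mult_left_mono \<zeta>(3) m(2) am_inf_ampliation_le[OF \<xi>1 m(1)]) simp
      finally show "am_inf \<mu> n \<le> C * D * \<mu> (n div (2 * m))" by (simp add: mult.assoc)
    qed
    then obtain K :: nat where K: "0 < K" "\<And>n. seq_tail \<xi> (Suc (K * Suc n)) \<le> seq_tail \<xi> (Suc n) / 2"
      by (rule stable_imp_decay[OF \<mu>1 dec, unfolded n\<mu>]) blast
    have "\<mu> n \<le> (2 * real K) * \<xi> n" for n
    proof -
      have "Suc n \<le> Suc (K * Suc n)" using K(1) by (cases K) auto
      then have "seq_tail \<xi> (Suc n) = (\<Sum>j=Suc n..<Suc (K * Suc n). \<xi> j) + seq_tail \<xi> (Suc (K * Suc n))"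
        by (rule seq_tail_split[OF \<xi>1])
      then have "seq_tail \<xi> (Suc n) / 2 \<le> (\<Sum>j=Suc n..<Suc (K * Suc n). \<xi> j)" using K(2)[of n] by simp
      also have "\<dots> \<le> (\<Sum>j=Suc n..<Suc (K * Suc n). \<xi> n)"
        by (intro sum_mono c0_star_antimono[OF \<xi>]) auto
      also have "\<dots> = real (K * Suc n - n) * \<xi> n" by simp
      also have "\<dots> \<le> real (K * Suc n) * \<xi> n"
        by (intro mult_right_mono c0_starD(1)[OF \<xi>] of_nat_mono diff_le_self)
      finally have "real (Suc n) * \<mu> n \<le> real (Suc n) * ((2 * real K) * \<xi> n)"
        unfolding n\<mu> by (simp add: field_simps)
      then show ?thesis by (rule mult_left_le_imp_le) simp
    qed
    then show ?thesis by (rule calkin_set_dominated[OF SC \<xi>S \<mu>])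
  qed
  then have "\<xi> \<in> pre_set S" using \<xi>1 by (simp add: pre_set_def \<mu>_def)
  from principal_eqI[OF nontrivial_pre_set[OF S] this] pre_set_subset[OF S] show ?thesis
    by (simp add: S_def)
qed

text \<open>If \<open>am_inf \<eta>\<close> were not in the principal set, a weighted sum of the sequences that are constant
  equal to \<open>am_inf \<eta> (m k)\<close> up to \<open>m k\<close> would be majorised at infinity by a multiple of \<open>\<eta>\<close> and
  yet escape the principal set.\<close>

lemma closed_subset_pre_set:
  assumes T: "nontrivial_calkin_set T" "T = pre_set (post_set T)" "T \<subseteq> principal_set \<xi>"
  shows "T \<subseteq> pre_set (principal_set \<xi>)"
proof
  fix \<eta> assume \<eta>T: "\<eta> \<in> T"
  then have \<eta>: "\<eta> \<in> l1_star" using T(2) pre_set_subset_l1 by blast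
  note am = am_inf_c0_star[OF \<eta>]
  have "am_inf \<eta> \<in> principal_set \<xi>"
  proof (rule ccontr)
    assume not: "am_inf \<eta> \<notin> principal_set \<xi>"
    \<comment> \<open>Constant and ampliation grow together, so that every pair of them is
      eventually beaten. Of the factor 4^k, one 2^k pays for the summable weights in c, and the
      other exceeds any constant C.\<close>
    have "\<exists>n. 4 ^ k * \<xi> (n div Suc k) < am_inf \<eta> n" for k
    proof (rule ccontr)
      assume "\<nexists>n. 4 ^ k * \<xi> (n div Suc k) < am_inf \<eta> n"
      then have "am_inf \<eta> n \<le> 4 ^ k * \<xi> (n div Suc k)" for n by (simp add: not_less)
      then show False using not principal_setI[OF \<xi> am, of "Suc k"] by blast
    qed
    then have "\<forall>k. \<exists>n. 4 ^ k * \<xi> (n div Suc k) < am_inf \<eta> n" by blast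
    from choice[OF this] obtain m where m: "\<And>k. 4 ^ k * \<xi> (m k div Suc k) < am_inf \<eta> (m k)" by blast
    have pos: "0 < am_inf \<eta> (m k)" for k
      by (rule le_less_trans[OF mult_nonneg_nonneg m]) (simp_all add: c0_starD(1)[OF \<xi>])
    define c where "c k = (1 / 2) ^ k * am_inf \<eta> (m k)" for k
    have c0: "0 \<le> c k" for k using pos[of k] by (simp add: c_def)
    have geo: "summable (\<lambda>k. (1 / 2 :: real) ^ k)" by (rule summable_geometric) simp
    have geo2: "(\<Sum>k. (1 / 2 :: real) ^ k) = 2" using suminf_geometric[of "1 / 2 :: real"] by simp
    have sc: "summable c"
    proof (rule summable_comparison_test'[OF summable_mult2[OF geo, of "am_inf \<eta> 0"], of 0])
      fix k
      have "c k \<le> (1 / 2) ^ k * am_inf \<eta> 0"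
        unfolding c_def by (intro mult_left_mono c0_star_antimono[OF am]) auto
      then show "norm (c k) \<le> (1 / 2) ^ k * am_inf \<eta> 0" using c0[of k] by simp
    qed
    have sc': "summable (\<lambda>k. if n \<le> m k then c k else 0)" for n
      by (rule summable_comparison_test'[OF sc, of 0]) (use c0 in auto)
    define \<zeta> where "\<zeta> n = (\<Sum>k. if n \<le> m k then c k else 0)" for n
    have \<zeta>0: "0 \<le> \<zeta> n" for n unfolding \<zeta>_def by (rule suminf_nonneg[OF sc']) (use c0 in auto)
    have \<zeta>dec: "\<zeta> (Suc n) \<le> \<zeta> n" for n
      unfolding \<zeta>_def by (rule suminf_le[OF _ sc' sc']) (use c0 in auto)
    have \<zeta>ge: "c k \<le> \<zeta> (m k)" for k
      using sum_le_suminf[OF sc', of "{k}" "m k"] c0 by (simp add: \<zeta>_def)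
    \<comment> \<open>The k-th block contributes at most (m k + 1) c k, its weight times the tail of
      \<eta> at m k + 1, and it contributes only if a < m k, when that tail is at most the one at a
      + 1. The weights add up to 2.\<close>
    have part: "(\<Sum>j<N. \<zeta> (j + Suc a)) \<le> 2 * seq_tail \<eta> (Suc a)" for N a
    proof -
      have inner: "(\<Sum>j<N. if j + Suc a \<le> m k then c k else 0) \<le> (1 / 2) ^ k * seq_tail \<eta> (Suc a)" for k
      proof (cases "a \<le> m k")
        case True
        have "(\<Sum>j<N. if j + Suc a \<le> m k then c k else 0) = (\<Sum>j\<in>{j \<in> {..<N}. j + Suc a \<le> m k}. c k)"
          by (rule sum.inter_filter[symmetric]) simp
        also have "\<dots> \<le> (\<Sum>j\<in>{..<Suc (m k)}. c k)" using c0 by (intro sum_mono2) auto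
        also have "\<dots> = (1 / 2) ^ k * seq_tail \<eta> (Suc (m k))"
          by (simp add: c_def am_inf_eq del: of_nat_Suc)
        also have "\<dots> \<le> (1 / 2) ^ k * seq_tail \<eta> (Suc a)"
          using True by (intro mult_left_mono seq_tail_antimono[OF \<eta>]) auto
        finally show ?thesis .
      next
        case False
        then have "(\<Sum>j<N. if j + Suc a \<le> m k then c k else 0) = 0" by (intro sum.neutral) auto
        then show ?thesis using seq_tail_nonneg[OF \<eta>] by simp
      qed
      have "(\<Sum>j<N. \<zeta> (j + Suc a)) = (\<Sum>k. \<Sum>j<N. if j + Suc a \<le> m k then c k else 0)"
        unfolding \<zeta>_def by (rule suminf_sum[symmetric]) (rule sc')
      also have "\<dots> \<le> (\<Sum>k. (1 / 2) ^ k * seq_tail \<eta> (Suc a))"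
        by (intro suminf_le inner summable_sum sc' summable_mult2 geo)
      also have "\<dots> = 2 * seq_tail \<eta> (Suc a)" using suminf_mult2[OF geo] geo2 by simp
      finally show ?thesis .
    qed
    have "summable (\<lambda>j. \<zeta> (j + Suc 0))"
      using \<zeta>0 part[where a = 0] by (rule summableI_nonneg_bounded)
    then have sz: "summable \<zeta>" by (rule summable_iff_shift[THEN iffD1])
    have \<zeta>1: "\<zeta> \<in> l1_star"
      using sz c0_starI[OF \<zeta>0 \<zeta>dec summable_LIMSEQ_zero[OF sz]] by (simp add: l1_star_def)
    have "am_inf \<zeta> n \<le> 2 * am_inf \<eta> n" for n
    proof -
      have "seq_tail \<zeta> (Suc n) \<le> 2 * seq_tail \<eta> (Suc n)"
        unfolding seq_tail_def[of \<zeta>]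
        by (rule suminf_le_const[OF summable_ignore_initial_segment[OF sz]]) (rule part)
      then have "seq_tail \<zeta> (Suc n) / real (Suc n) \<le> 2 * seq_tail \<eta> (Suc n) / real (Suc n)"
        by (rule divide_right_mono) simp
      then show ?thesis by (simp add: am_inf_eq del: of_nat_Suc)
    qed
    then have "am_inf \<zeta> \<in> post_set T" by (intro post_setI[OF am_inf_c0_star[OF \<zeta>1] \<eta>T \<eta>, of 0])
    then have "\<zeta> \<in> pre_set (post_set T)" using \<zeta>1 by (simp add: pre_set_def)
    then have "\<zeta> \<in> principal_set \<xi>" using T(2,3) by blast
    then obtain q C where q: "0 < q" "0 \<le> C" "\<And>n. \<zeta> n \<le> C * \<xi> (n div q)"
      by (rule principal_setE[OF \<xi>]) blast
    obtain k0 where k0: "C < 2 ^ k0" using real_arch_pow[of 2 C] by auto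
    define k where "k = max k0 q"
    have Ck: "C < 2 ^ k"
      using k0 by (rule less_le_trans) (simp add: k_def power_increasing)
    have "c k \<le> C * \<xi> (m k div q)" using \<zeta>ge[of k] q(3)[of "m k"] by (rule order_trans)
    also have "\<dots> \<le> C * \<xi> (m k div Suc k)"
      using q(1) by (intro mult_left_mono ampliation_mono[OF \<xi>] q(2)) (simp_all add: k_def)
    finally have "4 ^ k * c k \<le> C * (4 ^ k * \<xi> (m k div Suc k))" by simp
    also have "\<dots> \<le> C * am_inf \<eta> (m k)" using m[of k] by (intro mult_left_mono q(2)) simp
    also have "4 ^ k * c k = 2 ^ k * am_inf \<eta> (m k)"
      by (simp add: c_def power_mult_distrib[symmetric] mult.assoc[symmetric])
    finally show False using Ck pos[of k] by simp
  qed
  then show "\<eta> \<in> pre_set (principal_set \<xi>)" using \<eta> by (simp add: pre_set_def)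
qed

end

section \<open>The smallest open set above the o-harmonic part\<close>

definition o_harmonic :: "(nat \<Rightarrow> real) set" where
  "o_harmonic = {\<xi> \<in> c0_star. \<xi> \<in> o(harmonic)}"

lemma o_harmonic_iff:
  "\<xi> \<in> o_harmonic \<longleftrightarrow> \<xi> \<in> c0_star \<and> (\<lambda>n. real (Suc n) * \<xi> n) \<longlonglongrightarrow> 0"
proof -
  have "harmonic n \<noteq> 0" for n by (simp add: harmonic_def)
  then have "\<xi> \<in> o(harmonic) \<longleftrightarrow> (\<lambda>n. \<xi> n / harmonic n) \<longlonglongrightarrow> 0"
    using smalloI_tendsto[of \<xi> harmonic sequentially] smalloD_tendsto[of \<xi> sequentially harmonic] by auto
  then show ?thesis by (simp add: o_harmonic_def harmonic_def mult.commute)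
qed

lemma o_harmonic_dominated:
  assumes "\<xi> \<in> o_harmonic" "\<eta> \<in> c0_star" "0 < m" "\<And>n. \<eta> n \<le> C * \<xi> (n div m)" "0 \<le> C"
  shows "\<eta> \<in> o_harmonic"
proof -
  have \<xi>: "\<xi> \<in> c0_star" "(\<lambda>n. real (Suc n) * \<xi> n) \<longlonglongrightarrow> 0" using assms(1) by (simp_all add: o_harmonic_iff)
  have "(\<lambda>n. real (Suc (n div m)) * \<xi> (n div m)) \<longlonglongrightarrow> 0"
    by (rule filterlim_compose[OF \<xi>(2) filterlim_div_at_top[OF assms(3)]])
  then have lim: "(\<lambda>n. C * real m * (real (Suc (n div m)) * \<xi> (n div m))) \<longlonglongrightarrow> 0"
    by (rule tendsto_mult_right_zero)
  have le: "real (Suc n) * \<eta> n \<le> C * real m * (real (Suc (n div m)) * \<xi> (n div m))" for n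
  proof -
    have "real (Suc n) * \<eta> n \<le> (real m * real (Suc (n div m))) * (C * \<xi> (n div m))"
      by (rule mult_mono[OF Suc_le_mult_Suc_div[OF assms(3)] assms(4)]) (simp_all add: c0_starD(1)[OF assms(2)])
    also have "\<dots> = C * real m * (real (Suc (n div m)) * \<xi> (n div m))" by (simp only: mult_ac)
    finally show ?thesis .
  qed
  have "(\<lambda>n. real (Suc n) * \<eta> n) \<longlonglongrightarrow> 0"
  proof (rule tendsto_sandwich[OF _ _ tendsto_const lim])
    show "\<forall>\<^sub>F n in sequentially. 0 \<le> real (Suc n) * \<eta> n"
      by (intro always_eventually allI mult_nonneg_nonneg c0_starD(1)[OF assms(2)] of_nat_0_le_iff)
    show "\<forall>\<^sub>F n in sequentially. real (Suc n) * \<eta> n \<le> C * real m * (real (Suc (n div m)) * \<xi> (n div m))"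
      by (intro always_eventually allI le)
  qed
  then show ?thesis using assms(2) by (simp add: o_harmonic_iff)
qed

lemma calkin_set_o_harmonic: "calkin_set o_harmonic"
  unfolding calkin_set_def
proof (intro conjI ballI allI impI)
  show "o_harmonic \<subseteq> c0_star" by (auto simp: o_harmonic_def)
  show "(\<lambda>_. 0) \<in> o_harmonic" using l1_starD(1)[OF zero_in_l1_star] by (simp add: o_harmonic_iff)
  fix \<xi> assume \<xi>: "\<xi> \<in> o_harmonic"
  then have c: "\<xi> \<in> c0_star" by (simp add: o_harmonic_iff)
  show "(\<lambda>n. \<xi> n + \<eta> n) \<in> o_harmonic" if "\<eta> \<in> o_harmonic" for \<eta>
    using \<xi> that tendsto_add[of "\<lambda>n. real (Suc n) * \<xi> n" 0 sequentially "\<lambda>n. real (Suc n) * \<eta> n" 0]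
    by (simp add: o_harmonic_iff c0_star_add distrib_left del: of_nat_Suc)
  show "\<eta> \<in> o_harmonic" if "\<eta> \<in> c0_star" "\<forall>n. \<eta> n \<le> \<xi> n" for \<eta>
    by (rule o_harmonic_dominated[OF \<xi> that(1), of 1 1]) (use that in simp_all)
  show "(\<lambda>n. \<xi> (n div m)) \<in> o_harmonic" if "0 < m" for m
    by (rule o_harmonic_dominated[OF \<xi> c0_star_ampliation[OF c that] that, of 1]) simp_all
qed

text \<open>(n + 1) times the mean is a tail and tends to 0; \<open>pre_set_subset\<close> for
  \<open>o_harmonic\<close> transfers this from the mean to the sequence.\<close>

lemma l1_subset_o_harmonic: "l1_star \<subseteq> o_harmonic"
proof
  fix \<xi> assume \<xi>: "\<xi> \<in> l1_star"
  have "(\<lambda>n. real (Suc n) * am_inf \<xi> n) \<longlonglongrightarrow> 0"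
    using LIMSEQ_Suc[OF seq_tail_tendsto_0[OF \<xi>]] by (simp add: am_inf_eq del: of_nat_Suc)
  then have "am_inf \<xi> \<in> o_harmonic" using am_inf_c0_star[OF \<xi>] by (simp add: o_harmonic_iff)
  have "unit_seq \<in> o_harmonic"
  proof -
    have "(\<lambda>n. real (Suc n) * unit_seq n) \<longlonglongrightarrow> 0"
      by (rule tendsto_eventually, rule eventually_sequentiallyI[of 1]) (simp add: unit_seq_def)
    then show ?thesis using l1_starD(1)[OF unit_seq_l1] by (simp add: o_harmonic_iff)
  qed
  then have "nontrivial_calkin_set o_harmonic"
    using nontrivial_calkin_setI[OF calkin_set_o_harmonic, of unit_seq] by (simp add: unit_seq_def)
  then have "pre_set o_harmonic \<subseteq> o_harmonic" by (rule pre_set_subset)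
  moreover have "\<xi> \<in> pre_set o_harmonic" using \<xi> \<open>am_inf \<xi> \<in> o_harmonic\<close> by (simp add: pre_set_def)
  ultimately show "\<xi> \<in> o_harmonic" by blast
qed

text \<open>The numerator is the least nonincreasing majorant of (k + 1) \<eta> k, finite for \<eta>
  in \<open>o_harmonic\<close>. It matters because (n + 1) times a mean at infinity is a tail, hence
  nonincreasing: a mean dominating \<eta> dominates this as well.\<close>

definition upper_env :: "(nat \<Rightarrow> real) \<Rightarrow> nat \<Rightarrow> real" where
  "upper_env \<eta> n = (SUP k\<in>{n..}. real (Suc k) * \<eta> k) / real (Suc n)"

context
  fixes \<eta> assumes \<eta>: "\<eta> \<in> o_harmonic"
begin

lemma upper_env_ge:
  assumes "n \<le> k" shows "real (Suc k) * \<eta> k \<le> real (Suc n) * upper_env \<eta> n"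
proof -
  have "Bseq (\<lambda>k. real (Suc k) * \<eta> k)"
    using \<eta> by (intro convergent_imp_Bseq) (auto simp: o_harmonic_iff convergent_def)
  then obtain B where "\<And>k. norm (real (Suc k) * \<eta> k) \<le> B" by (auto simp: Bseq_def)
  then have "bdd_above ((\<lambda>k. real (Suc k) * \<eta> k) ` {n..})"
    by (intro bdd_aboveI2[of _ _ B]) (simp add: abs_le_iff del: of_nat_Suc)
  then have "real (Suc k) * \<eta> k \<le> (SUP k\<in>{n..}. real (Suc k) * \<eta> k)"
    using assms by (intro cSUP_upper) auto
  then show ?thesis by (simp add: upper_env_def del: of_nat_Suc)
qed

lemma upper_env_le:
  assumes "\<And>k. n \<le> k \<Longrightarrow> real (Suc k) * \<eta> k \<le> B" shows "real (Suc n) * upper_env \<eta> n \<le> B"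
proof -
  have "(SUP k\<in>{n..}. real (Suc k) * \<eta> k) \<le> B" by (rule cSUP_least) (use assms in auto)
  then show ?thesis by (simp add: upper_env_def del: of_nat_Suc)
qed

lemma le_upper_env: "\<eta> n \<le> upper_env \<eta> n"
  by (rule mult_left_le_imp_le[OF upper_env_ge[OF order_refl]]) simp

lemma upper_env_decseq: "decseq (\<lambda>n. real (Suc n) * upper_env \<eta> n)"
  unfolding decseq_Suc_iff by (intro allI upper_env_le upper_env_ge) simp

lemma upper_env_lim: "(\<lambda>n. real (Suc n) * upper_env \<eta> n) \<longlonglongrightarrow> 0"
proof (rule LIMSEQ_I)
  fix r :: real assume r: "0 < r"
  have "(\<lambda>n. real (Suc n) * \<eta> n) \<longlonglongrightarrow> 0" using \<eta> by (simp add: o_harmonic_iff)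
  from order_tendstoD(2)[OF this half_gt_zero[OF r]]
  obtain N where N: "\<And>n. n \<ge> N \<Longrightarrow> real (Suc n) * \<eta> n < r / 2" by (auto simp: eventually_sequentially)
  have "norm (real (Suc n) * upper_env \<eta> n - 0) < r" if "N \<le> n" for n
  proof -
    have "real (Suc n) * upper_env \<eta> n \<le> r / 2"
      by (rule upper_env_le) (use N that in \<open>force intro: less_imp_le\<close>)
    moreover have "0 \<le> real (Suc n) * upper_env \<eta> n"
      using upper_env_ge[OF order_refl, of n] c0_starD(1)[of \<eta> n] \<eta>
      by (intro order_trans[OF _ upper_env_ge[OF order_refl]] mult_nonneg_nonneg) (simp_all add: o_harmonic_iff)
    ultimately show ?thesis using r by simp
  qed
  then show "\<exists>no. \<forall>n\<ge>no. norm (real (Suc n) * upper_env \<eta> n - 0) < r" by blast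
qed

lemma upper_env_c0_star: "upper_env \<eta> \<in> c0_star"
proof -
  have \<eta>c: "\<eta> \<in> c0_star" using \<eta> by (simp add: o_harmonic_iff)
  have nn: "0 \<le> upper_env \<eta> n" for n using c0_starD(1)[OF \<eta>c] le_upper_env by (rule order_trans)
  show ?thesis
  proof (rule c0_starI[OF nn])
    show "upper_env \<eta> (Suc n) \<le> upper_env \<eta> n" for n
    proof -
      have "real (Suc n) * upper_env \<eta> (Suc n) \<le> real (Suc (Suc n)) * upper_env \<eta> (Suc n)"
        using nn by (intro mult_right_mono) auto
      also have "\<dots> \<le> real (Suc n) * upper_env \<eta> n" using decseq_SucD[OF upper_env_decseq] .
      finally show ?thesis by (rule mult_left_le_imp_le) simp
    qed
    have "upper_env \<eta> n \<le> real (Suc n) * upper_env \<eta> n" for n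
      using nn[of n] by (simp add: algebra_simps)
    then show "upper_env \<eta> \<longlonglongrightarrow> 0"
      using nn by (intro tendsto_sandwich[OF _ _ tendsto_const upper_env_lim]) simp_all
  qed
qed

end

lemma upper_env_dominated:
  assumes \<xi>: "\<xi> \<in> o_harmonic" and \<eta>: "\<eta> \<in> o_harmonic" and m: "0 < m" and C: "0 \<le> C" "\<And>n. \<eta> n \<le> C * \<xi> (n div m)"
  shows "upper_env \<eta> n \<le> C * real m * upper_env \<xi> (n div m)"
proof -
  note nn = c0_starD(1)[OF upper_env_c0_star[OF \<xi>]]
  have \<xi>c: "\<xi> \<in> c0_star" using \<xi> by (simp add: o_harmonic_iff)
  have "real (Suc n) * upper_env \<eta> n \<le> C * real m * (real (Suc (n div m)) * upper_env \<xi> (n div m))"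
  proof (rule upper_env_le[OF \<eta>])
    fix k assume "n \<le> k"
    have "real (Suc k) * \<eta> k \<le> (real m * real (Suc (k div m))) * (C * \<xi> (k div m))"
      using \<eta> by (intro mult_mono[OF Suc_le_mult_Suc_div[OF m] C(2)]) (simp_all add: o_harmonic_iff c0_starD(1))
    also have "\<dots> = C * real m * (real (Suc (k div m)) * \<xi> (k div m))" by (simp add: mult_ac)
    also have "\<dots> \<le> C * real m * (real (Suc (n div m)) * upper_env \<xi> (n div m))"
      using \<open>n \<le> k\<close> C(1) by (intro mult_left_mono upper_env_ge[OF \<xi>] div_le_mono) simp_all
    finally show "real (Suc k) * \<eta> k \<le> C * real m * (real (Suc (n div m)) * upper_env \<xi> (n div m))" .
  qed
  also have "\<dots> \<le> C * real m * (real (Suc n) * upper_env \<xi> (n div m))"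
    using C(1) nn by (intro mult_left_mono mult_right_mono) (simp_all add: div_le_dividend)
  finally have "real (Suc n) * upper_env \<eta> n \<le> real (Suc n) * (C * real m * upper_env \<xi> (n div m))"
    by (simp only: mult_ac)
  then show ?thesis by (rule mult_left_le_imp_le) simp
qed

lemma upper_env_ampliation:
  assumes \<eta>: "\<eta> \<in> o_harmonic" and m: "0 < m" and \<eta>m: "(\<lambda>n. \<eta> (n div m)) \<in> o_harmonic"
  shows "upper_env \<eta> (n div m) \<le> upper_env (\<lambda>n. \<eta> (n div m)) n"
proof -
  define q where "q = n div m"
  note nn = c0_starD(1)[OF upper_env_c0_star[OF \<eta>m]]
  have "real (Suc q) * upper_env \<eta> q \<le> real (Suc q) * upper_env (\<lambda>n. \<eta> (n div m)) n"
  proof (rule upper_env_le[OF \<eta>])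
    fix j assume "q \<le> j"
    \<comment> \<open>The last index of the j-th block, so that Suc k is exactly (j + 1) m.\<close>
    define k where "k = j * m + (m - 1)"
    have kj: "k div m = j" using m by (intro div_nat_eqI) (simp_all add: k_def mult.commute)
    have Sk: "real (Suc k) = real (Suc j) * real m"
    proof -
      have "Suc k = Suc j * m" using m by (simp add: k_def)
      then show ?thesis by (simp only: of_nat_mult)
    qed
    have "n \<le> k"
    proof -
      have "n < Suc q * m" using dividend_less_div_times[OF m, of n] by (simp add: q_def)
      also have "\<dots> \<le> Suc j * m" using \<open>q \<le> j\<close> by (intro mult_le_mono1) simp
      finally show ?thesis using m by (simp add: k_def)
    qed
    from upper_env_ge[OF \<eta>m this]
    have "real (Suc k) * \<eta> j \<le> real (Suc n) * upper_env (\<lambda>n. \<eta> (n div m)) n" by (simp only: kj)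
    also have "\<dots> \<le> (real m * real (Suc q)) * upper_env (\<lambda>n. \<eta> (n div m)) n"
      unfolding q_def by (intro mult_right_mono Suc_le_mult_Suc_div m nn)
    finally have "real m * (real (Suc j) * \<eta> j) \<le> real m * (real (Suc q) * upper_env (\<lambda>n. \<eta> (n div m)) n)"
      unfolding Sk by (simp only: mult_ac)
    then show "real (Suc j) * \<eta> j \<le> real (Suc q) * upper_env (\<lambda>n. \<eta> (n div m)) n"
      by (rule mult_left_le_imp_le) (use m in simp)
  qed
  then show ?thesis unfolding q_def by (rule mult_left_le_imp_le) simp
qed

text \<open>Explicit candidate for the LEAST in \<open>smallest_open_above\<close>.\<close>

definition open_hull :: "(nat \<Rightarrow> real) set \<Rightarrow> (nat \<Rightarrow> real) set" where
  "open_hull S = {\<zeta> \<in> c0_star. \<exists>\<eta>\<in>S \<inter> o_harmonic. \<exists>C\<ge>0. \<exists>N. \<forall>n\<ge>N. \<zeta> n \<le> C * upper_env \<eta> n}"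

lemma open_hullI:
  assumes "\<zeta> \<in> c0_star" "\<eta> \<in> S" "\<eta> \<in> o_harmonic" "0 \<le> C" "\<And>n. n \<ge> N \<Longrightarrow> \<zeta> n \<le> C * upper_env \<eta> n"
  shows "\<zeta> \<in> open_hull S"
  unfolding open_hull_def
  by (intro CollectI conjI bexI[of _ \<eta>] exI[of _ C] exI[of _ N] allI impI assms IntI)

lemma open_hullE:
  assumes "\<zeta> \<in> open_hull S"
  obtains \<eta> C N where "\<zeta> \<in> c0_star" "\<eta> \<in> S" "\<eta> \<in> o_harmonic" "0 \<le> C" "\<And>n. n \<ge> N \<Longrightarrow> \<zeta> n \<le> C * upper_env \<eta> n"
  using assms unfolding open_hull_def by blast

context
  fixes S assumes S: "nontrivial_calkin_set S"
begin

lemma subset_open_hull: "S \<inter> o_harmonic \<subseteq> open_hull S"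
proof
  fix \<eta> assume "\<eta> \<in> S \<inter> o_harmonic"
  then have *: "\<eta> \<in> S" "\<eta> \<in> o_harmonic" by auto
  then have "\<eta> \<in> c0_star" by (simp add: o_harmonic_iff)
  then show "\<eta> \<in> open_hull S"
    using * by (rule open_hullI[of _ _ _ 1 0]) (simp_all add: le_upper_env *)
qed

lemma nontrivial_open_hull: "nontrivial_calkin_set (open_hull S)"
proof -
  note C = calkin_set_of_nontrivial[OF S]
  have "calkin_set (open_hull S)"
    unfolding calkin_set_def
  proof (intro conjI ballI allI impI)
    show "open_hull S \<subseteq> c0_star" by (auto simp: open_hull_def)
    show "(\<lambda>_. 0) \<in> open_hull S"
      using subset_open_hull calkin_setD(2)[OF C] calkin_setD(2)[OF calkin_set_o_harmonic] by blast
    fix \<xi> assume "\<xi> \<in> open_hull S"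
    then obtain a A M where a: "\<xi> \<in> c0_star" "a \<in> S" "a \<in> o_harmonic" "0 \<le> A" "\<And>n. n \<ge> M \<Longrightarrow> \<xi> n \<le> A * upper_env a n"
      by (rule open_hullE) blast
    show "(\<lambda>n. \<xi> n + \<eta> n) \<in> open_hull S" if \<eta>: "\<eta> \<in> open_hull S" for \<eta>
    proof -
      obtain b B N where b: "\<eta> \<in> c0_star" "b \<in> S" "b \<in> o_harmonic" "0 \<le> B" "\<And>n. n \<ge> N \<Longrightarrow> \<eta> n \<le> B * upper_env b n"
        using \<eta> by (rule open_hullE) blast
      have s: "(\<lambda>n. a n + b n) \<in> o_harmonic" by (rule calkin_setD(3)[OF calkin_set_o_harmonic a(3) b(3)])
      have ac: "0 \<le> a n" "0 \<le> b n" for n using a(3) b(3) by (simp_all add: o_harmonic_iff c0_starD(1))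
      have ua: "upper_env a n \<le> upper_env (\<lambda>n. a n + b n) n" "upper_env b n \<le> upper_env (\<lambda>n. a n + b n) n" for n
        using upper_env_dominated[OF s a(3), of 1 1 n] upper_env_dominated[OF s b(3), of 1 1 n] ac by simp_all
      show ?thesis
      proof (rule open_hullI[OF c0_star_add[OF a(1) b(1)] calkin_setD(3)[OF C a(2) b(2)] s, of "A + B" "max M N"])
        show "0 \<le> A + B" using a(4) b(4) by simp
        fix n assume n: "max M N \<le> n"
        have "\<xi> n \<le> A * upper_env (\<lambda>n. a n + b n) n"
          using n a(4) ua(1) by (intro order_trans[OF a(5)] mult_left_mono) simp_all
        moreover have "\<eta> n \<le> B * upper_env (\<lambda>n. a n + b n) n"
          using n b(4) ua(2) by (intro order_trans[OF b(5)] mult_left_mono) simp_all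
        ultimately show "\<xi> n + \<eta> n \<le> (A + B) * upper_env (\<lambda>n. a n + b n) n" by (simp add: distrib_right)
      qed
    qed
    show "\<eta> \<in> open_hull S" if "\<eta> \<in> c0_star" "\<forall>n. \<eta> n \<le> \<xi> n" for \<eta>
      by (rule open_hullI[OF that(1) a(2-4) order_trans[OF spec[OF that(2)] a(5)]])
    show "(\<lambda>n. \<xi> (n div m)) \<in> open_hull S" if m: "0 < m" for m
    proof -
      have am: "(\<lambda>n. a (n div m)) \<in> o_harmonic" by (rule calkin_setD(5)[OF calkin_set_o_harmonic a(3) m])
      show ?thesis
      proof (rule open_hullI[OF c0_star_ampliation[OF a(1) m] calkin_setD(5)[OF C a(2) m] am a(4), of "M * m"])
        fix n assume "M * m \<le> n"
        then have "M \<le> n div m" using m by (simp add: less_eq_div_iff_mult_less_eq)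
        then have "\<xi> (n div m) \<le> A * upper_env a (n div m)" by (rule a(5))
        also have "\<dots> \<le> A * upper_env (\<lambda>n. a (n div m)) n"
          by (intro mult_left_mono upper_env_ampliation a(3,4) m am)
        finally show "\<xi> (n div m) \<le> A * upper_env (\<lambda>n. a (n div m)) n" .
      qed
    qed
  qed
  moreover have "unit_seq \<in> open_hull S"
    by (rule open_hullI[OF l1_starD(1)[OF unit_seq_l1] calkin_setD(2)[OF C] calkin_setD(2)[OF calkin_set_o_harmonic], of 0 1])
      (simp_all add: unit_seq_def)
  ultimately show ?thesis by (rule nontrivial_calkin_setI) (simp add: unit_seq_def)
qed

text \<open>An envelope meets the hypotheses of \<open>convexification\<close>, so up to an
  ampliation by 3 it is the mean of a summable \<rho>; and \<rho> lies in the \<open>pre_set\<close>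
  because its mean is below the envelope.\<close>

lemma open_hull_open: "open_hull S = post_set (pre_set (open_hull S))"
proof
  show "post_set (pre_set (open_hull S)) \<subseteq> open_hull S" by (rule post_pre_subset[OF nontrivial_open_hull])
  note H = nontrivial_open_hull
  have PP: "nontrivial_calkin_set (post_set (pre_set (open_hull S)))"
    by (intro nontrivial_post_set nontrivial_pre_set H)
  show "open_hull S \<subseteq> post_set (pre_set (open_hull S))"
  proof
    fix \<zeta> assume "\<zeta> \<in> open_hull S"
    then obtain \<eta> C N where \<eta>: "\<zeta> \<in> c0_star" "\<eta> \<in> S" "\<eta> \<in> o_harmonic" "0 \<le> C" "\<And>n. n \<ge> N \<Longrightarrow> \<zeta> n \<le> C * upper_env \<eta> n"
      by (rule open_hullE) blast
    note ec = upper_env_c0_star[OF \<eta>(3)]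
    obtain \<rho> where \<rho>: "\<rho> \<in> l1_star" "\<And>n. am_inf \<rho> n \<le> upper_env \<eta> n" "\<And>n. 1 \<le> n \<Longrightarrow> upper_env \<eta> n \<le> am_inf \<rho> (n div 3)"
      by (rule convexification_c0_star[OF ec upper_env_decseq[OF \<eta>(3)] upper_env_lim[OF \<eta>(3)]]) blast
    have "am_inf \<rho> \<in> open_hull S"
      by (rule open_hullI[OF am_inf_c0_star[OF \<rho>(1)] \<eta>(2,3), of 1 0]) (simp_all add: \<rho>(2))
    then have "\<rho> \<in> pre_set (open_hull S)" using \<rho>(1) by (simp add: pre_set_def)
    then have "am_inf \<rho> \<in> post_set (pre_set (open_hull S))"
      using \<rho>(1) by (rule post_setI[OF am_inf_c0_star[OF \<rho>(1)], of _ _ 0 1]) simp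
    then have "(\<lambda>n. am_inf \<rho> (n div 3)) \<in> post_set (pre_set (open_hull S))"
      by (rule calkin_setD(5)[OF calkin_set_of_nontrivial[OF PP]]) simp
    then have "upper_env \<eta> \<in> post_set (pre_set (open_hull S))"
      by (rule eventually_dominated_mem[OF PP _ ec, of _ 1 1]) (simp add: \<rho>(3))
    then show "\<zeta> \<in> post_set (pre_set (open_hull S))"
      by (rule eventually_dominated_mem[OF PP _ \<eta>(1,5)])
  qed
qed

text \<open>Openness of T puts \<eta> eventually below a multiple of some \<open>am_inf a\<close> in
  T. As (k + 1) \<open>am_inf a\<close> k is a nonincreasing tail, the bound passes to the supremum
  over k \<ge> n.\<close>

lemma open_hull_least:
  assumes T: "nontrivial_calkin_set T" "T = post_set (pre_set T)" "S \<inter> o_harmonic \<subseteq> T"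
  shows "open_hull S \<subseteq> T"
proof
  fix \<zeta> assume "\<zeta> \<in> open_hull S"
  then obtain \<eta> C N where \<eta>: "\<zeta> \<in> c0_star" "\<eta> \<in> S" "\<eta> \<in> o_harmonic" "0 \<le> C" "\<And>n. n \<ge> N \<Longrightarrow> \<zeta> n \<le> C * upper_env \<eta> n"
    by (rule open_hullE) blast
  then have "\<eta> \<in> post_set (pre_set T)" using T(2,3) by blast
  then obtain a A M where a: "a \<in> pre_set T" "a \<in> l1_star" "0 \<le> A" "\<And>n. n \<ge> M \<Longrightarrow> \<eta> n \<le> A * am_inf a n"
    by (rule post_setE) blast
  have aT: "am_inf a \<in> T" using a(1) by (simp add: pre_set_def)
  have "upper_env \<eta> n \<le> A * am_inf a n" if "M \<le> n" for n
  proof -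
    have "real (Suc n) * upper_env \<eta> n \<le> A * seq_tail a (Suc n)"
    proof (rule upper_env_le[OF \<eta>(3)])
      fix k assume "n \<le> k"
      then have "real (Suc k) * \<eta> k \<le> real (Suc k) * (A * am_inf a k)"
        using that by (intro mult_left_mono a(4)) simp_all
      also have "\<dots> = A * seq_tail a (Suc k)" by (simp add: am_inf_eq del: of_nat_Suc)
      also have "\<dots> \<le> A * seq_tail a (Suc n)"
        using \<open>n \<le> k\<close> by (intro mult_left_mono a(3) seq_tail_antimono[OF a(2)]) simp
      finally show "real (Suc k) * \<eta> k \<le> A * seq_tail a (Suc n)" .
    qed
    also have "\<dots> = real (Suc n) * (A * am_inf a n)" by (simp add: am_inf_eq del: of_nat_Suc)
    finally show ?thesis by (rule mult_left_le_imp_le) simp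
  qed
  then have "upper_env \<eta> \<in> T" by (rule eventually_dominated_mem[OF T(1) aT upper_env_c0_star[OF \<eta>(3)]])
  then show "\<zeta> \<in> T" by (rule eventually_dominated_mem[OF T(1) _ \<eta>(1,5)])
qed

lemma stable_imp_open_hull_eq:
  assumes st: "S = pre_set S" shows "open_hull S = S"
proof
  have l1: "S \<subseteq> l1_star" using st pre_set_subset_l1 by blast
  then show "S \<subseteq> open_hull S" using subset_open_hull l1_subset_o_harmonic by blast
  show "open_hull S \<subseteq> S"
    by (rule open_hull_least[OF S]) (use stable_imp_post_eq[OF S st] st in auto)
qed

end

text \<open>When \<open>(n + 1) \<xi>\<close> does not tend to 0, damping \<open>min \<xi> harmonic\<close> by 1 / ln (4 + c), where c counts the
  earlier indices at which \<open>(n + 1) \<xi>\<close> is large, produces a member of \<open>o_harmonic\<close> whose upper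
  envelope still dominates a multiple of 1 / ((n + 1) ln (n + 4)).\<close>

lemma exists_nonsummable_upper_env:
  assumes \<xi>: "\<xi> \<in> c0_star" and not: "\<xi> \<notin> o_harmonic"
  obtains \<eta> where "\<eta> \<in> o_harmonic" "\<And>n. \<eta> n \<le> \<xi> n" "\<not> summable (upper_env \<eta>)"
proof -
  have nn: "0 \<le> real (Suc n) * \<xi> n" for n using c0_starD(1)[OF \<xi>] by simp
  have "\<not> (\<lambda>n. real (Suc n) * \<xi> n) \<longlonglongrightarrow> 0" using \<xi> not by (simp add: o_harmonic_iff)
  have "\<exists>c>0. \<forall>N. \<exists>n\<ge>N. c \<le> real (Suc n) * \<xi> n"
  proof (rule ccontr)
    assume a: "\<not> (\<exists>c>0. \<forall>N. \<exists>n\<ge>N. c \<le> real (Suc n) * \<xi> n)"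
    have "(\<lambda>n. real (Suc n) * \<xi> n) \<longlonglongrightarrow> 0"
    proof (rule LIMSEQ_I)
      fix r :: real assume "0 < r"
      then obtain N where "\<forall>n\<ge>N. \<not> r \<le> real (Suc n) * \<xi> n" using a by blast
      then show "\<exists>N. \<forall>n\<ge>N. norm (real (Suc n) * \<xi> n - 0) < r"
        using nn by (intro exI[of _ N]) (simp add: not_le del: of_nat_Suc)
    qed
    then show False using \<open>\<not> (\<lambda>n. real (Suc n) * \<xi> n) \<longlonglongrightarrow> 0\<close> by contradiction
  qed
  then obtain c where c: "0 < c" "\<And>N. \<exists>n\<ge>N. c \<le> real (Suc n) * \<xi> n" by blast
  define B where "B = {n. c \<le> real (Suc n) * \<xi> n}"
  define \<kappa> where "\<kappa> n = card (B \<inter> {..<n})" for n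
  define \<delta> where "\<delta> n = 1 / ln (4 + real (\<kappa> n))" for n
  \<comment> \<open>The minimum with \<xi> keeps \<eta> below \<xi>, while the one with
    \<open>harmonic\<close> bounds (n + 1) \<eta> n by \<delta> n, which tends to 0.\<close>
  define \<eta> where "\<eta> n = min (\<xi> n) (harmonic n) * \<delta> n" for n
  have infB: "infinite B"
    unfolding infinite_nat_iff_unbounded_le B_def using c(2) by simp
  have \<kappa>mono: "\<kappa> m \<le> \<kappa> n" if "m \<le> n" for m n
    unfolding \<kappa>_def using that by (intro card_mono) auto
  have \<kappa>lim: "filterlim \<kappa> at_top sequentially"
    unfolding filterlim_at_top eventually_sequentially
  proof
    fix Z
    obtain A where A: "A \<subseteq> B" "finite A" "card A = Z" using infinite_arbitrarily_large[OF infB] by blast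
    obtain N where N: "A \<subseteq> {..<N}" using finite_nat_iff_bounded A(2) by blast
    have "Z \<le> \<kappa> N" unfolding \<kappa>_def A(3)[symmetric] using A(1) N by (intro card_mono) auto
    then have "\<forall>n\<ge>N. Z \<le> \<kappa> n" using order_trans[OF _ \<kappa>mono] by simp
    then show "\<exists>N. \<forall>n\<ge>N. Z \<le> \<kappa> n" ..
  qed
  have ln1: "1 \<le> ln (4 + real k)" for k
    using exp_le by (subst ln_ge_iff) auto
  have \<delta>: "0 \<le> \<delta> n" "\<delta> n \<le> 1" for n
    using ln1[of "\<kappa> n"] by (simp_all add: \<delta>_def)
  have \<delta>dec: "\<delta> n \<le> \<delta> m" if "m \<le> n" for m n
    unfolding \<delta>_def using \<kappa>mono[OF that] ln1[of "\<kappa> m"] by (intro frac_le) auto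
  have \<delta>lim: "\<delta> \<longlonglongrightarrow> 0"
  proof -
    have "filterlim (\<lambda>n. real (\<kappa> n)) at_top sequentially"
      by (rule filterlim_compose[OF filterlim_real_sequentially \<kappa>lim])
    then have "filterlim (\<lambda>n. 4 + real (\<kappa> n)) at_top sequentially"
      by (rule filterlim_at_top_mono) simp
    then have "filterlim (\<lambda>n. ln (4 + real (\<kappa> n))) at_top sequentially"
      by (rule filterlim_compose[OF ln_at_top])
    then show ?thesis unfolding \<delta>_def using tendsto_inverse_0_at_top by (simp add: divide_inverse)
  qed
  have min0: "0 \<le> min (\<xi> n) (harmonic n)" for n
    using c0_starD(1)[OF \<xi>] c0_starD(1)[OF harmonic_c0_star] by simp
  have \<eta>0: "0 \<le> \<eta> n" for n unfolding \<eta>_def by (rule mult_nonneg_nonneg[OF min0 \<delta>(1)])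
  have \<eta>le: "\<eta> n \<le> \<xi> n" for n
    unfolding \<eta>_def using mult_left_mono[OF \<delta>(2) min0, of n n] by simp
  have \<eta>c: "\<eta> \<in> c0_star"
  proof (rule c0_starI[OF \<eta>0])
    show "\<eta> (Suc n) \<le> \<eta> n" for n
      unfolding \<eta>_def
      by (intro mult_mono min.mono c0_star_antimono[OF \<xi>] c0_star_antimono[OF harmonic_c0_star] \<delta>dec min0 \<delta>(1)) simp_all
    show "\<eta> \<longlonglongrightarrow> 0"
      by (rule tendsto_sandwich[OF _ _ tendsto_const c0_starD(3)[OF \<xi>]]) (simp_all add: \<eta>0 \<eta>le)
  qed
  have "real (Suc n) * \<eta> n \<le> \<delta> n" for n
  proof -
    have "real (Suc n) * \<eta> n \<le> real (Suc n) * (harmonic n * \<delta> n)"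
      unfolding \<eta>_def by (intro mult_left_mono mult_right_mono \<delta>(1)) simp_all
    then show ?thesis by (simp add: harmonic_def del: of_nat_Suc)
  qed
  then have "(\<lambda>n. real (Suc n) * \<eta> n) \<longlonglongrightarrow> 0"
    by (intro tendsto_sandwich[OF _ _ tendsto_const \<delta>lim]) (simp_all add: \<eta>0)
  then have \<eta>o: "\<eta> \<in> o_harmonic" using \<eta>c by (simp add: o_harmonic_iff)
  have env: "min c 1 * (1 / (real (Suc n) * ln (real n + 4))) \<le> upper_env \<eta> n" for n
  proof -
    \<comment> \<open>The first index from n on where (k + 1) \<xi> k is large. None lies between n
      and N, so \<kappa> N \<le> n and the damping at N is still at least 1 / ln (n + 4).\<close>
    define N where "N = (LEAST k. n \<le> k \<and> k \<in> B)"
    have "\<exists>k. n \<le> k \<and> k \<in> B" using c(2)[of n] by (auto simp: B_def)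
    then have N: "n \<le> N \<and> N \<in> B" unfolding N_def by (rule LeastI_ex)
    have gap: "k \<notin> B" if "n \<le> k" "k < N" for k
      using not_less_Least[of k "\<lambda>k. n \<le> k \<and> k \<in> B"] that unfolding N_def by blast
    have "B \<inter> {..<N} \<subseteq> {..<n}"
    proof
      fix k assume "k \<in> B \<inter> {..<N}"
      then show "k \<in> {..<n}" using gap[of k] by (cases "n \<le> k") auto
    qed
    from card_mono[OF _ this] have "\<kappa> N \<le> n" by (simp add: \<kappa>_def)
    then have "1 / ln (real n + 4) \<le> \<delta> N"
      unfolding \<delta>_def using ln1[of "\<kappa> N"] by (intro frac_le) auto
    moreover have "min c 1 \<le> real (Suc N) * min (\<xi> N) (harmonic N)"
    proof -
      have "real (Suc N) * harmonic N = 1" by (simp add: harmonic_def del: of_nat_Suc)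
      moreover have "c \<le> real (Suc N) * \<xi> N" using N by (simp add: B_def)
      ultimately show ?thesis by (cases "\<xi> N \<le> harmonic N") (simp_all add: min_def del: of_nat_Suc)
    qed
    moreover have "0 \<le> real (Suc N) * min (\<xi> N) (harmonic N)" using min0 by simp
    moreover have "0 \<le> 1 / ln (real n + 4)" by simp
    ultimately have "min c 1 * (1 / ln (real n + 4)) \<le> real (Suc N) * min (\<xi> N) (harmonic N) * \<delta> N"
      by (intro mult_mono)
    also have "\<dots> \<le> real (Suc n) * upper_env \<eta> n"
      using upper_env_ge[OF \<eta>o conjunct1[OF N]] by (simp only: \<eta>_def mult.assoc)
    also have "\<dots> = upper_env \<eta> n * real (Suc n)" by (rule mult.commute)
    finally have "min c 1 * (1 / ln (real n + 4)) / real (Suc n) \<le> upper_env \<eta> n"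
      by (subst pos_divide_le_eq) simp_all
    moreover have "min c 1 * (1 / (a * b)) = min c 1 * (1 / b) / a" for a b by simp
    ultimately show ?thesis by (simp only:)
  qed
  have "\<not> summable (upper_env \<eta>)"
  proof
    assume s: "summable (upper_env \<eta>)"
    have "summable (\<lambda>n. min c 1 * (1 / (real (Suc n) * ln (real n + 4))))"
      using env by (intro summable_comparison_test'[OF s, of 0]) (use c(1) in \<open>simp add: abs_mult\<close>)
    then have "summable (\<lambda>n. 1 / (real (Suc n) * ln (real n + 4)))"
      using c(1) by (subst (asm) summable_cmult_iff) auto
    then show False using not_summable_inverse_mult_ln by contradiction
  qed
  then show ?thesis by (rule that[OF \<eta>o \<eta>le])
qed

text \<open>If \<xi> were not in \<open>o_harmonic\<close>, the hull would contain a nonsummable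
  envelope, which stability forbids. Otherwise the envelope \<mu> of \<xi> generates the hull and
  decays. In the supremum for (n + 1) \<mu> n the terms with k \<ge> K (n + 1) reach only half of
  it, and the others are at most K (n + 1) \<xi> n; so \<mu> is dominated by \<xi>.\<close>

lemma stable_if_open_hull_stable:
  assumes \<xi>: "\<xi> \<in> c0_star" and \<xi>0: "\<xi> 0 \<noteq> 0"
    and st: "open_hull (principal_set \<xi>) = pre_set (open_hull (principal_set \<xi>))"
  shows "principal_set \<xi> = pre_set (principal_set \<xi>)"
proof -
  define S H where "S = principal_set \<xi>" and "H = open_hull S"
  have S: "nontrivial_calkin_set S" and \<xi>S: "\<xi> \<in> S"
    using nontrivial_principal[OF \<xi> \<xi>0] generator_mem[OF \<xi>] by (simp_all add: S_def)
  note SC = calkin_set_of_nontrivial[OF S]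
  have H: "nontrivial_calkin_set H" unfolding H_def by (rule nontrivial_open_hull[OF S])
  have stH: "H = pre_set H" using st by (simp add: H_def S_def)
  have envH: "upper_env \<eta> \<in> H" if "\<eta> \<in> S" "\<eta> \<in> o_harmonic" for \<eta>
    unfolding H_def by (rule open_hullI[OF upper_env_c0_star[OF that(2)] that, of 1 0]) simp_all
  have \<xi>o: "\<xi> \<in> o_harmonic"
  proof (rule ccontr)
    assume "\<xi> \<notin> o_harmonic"
    then obtain \<eta> where \<eta>: "\<eta> \<in> o_harmonic" "\<And>n. \<eta> n \<le> \<xi> n" "\<not> summable (upper_env \<eta>)"
      by (rule exists_nonsummable_upper_env[OF \<xi>]) blast
    have "\<eta> \<in> c0_star" using \<eta>(1) by (simp add: o_harmonic_iff)
    then have "\<eta> \<in> S" using \<eta>(2) by (rule calkin_setD(4)[OF SC \<xi>S])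
    then have "upper_env \<eta> \<in> l1_star" using stableD(1)[OF stH envH] \<eta>(1) by blast
    then show False using \<eta>(3) l1_starD(2) by blast
  qed
  define \<mu> where "\<mu> = upper_env \<xi>"
  have \<mu>: "\<mu> \<in> c0_star" unfolding \<mu>_def by (rule upper_env_c0_star[OF \<xi>o])
  have \<mu>nn: "0 \<le> \<mu> n" for n by (rule c0_starD(1)[OF \<mu>])
  have \<xi>\<mu>: "\<xi> n \<le> \<mu> n" for n unfolding \<mu>_def by (rule le_upper_env[OF \<xi>o])
  have \<mu>0: "\<mu> 0 \<noteq> 0" using \<xi>\<mu>[of 0] \<xi>0 c0_starD(1)[OF \<xi>, of 0] by simp
  have \<mu>H: "\<mu> \<in> H" unfolding \<mu>_def by (rule envH[OF \<xi>S \<xi>o])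
  \<comment> \<open>The hull of a principal set is again principal, which makes
    \<open>stable_imp_decay\<close> applicable to \<mu>.\<close>
  have HP: "H \<subseteq> principal_set \<mu>"
  proof
    fix \<zeta> assume "\<zeta> \<in> H"
    then obtain \<eta> C N where \<eta>: "\<zeta> \<in> c0_star" "\<eta> \<in> S" "\<eta> \<in> o_harmonic" "0 \<le> C" "\<And>n. n \<ge> N \<Longrightarrow> \<zeta> n \<le> C * upper_env \<eta> n"
      unfolding H_def by (rule open_hullE) blast
    obtain m D where m: "0 < m" "0 \<le> D" "\<And>n. \<eta> n \<le> D * \<xi> (n div m)"
      by (rule principal_setE[OF \<xi> \<eta>(2)[unfolded S_def]]) blast
    have "(\<lambda>n. \<mu> (n div m)) \<in> principal_set \<mu>"
      by (rule calkin_setD(5)[OF calkin_set_principal[OF \<mu>] generator_mem[OF \<mu>] m(1)])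
    then show "\<zeta> \<in> principal_set \<mu>"
    proof (rule eventually_dominated_mem[OF nontrivial_principal[OF \<mu> \<mu>0] _ \<eta>(1)])
      fix n assume "N \<le> n"
      then have "\<zeta> n \<le> C * upper_env \<eta> n" by (rule \<eta>(5))
      also have "\<dots> \<le> C * (D * real m * \<mu> (n div m))"
        unfolding \<mu>_def by (intro mult_left_mono upper_env_dominated[OF \<xi>o \<eta>(3) m] \<eta>(4))
      finally show "\<zeta> n \<le> C * (D * real m) * \<mu> (n div m)" by (simp only: mult.assoc)
    qed
  qed
  have dec: "decseq (\<lambda>n. real (Suc n) * \<mu> n)" unfolding \<mu>_def by (rule upper_env_decseq[OF \<xi>o])
  have "am_inf \<mu> \<in> principal_set \<mu>" using stableD(2)[OF stH \<mu>H] HP by blast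
  then obtain K :: nat where K: "0 < K" "\<And>n. real (Suc (K * Suc n)) * \<mu> (K * Suc n) \<le> real (Suc n) * \<mu> n / 2"
    by (rule stable_imp_decay[OF stableD(1)[OF stH \<mu>H] dec]) blast
  have "\<mu> n \<le> real K * \<xi> n" for n
  proof (rule ccontr)
    assume "\<not> \<mu> n \<le> real K * \<xi> n"
    then have less: "real K * \<xi> n < \<mu> n" by simp
    have "0 \<le> real K * \<xi> n" by (intro mult_nonneg_nonneg c0_starD(1)[OF \<xi>]) simp
    then have p: "0 < \<mu> n" using less by (rule le_less_trans)
    \<comment> \<open>The bounds for near and far k; under the contrary assumption both are strictly
      below (n + 1) \<mu> n.\<close>
    define B where "B = max (real (Suc n) * (real K * \<xi> n)) (real (Suc n) * \<mu> n / 2)"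
    have "real (Suc n) * \<mu> n \<le> B"
      unfolding \<mu>_def
    proof (rule upper_env_le[OF \<xi>o])
      fix k assume "n \<le> k"
      show "real (Suc k) * \<xi> k \<le> B"
      proof (cases "k < K * Suc n")
        case True
        then have "real (Suc k) \<le> real K * real (Suc n)"
          by (simp only: of_nat_mult[symmetric] of_nat_le_iff Suc_le_eq)
        then have "real (Suc k) * \<xi> k \<le> (real K * real (Suc n)) * \<xi> n"
          by (intro mult_mono c0_star_antimono[OF \<xi> \<open>n \<le> k\<close>] c0_starD(1)[OF \<xi>]) simp_all
        then show ?thesis unfolding B_def by (simp only: le_max_iff_disj mult_ac) simp
      next
        case False
        then have "real (Suc k) * \<xi> k \<le> real (Suc (K * Suc n)) * \<mu> (K * Suc n)"
          unfolding \<mu>_def by (intro upper_env_ge[OF \<xi>o]) simp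
        also have "\<dots> \<le> real (Suc n) * \<mu> n / 2" by (rule K(2))
        finally show ?thesis unfolding B_def by simp
      qed
    qed
    moreover have "B < real (Suc n) * \<mu> n"
      unfolding B_def using less p by (simp del: of_nat_Suc)
    ultimately show False by simp
  qed
  then have \<mu>S: "\<mu> \<in> S" by (rule calkin_set_dominated[OF SC \<xi>S \<mu>])
  have "H \<subseteq> S" using HP principal_set_subset[OF \<mu> SC \<mu>S] by blast
  moreover have "\<xi> \<in> H" using subset_open_hull[OF S] \<xi>S \<xi>o by (auto simp: H_def)
  ultimately have "S = H" using principal_eqI[OF \<xi> \<xi>0 H] by (simp add: S_def)
  then show ?thesis using stH by (simp add: S_def)
qed

section \<open>Ideals and their characteristic sets\<close>

context
  assumes inf: "\<nexists>B :: 'h::complex_hilbert set. finite B \<and> cspan B = UNIV"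
begin

lemma nontrivial_char_set_iff:
  assumes J: "op_ideal (J :: ('h \<Rightarrow>\<^sub>L 'h) set)"
  shows "nontrivial_calkin_set (char_set J) \<longleftrightarrow> J \<noteq> {0}"
  using calkin_set_char_set[OF inf J] char_set_zero_iff[OF inf J] by (auto simp: nontrivial_calkin_set_def)

text \<open>That the result is nonzero belongs to the conclusion because closure and interior apply
  two operations in succession.\<close>

lemma pre_am_inf_char:
  assumes J: "op_ideal (J :: ('h \<Rightarrow>\<^sub>L 'h) set)" "J \<noteq> {0}"
  shows "op_ideal (pre_am_inf J)" "char_set (pre_am_inf J) = pre_set (char_set J)" "pre_am_inf J \<noteq> {0}"
proof -
  have n: "nontrivial_calkin_set (pre_set (char_set J))"
    using J by (simp add: nontrivial_pre_set nontrivial_char_set_iff)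
  have "pre_am_inf J = ideal_with (pre_set (char_set J))" by (simp add: pre_am_inf_def pre_set_def)
  then show *: "op_ideal (pre_am_inf J)" "char_set (pre_am_inf J) = pre_set (char_set J)"
    using calkin_correspondence[OF inf calkin_set_of_nontrivial[OF n]] by simp_all
  show "pre_am_inf J \<noteq> {0}" using n nontrivial_char_set_iff[OF *(1)] *(2) by simp
qed

lemma char_set_Int_trace_class:
  assumes J: "op_ideal (J :: ('h \<Rightarrow>\<^sub>L 'h) set)"
  shows "char_set (J \<inter> trace_class) = char_set J \<inter> l1_star"
proof -
  have "T \<in> compact_ops" "s_numbers T \<in> c0_star" if "T \<in> J" for T
    using that op_idealD(1)[OF J] s_numbers_in_c0_star[OF inf] by blast+
  then show ?thesis by (auto simp: char_set_def trace_class_def l1_star_def)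
qed

lemma am_inf_ideal_char:
  assumes J: "op_ideal (J :: ('h \<Rightarrow>\<^sub>L 'h) set)" "J \<noteq> {0}"
  shows "op_ideal (am_inf_ideal J)" "char_set (am_inf_ideal J) = post_set (char_set J)" "am_inf_ideal J \<noteq> {0}"
proof -
  have n: "nontrivial_calkin_set (post_set (char_set J))"
    using J by (simp add: nontrivial_post_set nontrivial_char_set_iff)
  have "am_inf_ideal J = ideal_with (post_set (char_set J))"
    by (simp add: am_inf_ideal_def post_set_def char_set_Int_trace_class[OF J(1)])
  then show *: "op_ideal (am_inf_ideal J)" "char_set (am_inf_ideal J) = post_set (char_set J)"
    using calkin_correspondence[OF inf calkin_set_of_nontrivial[OF n]] by simp_all
  show "am_inf_ideal J \<noteq> {0}" using n nontrivial_char_set_iff[OF *(1)] *(2) by simp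
qed

lemma am_inf_closure_char:
  assumes J: "op_ideal (J :: ('h \<Rightarrow>\<^sub>L 'h) set)" "J \<noteq> {0}"
  shows "op_ideal (am_inf_closure J)" "char_set (am_inf_closure J) = pre_set (post_set (char_set J))"
  using pre_am_inf_char[OF am_inf_ideal_char(1,3)[OF J]] am_inf_ideal_char(2)[OF J]
  by (simp_all add: am_inf_closure_def)

lemma am_inf_interior_char:
  assumes J: "op_ideal (J :: ('h \<Rightarrow>\<^sub>L 'h) set)" "J \<noteq> {0}"
  shows "op_ideal (am_inf_interior J)" "char_set (am_inf_interior J) = post_set (pre_set (char_set J))"
  using am_inf_ideal_char[OF pre_am_inf_char(1,3)[OF J]] pre_am_inf_char(2)[OF J]
  by (simp_all add: am_inf_interior_def)

lemma am_inf_stable_iff: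
  assumes J: "op_ideal (J :: ('h \<Rightarrow>\<^sub>L 'h) set)" "J \<noteq> {0}"
  shows "am_inf_stable J \<longleftrightarrow> char_set J = pre_set (char_set J)"
  using char_set_eq_iff[OF inf J(1) pre_am_inf_char(1)[OF J]] J(1) pre_am_inf_char(2)[OF J]
  by (simp add: am_inf_stable_def)

lemma se_harmonic_char:
  "op_ideal (se_harmonic :: ('h \<Rightarrow>\<^sub>L 'h) set)" "char_set (se_harmonic :: ('h \<Rightarrow>\<^sub>L 'h) set) = o_harmonic"
proof -
  have "se_harmonic = (ideal_with o_harmonic :: ('h \<Rightarrow>\<^sub>L 'h) set)" by (simp add: se_harmonic_def o_harmonic_def)
  then show "op_ideal (se_harmonic :: ('h \<Rightarrow>\<^sub>L 'h) set)" "char_set (se_harmonic :: ('h \<Rightarrow>\<^sub>L 'h) set) = o_harmonic"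
    using calkin_correspondence[OF inf calkin_set_o_harmonic] by simp_all
qed

text \<open>\<xi> is the s-number sequence of a ring generator; minimality of the generated ideal is
  tested against the ideal \<open>ops_of (principal_set \<xi>)\<close>.\<close>

lemma principal_op_ideal_char:
  assumes I: "principal_op_ideal (I :: ('h \<Rightarrow>\<^sub>L 'h) set)" "I \<noteq> {0}"
  obtains \<xi> where "op_ideal I" "\<xi> \<in> c0_star" "\<xi> 0 \<noteq> 0" "char_set I = principal_set \<xi>"
proof -
  interpret principalideal I BH using I(1) by (simp add: principal_op_ideal_def)
  have J: "op_ideal I" using I(1) is_ideal by (simp add: op_ideal_def principal_op_ideal_def)
  obtain T where T: "T \<in> carrier BH" "I = genideal BH {T}" using generate by blast
  have TI: "T \<in> I" unfolding T(2) using T(1) by (intro genideal_self') 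
  then have Tc: "T \<in> compact_ops" using op_idealD(1)[OF J] by blast
  define \<xi> where "\<xi> = s_numbers T"
  have \<xi>: "\<xi> \<in> c0_star" unfolding \<xi>_def by (rule s_numbers_in_c0_star[OF inf Tc])
  have "principal_set \<xi> \<subseteq> char_set I"
    using TI by (intro principal_set_subset[OF \<xi> calkin_set_char_set[OF inf J]]) (simp add: \<xi>_def char_set_def)
  moreover have "char_set I \<subseteq> principal_set \<xi>"
  proof -
    have "T \<in> ops_of (principal_set \<xi>)" using Tc generator_mem[OF \<xi>] by (simp add: ops_of_def \<xi>_def)
    moreover have "ideal (ops_of (principal_set \<xi>) :: ('h \<Rightarrow>\<^sub>L 'h) set) BH"
      using op_ideal_ops_of[OF inf calkin_set_principal[OF \<xi>]] by (simp add: op_ideal_def)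
    ultimately have "I \<subseteq> ops_of (principal_set \<xi>)" unfolding T(2) by (intro genideal_minimal) simp_all
    then show ?thesis by (auto simp: char_set_def ops_of_def)
  qed
  ultimately have eq: "char_set I = principal_set \<xi>" by simp
  have "\<xi> 0 \<noteq> 0"
  proof
    assume z: "\<xi> 0 = 0"
    have "\<eta> 0 = 0" if \<eta>: "\<eta> \<in> principal_set \<xi>" for \<eta>
    proof -
      obtain m C where "\<eta> \<in> c0_star" "\<And>n. \<eta> n \<le> C * \<xi> (n div m)"
        by (rule principal_setE[OF \<xi> \<eta>]) blast
      from this(2)[of 0] c0_starD(1)[OF this(1), of 0] show ?thesis by (simp add: z)
    qed
    then show False using char_set_zero_iff[OF inf J] I(2) by (simp add: eq)
  qed
  with that J \<xi> eq show ?thesis by blast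
qed

text \<open>The candidate is closed by \<open>pre_post_pre\<close>. That it contains every closed
  ideal below I is \<open>closed_subset_pre_set\<close>, which is where the generator is
  used.\<close>

lemma largest_closed_below_eq:
  assumes I: "op_ideal (I :: ('h \<Rightarrow>\<^sub>L 'h) set)" "I \<noteq> {0}"
    and \<xi>: "\<xi> \<in> c0_star" "\<xi> 0 \<noteq> 0" "char_set I = principal_set \<xi>"
  shows "largest_closed_below I = pre_am_inf I"
  unfolding largest_closed_below_def
proof (rule Greatest_equality)
  note P = pre_am_inf_char[OF I]
  have N: "nontrivial_calkin_set (char_set I)" using I by (simp add: nontrivial_char_set_iff)
  have "char_set (am_inf_closure (pre_am_inf I)) = char_set (pre_am_inf I)"
    using am_inf_closure_char(2)[OF P(1,3)] P(2) pre_post_pre[OF N] by simp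
  then have "pre_am_inf I = am_inf_closure (pre_am_inf I)"
    using char_set_eq_iff[OF inf P(1) am_inf_closure_char(1)[OF P(1,3)]] by simp
  then have "am_inf_closed (pre_am_inf I)" using P(1) by (simp add: am_inf_closed_def)
  moreover have "pre_am_inf I \<subseteq> I"
    using char_set_mono_iff[OF inf P(1) I(1)] P(2) pre_set_subset[OF N] by simp
  ultimately show "am_inf_closed (pre_am_inf I) \<and> pre_am_inf I \<subseteq> I" ..
  fix J assume J: "am_inf_closed J \<and> J \<subseteq> I"
  then have op: "op_ideal J" and cl: "J = am_inf_closure J" and sub: "J \<subseteq> I" by (simp_all add: am_inf_closed_def)
  show "J \<subseteq> pre_am_inf I"
  \<comment> \<open>The descriptions by characteristic sets hold for nonzero ideals, so the zero
    ideal is treated directly.\<close>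
  proof (cases "J = {0}")
    case True
    then show ?thesis using op_idealD(2)[OF P(1)] by simp
  next
    case False
    have "char_set J = pre_set (post_set (char_set J))"
      using am_inf_closure_char(2)[OF op False] cl by simp
    moreover have "char_set J \<subseteq> principal_set \<xi>" using sub char_set_mono_iff[OF inf op I(1)] \<xi>(3) by simp
    ultimately have "char_set J \<subseteq> pre_set (principal_set \<xi>)"
      using closed_subset_pre_set[OF \<xi>(1,2)] nontrivial_char_set_iff[OF op] False by simp
    then show ?thesis using char_set_mono_iff[OF inf op P(1)] P(2) \<xi>(3) by simp
  qed
qed

lemma smallest_open_above_char:
  assumes I: "op_ideal (I :: ('h \<Rightarrow>\<^sub>L 'h) set)" "I \<noteq> {0}"
  shows "op_ideal (smallest_open_above I)" "char_set (smallest_open_above I) = open_hull (char_set I)"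
proof -
  have N: "nontrivial_calkin_set (char_set I)" using I by (simp add: nontrivial_char_set_iff)
  define H where "H = (ideal_with (open_hull (char_set I)) :: ('h \<Rightarrow>\<^sub>L 'h) set)"
  note HN = nontrivial_open_hull[OF N]
  have H: "op_ideal H" "char_set H = open_hull (char_set I)"
    unfolding H_def by (rule calkin_correspondence[OF inf calkin_set_of_nontrivial[OF HN]])+
  have H0: "H \<noteq> {0}" using HN H nontrivial_char_set_iff by metis
  have Is: "op_ideal (I \<inter> se_harmonic)" by (rule op_ideal_Int[OF I(1) se_harmonic_char(1)])
  have Isc: "char_set (I \<inter> se_harmonic) = char_set I \<inter> o_harmonic"
    using char_set_Int[OF inf I(1) se_harmonic_char(1)] se_harmonic_char(2) by simp
  have "smallest_open_above I = H"
    unfolding smallest_open_above_def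
  proof (rule Least_equality)
    have "char_set (am_inf_interior H) = char_set H"
      using am_inf_interior_char(2)[OF H(1) H0] H(2) open_hull_open[OF N] by simp
    then have "H = am_inf_interior H"
      using char_set_eq_iff[OF inf H(1) am_inf_interior_char(1)[OF H(1) H0]] by simp
    then have "am_inf_open H" using H(1) by (simp add: am_inf_open_def)
    moreover have "I \<inter> se_harmonic \<subseteq> H"
      using char_set_mono_iff[OF inf Is H(1)] Isc H(2) subset_open_hull[OF N] by simp
    ultimately show "am_inf_open H \<and> I \<inter> se_harmonic \<subseteq> H" ..
    fix J assume J: "am_inf_open J \<and> I \<inter> se_harmonic \<subseteq> J"
    then have op: "op_ideal J" and opn: "J = am_inf_interior J" and sub: "I \<inter> se_harmonic \<subseteq> J"
      by (simp_all add: am_inf_open_def)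
    have s: "char_set I \<inter> o_harmonic \<subseteq> char_set J"
      using char_set_mono_iff[OF inf Is op] Isc sub by simp
    \<comment> \<open>A common nonzero member, which forces every competitor J to be nonzero and so
      open in terms of its characteristic set.\<close>
    have "unit_seq \<in> char_set I \<inter> o_harmonic"
    proof
      show "unit_seq \<in> char_set I"
        by (rule eventually_dominated_mem[OF N calkin_setD(2)[OF calkin_set_of_nontrivial[OF N]] l1_starD(1)[OF unit_seq_l1], of 1])
          (simp add: unit_seq_def)
      show "unit_seq \<in> o_harmonic" using l1_subset_o_harmonic unit_seq_l1 by blast
    qed
    then have "unit_seq \<in> char_set J" using s by blast
    then have J0: "nontrivial_calkin_set (char_set J)"
      by (rule nontrivial_calkin_setI[OF calkin_set_char_set[OF inf op]]) (simp add: unit_seq_def)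
    then have "J \<noteq> {0}" using nontrivial_char_set_iff[OF op] by simp
    then have "char_set J = post_set (pre_set (char_set J))" using am_inf_interior_char(2)[OF op] opn by simp
    then have "char_set H \<subseteq> char_set J" unfolding H(2) by (intro open_hull_least[OF N J0] s)
    then show "H \<subseteq> J" using char_set_mono_iff[OF inf H(1) op] by simp
  qed
  then show "op_ideal (smallest_open_above I)" "char_set (smallest_open_above I) = open_hull (char_set I)"
    using H by simp_all
qed

end

section \<open>Equivalence of the seven stabilities\<close>

theorem theorem5p2:
  fixes I :: "('h::complex_hilbert \<Rightarrow>\<^sub>L 'h) set"
  assumes separable: "separable_space (euclidean :: 'h topology)"
    and infinite_dim: "\<nexists>B :: 'h set. finite B \<and> cspan B = UNIV"
    and principal: "principal_op_ideal I"
    and nonzero: "I \<noteq> {0}"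
  shows "\<forall>J \<in> {I, pre_am_inf I, am_inf_interior I, largest_closed_below I,
                smallest_open_above I, am_inf_ideal I, am_inf_closure I}.
         \<forall>K \<in> {I, pre_am_inf I, am_inf_interior I, largest_closed_below I,
                smallest_open_above I, am_inf_ideal I, am_inf_closure I}.
           am_inf_stable J \<longleftrightarrow> am_inf_stable K"
proof -
  obtain \<xi> where I: "op_ideal I" and \<xi>: "\<xi> \<in> c0_star" "\<xi> 0 \<noteq> 0" "char_set I = principal_set \<xi>"
    by (rule principal_op_ideal_char[OF infinite_dim principal nonzero])
  define S where "S = char_set I"
  have S: "nontrivial_calkin_set S" and S\<xi>: "S = principal_set \<xi>"
    using nontrivial_char_set_iff[OF infinite_dim I] nonzero \<xi>(3) by (simp_all add: S_def)
  define stable where "stable \<longleftrightarrow> S = pre_set S"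
  \<comment> \<open>Each derived set X is compared with S only: its stability must imply that of S,
    and it must equal S once S is stable.\<close>
  have iff: "am_inf_stable J \<longleftrightarrow> stable"
    if "op_ideal J" "char_set J = X" "nontrivial_calkin_set X" "X = pre_set X \<Longrightarrow> stable" "stable \<Longrightarrow> X = S"
    for J :: "('h \<Rightarrow>\<^sub>L 'h) set" and X
  proof -
    have "J \<noteq> {0}" using nontrivial_char_set_iff[OF infinite_dim that(1)] that(2,3) by simp
    then have "am_inf_stable J \<longleftrightarrow> X = pre_set X"
      using am_inf_stable_iff[OF infinite_dim that(1)] that(2) by simp
    moreover have "X = pre_set X" if stable using that \<open>stable \<Longrightarrow> X = S\<close> by (simp add: stable_def)
    ultimately show ?thesis using that(4) by blast
  qed
  have pre: "stable" if "pre_set S = pre_set (pre_set S)"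
    using stable_if_pre_stable[OF \<xi>(1,2)] that by (simp add: S\<xi> stable_def)
  have post: "stable" if "post_set S = pre_set (post_set S)"
    using stable_if_post_stable[OF \<xi>(1,2)] that by (simp add: S\<xi> stable_def)
  have post_eq: "post_set S = S" if stable
    using stable_imp_post_eq[OF S] that by (simp add: stable_def)
  note chars = pre_am_inf_char[OF infinite_dim I nonzero] am_inf_ideal_char[OF infinite_dim I nonzero]
    am_inf_closure_char[OF infinite_dim I nonzero] am_inf_interior_char[OF infinite_dim I nonzero]
    smallest_open_above_char[OF infinite_dim I nonzero]
  have 1: "am_inf_stable I \<longleftrightarrow> stable"
    by (rule iff[OF I S_def[symmetric] S]) (simp_all add: stable_def)
  have 2: "am_inf_stable (pre_am_inf I) \<longleftrightarrow> stable"
    by (rule iff[OF chars(1) chars(2)[folded S_def] nontrivial_pre_set[OF S] pre]) (simp_all add: stable_def)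
  have 3: "am_inf_stable (am_inf_interior I) \<longleftrightarrow> stable"
  proof (rule iff[OF chars(9) chars(10)[folded S_def] nontrivial_post_set[OF nontrivial_pre_set[OF S]]])
    assume st: "post_set (pre_set S) = pre_set (post_set (pre_set S))"
    \<comment> \<open>The \<open>pre_set\<close> of the interior is that of S, so a stable interior
      is \<open>pre_set S\<close> itself.\<close>
    then have "post_set (pre_set S) = pre_set S" using pre_post_pre[OF S] by simp
    then show stable using st by (intro pre) simp
  next
    assume stable
    then show "post_set (pre_set S) = S" using post_eq by (simp add: stable_def)
  qed
  have 4: "am_inf_stable (largest_closed_below I) \<longleftrightarrow> stable"
    using 2 largest_closed_below_eq[OF infinite_dim I nonzero \<xi>] by simp
  have 5: "am_inf_stable (smallest_open_above I) \<longleftrightarrow> stable"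
  proof (rule iff[OF chars(11) chars(12)[folded S_def] nontrivial_open_hull[OF S]])
    show stable if "open_hull S = pre_set (open_hull S)"
      using stable_if_open_hull_stable[OF \<xi>(1,2)] that by (simp add: S\<xi> stable_def)
    show "open_hull S = S" if stable using stable_imp_open_hull_eq[OF S] that by (simp add: stable_def)
  qed
  have 6: "am_inf_stable (am_inf_ideal I) \<longleftrightarrow> stable"
    by (rule iff[OF chars(4) chars(5)[folded S_def] nontrivial_post_set[OF S] post post_eq])
  have 7: "am_inf_stable (am_inf_closure I) \<longleftrightarrow> stable"
  proof (rule iff[OF chars(7) chars(8)[folded S_def] nontrivial_pre_set[OF nontrivial_post_set[OF S]]])
    assume st: "pre_set (post_set S) = pre_set (pre_set (post_set S))"
    have "post_set (pre_set (post_set S)) = pre_set (post_set S)"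
      by (rule stable_imp_post_eq[OF nontrivial_pre_set[OF nontrivial_post_set[OF S]] st])
    then show stable using post_pre_post[OF S] by (intro post) simp
  next
    assume stable
    then show "pre_set (post_set S) = S" using post_eq by (simp add: stable_def)
  qed
  show ?thesis by (simp add: 1 2 3 4 5 6 7)
qed

end
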